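(* Let $\mathbb{X}\subseteq\mathbb{P}^n$ be a $0$-dimensional scheme and let $\{F_1,\dots,F_r\}$ be a homogeneous system of generators of $I_{\mathbb{X}}$. There is an isomorphism of graded $R_{\mathbb{X}}$-modules $$\Omega^{n+1}_{R_{\mathbb{X}}/K}\;\cong\;\Big(S/\Big\langle \tfrac{\partial F_j}{\partial X_i}\;\Big|\;0\le i\le n,\ 1\le j\le r\Big\rangle\Big)(-n-1).$$
   Context: $K$ is a field of characteristic zero, $S=K[X_0,\dots,X_n]$ ($n\ge 1$) with the standard grading is the homogeneous coordinate ring of $\mathbb{P}^n$ over $K$. For a $0$-dimensional subscheme $\mathbb{X}\subseteq\mathbb{P}^n$, $I_{\mathbb{X}}\subseteq S$ is its saturated homogeneous vanishing ideal, $R_{\mathbb{X}}=S/I_{\mathbb{X}}$, and $x_i$ is the image of $X_i$ in $R_{\mathbb{X}}$. $\Omega^1_{R_{\mathbb{X}}/K}$ is the module of Kähler differentials of $R_{\mathbb{X}}/K$, a graded $R_{\mathbb{X}}$-module with $\deg(dx_i)=1$, and $\Omega^m_{R_{\mathbb{X}}/K}=\bigwedge^m_{R_{\mathbb{X}}}\Omega^1_{R_{\mathbb{X}}/K}$. For a graded module $M$, $M(a)$ denotes the shift $M(a)_i=M_{a+i}$. *)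

theory Defs
  imports
    "HOL-Library.Poly_Mapping"
    "HOL-Algebra.Module"
    "HOL-Algebra.QuotRing"
    "HOL-Algebra.Generated_Groups"
begin

section \<open>The polynomial ring \<open>S = K[X_0, ..., X_n]\<close>\<close>

text \<open>
  Exponent vectors are finitely supported functions, so the type \<open>'k mpoly\<close> has a variable
  \<open>X_i\<close> for every natural number \<open>i\<close>; \<open>coord_ring n\<close> restricts to the variables with \<open>i \<le> n\<close>.
\<close>

type_synonym 'k mpoly = "(nat \<Rightarrow>\<^sub>0 nat) \<Rightarrow>\<^sub>0 'k"

definition const_poly :: "'k::comm_ring_1 \<Rightarrow> 'k mpoly" where
  "const_poly c = Poly_Mapping.single 0 c"

definition var_poly :: "nat \<Rightarrow> 'k::comm_ring_1 mpoly" where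
  "var_poly i = Poly_Mapping.single (Poly_Mapping.single i 1) 1"

definition coord_ring :: "nat \<Rightarrow> 'k::comm_ring_1 mpoly ring" where
  "coord_ring n =
    \<lparr>carrier = {p. \<forall>m\<in>Poly_Mapping.keys p. Poly_Mapping.keys m \<subseteq> {..n}},
     mult = (*), one = 1, zero = 0, add = (+)\<rparr>"

definition forms :: "nat \<Rightarrow> int \<Rightarrow> 'k::comm_ring_1 mpoly set" where
  "forms n d = {p \<in> carrier (coord_ring n).
     \<forall>m\<in>Poly_Mapping.keys p. int (\<Sum>i\<le>n. Poly_Mapping.lookup m i) = d}"

text \<open>
  If \<open>X_i\<close> does not occur in \<open>m\<close>, the truncated difference of exponents below is harmless,
  because the coefficient is then zero.
\<close>

definition partial :: "nat \<Rightarrow> 'k::comm_ring_1 mpoly \<Rightarrow> 'k mpoly" where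
  "partial i p = (\<Sum>m\<in>Poly_Mapping.keys p.
     Poly_Mapping.single (m - Poly_Mapping.single i 1)
       (of_nat (Poly_Mapping.lookup m i) * Poly_Mapping.lookup p m))"

section \<open>Zero-dimensional subschemes of projective space\<close>

definition homogeneous :: "nat \<Rightarrow> 'k::comm_ring_1 mpoly \<Rightarrow> bool" where
  "homogeneous n p \<longleftrightarrow> (\<exists>d. p \<in> forms n d)"

definition homogeneous_ideal :: "nat \<Rightarrow> 'k::comm_ring_1 mpoly set \<Rightarrow> bool" where
  "homogeneous_ideal n I \<longleftrightarrow>
     ideal I (coord_ring n) \<and> I = genideal (coord_ring n) {p \<in> I. homogeneous n p}"

definition saturated :: "nat \<Rightarrow> 'k::comm_ring_1 mpoly set \<Rightarrow> bool" where
  "saturated n I \<longleftrightarrow>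
     (\<forall>p\<in>carrier (coord_ring n). (\<forall>i\<le>n. \<exists>k. var_poly i ^ k * p \<in> I) \<longrightarrow> p \<in> I)"

text \<open>
  The points of \<open>Proj(S/I)\<close>, that is, of the closed subscheme of projective space cut out by
  the homogeneous ideal \<open>I\<close>.
\<close>

definition proj_points :: "nat \<Rightarrow> 'k::comm_ring_1 mpoly set \<Rightarrow> 'k mpoly set set" where
  "proj_points n I = {P. primeideal P (coord_ring n) \<and> homogeneous_ideal n P \<and>
     I \<subseteq> P \<and> \<not> (\<forall>i\<le>n. var_poly i \<in> P)}"

text \<open>
  Irreducible closed subsets of \<open>Proj(S/I)\<close> are the closures of its points, so chains of them
  are chains of points under inclusion. The empty scheme has no dimension in the sense below;
  in particular it is not zero-dimensional.
\<close>

definition has_point_chain :: "nat \<Rightarrow> 'k::comm_ring_1 mpoly set \<Rightarrow> nat \<Rightarrow> bool" where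
  "has_point_chain n I d \<longleftrightarrow>
     (\<exists>P. (\<forall>i\<le>d. P i \<in> proj_points n I) \<and> (\<forall>i<d. P i \<subset> P (Suc i)))"

definition proj_dim_is :: "nat \<Rightarrow> 'k::comm_ring_1 mpoly set \<Rightarrow> nat \<Rightarrow> bool" where
  "proj_dim_is n I d \<longleftrightarrow> has_point_chain n I d \<and> \<not> has_point_chain n I (Suc d)"

text \<open>
  Closed subschemes \<open>X\<close> of projective space over \<open>K\<close> correspond bijectively to saturated
  homogeneous ideals of \<open>S\<close> via \<open>X \<mapsto> I_X\<close>; a subscheme is represented by \<open>I_X\<close>.
\<close>

definition zero_dim_subscheme :: "nat \<Rightarrow> 'k::comm_ring_1 mpoly set \<Rightarrow> bool" where
  "zero_dim_subscheme n I \<longleftrightarrow> homogeneous_ideal n I \<and> saturated n I \<and> proj_dim_is n I 0"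

section \<open>Modules by generators and relations\<close>

definition free_module :: "('r, 'm) ring_scheme \<Rightarrow> 'x set \<Rightarrow> ('r, 'x \<Rightarrow> 'r) module" where
  "free_module R X =
    \<lparr>carrier = {f. (\<forall>x\<in>X. f x \<in> carrier R) \<and> (\<forall>x. x \<notin> X \<longrightarrow> f x = \<zero>\<^bsub>R\<^esub>) \<and>
                   finite {x. f x \<noteq> \<zero>\<^bsub>R\<^esub>}},
     mult = undefined, one = undefined,
     zero = (\<lambda>_. \<zero>\<^bsub>R\<^esub>),
     add = (\<lambda>f g x. f x \<oplus>\<^bsub>R\<^esub> g x),
     smult = (\<lambda>r f x. r \<otimes>\<^bsub>R\<^esub> f x)\<rparr>"

definition basis_elt :: "('r, 'm) ring_scheme \<Rightarrow> 'x \<Rightarrow> 'x \<Rightarrow> 'r" where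
  "basis_elt R x = (\<lambda>y. if y = x then \<one>\<^bsub>R\<^esub> else \<zero>\<^bsub>R\<^esub>)"

definition submodule_span ::
  "('r, 'm) ring_scheme \<Rightarrow> ('r, 'a, 'n) module_scheme \<Rightarrow> 'a set \<Rightarrow> 'a set" where
  "submodule_span R M A = \<Inter>{N. submodule N R M \<and> A \<subseteq> N}"

definition quot_module :: "('r, 'a, 'n) module_scheme \<Rightarrow> 'a set \<Rightarrow> ('r, 'a set) module" where
  "quot_module M N =
    \<lparr>carrier = a_rcosets\<^bsub>M\<^esub> N,
     mult = undefined, one = undefined,
     zero = N,
     add = set_add M,
     smult = (\<lambda>r A. \<Union>x\<in>A. N +>\<^bsub>M\<^esub> (r \<odot>\<^bsub>M\<^esub> x))\<rparr>"

section \<open>Kaehler differentials and exterior powers\<close>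

text \<open>
  In the following, \<open>R\<close> is an algebra over some ring \<open>k\<close>, and \<open>k\<close> enters only through the
  image \<open>C\<close> of its structure map in \<open>R\<close>. The module of differentials is presented by the
  generators \<open>d a\<close> for all \<open>a\<close> in \<open>R\<close> and the relations of a \<open>k\<close>-linear derivation; linearity
  follows from the Leibniz rule and \<open>d c = 0\<close> for \<open>c\<close> in \<open>C\<close>.
\<close>

definition kaehler_rels :: "('r, 'm) ring_scheme \<Rightarrow> 'r set \<Rightarrow> ('r \<Rightarrow> 'r) set" where
  "kaehler_rels R C = (let F = free_module R (carrier R); \<delta> = basis_elt R in
     {\<delta> (a \<oplus>\<^bsub>R\<^esub> b) \<ominus>\<^bsub>F\<^esub> (\<delta> a \<oplus>\<^bsub>F\<^esub> \<delta> b) | a b. a \<in> carrier R \<and> b \<in> carrier R} \<union>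
     {\<delta> (a \<otimes>\<^bsub>R\<^esub> b) \<ominus>\<^bsub>F\<^esub> (a \<odot>\<^bsub>F\<^esub> \<delta> b \<oplus>\<^bsub>F\<^esub> b \<odot>\<^bsub>F\<^esub> \<delta> a) | a b. a \<in> carrier R \<and> b \<in> carrier R} \<union>
     {\<delta> c | c. c \<in> C})"

definition kaehler_span :: "('r, 'm) ring_scheme \<Rightarrow> 'r set \<Rightarrow> ('r \<Rightarrow> 'r) set" where
  "kaehler_span R C = submodule_span R (free_module R (carrier R)) (kaehler_rels R C)"

definition kaehler :: "('r, 'm) ring_scheme \<Rightarrow> 'r set \<Rightarrow> ('r, ('r \<Rightarrow> 'r) set) module" where
  "kaehler R C = quot_module (free_module R (carrier R)) (kaehler_span R C)"

definition kaehler_d :: "('r, 'm) ring_scheme \<Rightarrow> 'r set \<Rightarrow> 'r \<Rightarrow> ('r \<Rightarrow> 'r) set" where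
  "kaehler_d R C a = kaehler_span R C +>\<^bsub>free_module R (carrier R)\<^esub> basis_elt R a"

text \<open>
  The \<open>m\<close>-th exterior power of \<open>M\<close> is presented by the generators \<open>x_1 \<and> ... \<and> x_m\<close>, indexed
  by lists of length \<open>m\<close> over \<open>M\<close>, and the relations saying that they are multilinear and
  alternating in \<open>x_1, ..., x_m\<close>.
\<close>

definition tuples :: "nat \<Rightarrow> 'a set \<Rightarrow> 'a list set" where
  "tuples m A = {xs. length xs = m \<and> set xs \<subseteq> A}"

definition ext_rels ::
  "('r, 'm) ring_scheme \<Rightarrow> nat \<Rightarrow> ('r, 'a, 'n) module_scheme \<Rightarrow> ('a list \<Rightarrow> 'r) set" where
  "ext_rels R m M = (let T = tuples m (carrier M); F = free_module R T; \<epsilon> = basis_elt R in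
     {\<epsilon> (xs[i := x \<oplus>\<^bsub>M\<^esub> y]) \<ominus>\<^bsub>F\<^esub> (\<epsilon> (xs[i := x]) \<oplus>\<^bsub>F\<^esub> \<epsilon> (xs[i := y])) | xs i x y.
        xs \<in> T \<and> i < m \<and> x \<in> carrier M \<and> y \<in> carrier M} \<union>
     {\<epsilon> (xs[i := r \<odot>\<^bsub>M\<^esub> x]) \<ominus>\<^bsub>F\<^esub> (r \<odot>\<^bsub>F\<^esub> \<epsilon> (xs[i := x])) | xs i r x.
        xs \<in> T \<and> i < m \<and> r \<in> carrier R \<and> x \<in> carrier M} \<union>
     {\<epsilon> xs | xs. xs \<in> T \<and> (\<exists>i j. i < j \<and> j < m \<and> xs ! i = xs ! j)})"

definition ext_span ::
  "('r, 'm) ring_scheme \<Rightarrow> nat \<Rightarrow> ('r, 'a, 'n) module_scheme \<Rightarrow> ('a list \<Rightarrow> 'r) set" where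
  "ext_span R m M = submodule_span R (free_module R (tuples m (carrier M))) (ext_rels R m M)"

definition ext_power ::
  "('r, 'm) ring_scheme \<Rightarrow> nat \<Rightarrow> ('r, 'a, 'n) module_scheme \<Rightarrow> ('r, ('a list \<Rightarrow> 'r) set) module" where
  "ext_power R m M = quot_module (free_module R (tuples m (carrier M))) (ext_span R m M)"

definition wedge ::
  "('r, 'm) ring_scheme \<Rightarrow> nat \<Rightarrow> ('r, 'a, 'n) module_scheme \<Rightarrow> 'a list \<Rightarrow> ('a list \<Rightarrow> 'r) set" where
  "wedge R m M xs = ext_span R m M +>\<^bsub>free_module R (tuples m (carrier M))\<^esub> basis_elt R xs"

section \<open>Gradings\<close>

text \<open>
  A \<open>\<int>\<close>-grading of a module is the family of its homogeneous components. On differentials and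
  exterior powers the components are those of the canonical grading: \<open>d\<close> preserves degrees (so
  the differentials of the coordinate functions have degree 1), and the degree of a wedge
  product is the sum of the degrees of its factors.
\<close>

definition kaehler_grading ::
  "('r, 'm) ring_scheme \<Rightarrow> 'r set \<Rightarrow> (int \<Rightarrow> 'r set) \<Rightarrow> int \<Rightarrow> ('r \<Rightarrow> 'r) set set" where
  "kaehler_grading R C gR d = generate (add_monoid (kaehler R C))
     {a \<odot>\<^bsub>kaehler R C\<^esub> kaehler_d R C b | a b i j. a \<in> gR i \<and> b \<in> gR j \<and> i + j = d}"

definition ext_grading ::
  "('r, 'm) ring_scheme \<Rightarrow> (int \<Rightarrow> 'r set) \<Rightarrow> nat \<Rightarrow> ('r, 'a, 'n) module_scheme \<Rightarrow>
   (int \<Rightarrow> 'a set) \<Rightarrow> int \<Rightarrow> ('a list \<Rightarrow> 'r) set set" where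
  "ext_grading R gR m M gM d = generate (add_monoid (ext_power R m M))
     {a \<odot>\<^bsub>ext_power R m M\<^esub> wedge R m M xs | a xs i ds.
        a \<in> gR i \<and> length xs = m \<and> length ds = m \<and> (\<forall>l<m. xs ! l \<in> gM (ds ! l)) \<and>
        i + sum_list ds = d}"

definition shift :: "int \<Rightarrow> (int \<Rightarrow> 'a set) \<Rightarrow> int \<Rightarrow> 'a set" where
  "shift a gM i = gM (a + i)"

definition graded_module ::
  "('r, 'm) ring_scheme \<Rightarrow> (int \<Rightarrow> 'r set) \<Rightarrow> ('r, 'a, 'n) module_scheme \<Rightarrow> (int \<Rightarrow> 'a set) \<Rightarrow> bool"
  where
  "graded_module R gR M gM \<longleftrightarrow>
     module R M \<and>
     (\<forall>d. additive_subgroup (gM d) M) \<and>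
     (\<forall>i j. \<forall>a\<in>gR i. \<forall>x\<in>gM j. a \<odot>\<^bsub>M\<^esub> x \<in> gM (i + j)) \<and>
     (\<forall>x\<in>carrier M. \<exists>!c. (\<forall>d. c d \<in> gM d) \<and> finite {d. c d \<noteq> \<zero>\<^bsub>M\<^esub>} \<and>
        x = finsum M c {d. c d \<noteq> \<zero>\<^bsub>M\<^esub>})"

definition graded_isomorphic ::
  "('r, 'm) ring_scheme \<Rightarrow> (int \<Rightarrow> 'r set) \<Rightarrow>
   ('r, 'a, 'n) module_scheme \<Rightarrow> (int \<Rightarrow> 'a set) \<Rightarrow>
   ('r, 'b, 'l) module_scheme \<Rightarrow> (int \<Rightarrow> 'b set) \<Rightarrow> bool" where
  "graded_isomorphic R gR M gM N gN \<longleftrightarrow>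
     graded_module R gR M gM \<and> graded_module R gR N gN \<and>
     (\<exists>\<phi>. bij_betw \<phi> (carrier M) (carrier N) \<and>
        (\<forall>x\<in>carrier M. \<forall>y\<in>carrier M. \<phi> (x \<oplus>\<^bsub>M\<^esub> y) = \<phi> x \<oplus>\<^bsub>N\<^esub> \<phi> y) \<and>
        (\<forall>a\<in>carrier R. \<forall>x\<in>carrier M. \<phi> (a \<odot>\<^bsub>M\<^esub> x) = a \<odot>\<^bsub>N\<^esub> \<phi> x) \<and>
        (\<forall>d. \<phi> ` gM d = gN d))"

section \<open>The homogeneous coordinate ring and its differentials\<close>

definition RX :: "nat \<Rightarrow> 'k::comm_ring_1 mpoly set \<Rightarrow> 'k mpoly set ring" where
  "RX n I = coord_ring n Quot I"

definition RX_consts :: "nat \<Rightarrow> 'k::comm_ring_1 mpoly set \<Rightarrow> 'k mpoly set set" where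
  "RX_consts n I = {I +>\<^bsub>coord_ring n\<^esub> const_poly c | c. True}"

definition quot_grading :: "nat \<Rightarrow> 'k::comm_ring_1 mpoly set \<Rightarrow> int \<Rightarrow> 'k mpoly set set" where
  "quot_grading n I d = {I +>\<^bsub>coord_ring n\<^esub> p | p. p \<in> forms n d}"

definition Omega1 ::
  "nat \<Rightarrow> 'k::comm_ring_1 mpoly set \<Rightarrow> ('k mpoly set, ('k mpoly set \<Rightarrow> 'k mpoly set) set) module"
  where
  "Omega1 n I = kaehler (RX n I) (RX_consts n I)"

definition Omega1_grading where
  "Omega1_grading n I = kaehler_grading (RX n I) (RX_consts n I) (quot_grading n I)"

definition Omega where
  "Omega m n I = ext_power (RX n I) m (Omega1 n I)"

definition Omega_grading where
  "Omega_grading m n I =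
     ext_grading (RX n I) (quot_grading n I) m (Omega1 n I) (Omega1_grading n I)"

text \<open>
  \<open>S/J\<close> as a module over \<open>S/I\<close>, where \<open>I \<subseteq> J\<close>: the scalar multiplication
  \<open>(a + I) \<cdot> (b + J) = a * b + J\<close> is written as the union of the cosets \<open>a * b + J\<close> over all
  representatives \<open>a\<close> and \<open>b\<close>. These cosets coincide exactly because \<open>I \<subseteq> J\<close>.
\<close>

definition quot_as_module :: "nat \<Rightarrow> 'k::comm_ring_1 mpoly set \<Rightarrow> ('k mpoly set, 'k mpoly set) module"
  where
  "quot_as_module n J =
    \<lparr>carrier = carrier (coord_ring n Quot J),
     mult = undefined, one = undefined,
     zero = \<zero>\<^bsub>coord_ring n Quot J\<^esub>,
     add = add (coord_ring n Quot J),
     smult = rcoset_mult (coord_ring n) J\<rparr>"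

definition jacobian_ideal :: "nat \<Rightarrow> nat \<Rightarrow> (nat \<Rightarrow> 'k::comm_ring_1 mpoly) \<Rightarrow> 'k mpoly set" where
  "jacobian_ideal n r F =
     genideal (coord_ring n) {partial i (F j) | i j. i \<le> n \<and> j \<in> {1..r}}"

end

theory Submission
  imports "Jordan_Normal_Form.Determinant" Defs
begin

text \<open>
  Let \<open>J\<close> be the ideal of the partial derivatives. By Euler's identity \<open>I \<subseteq> J\<close>, so each \<open>\<partial>/\<partial>X_i\<close>
  descends to a derivation from \<open>R = S/I\<close> to \<open>S/J\<close> and hence to a linear map \<open>\<delta>_i\<close> on the
  differentials of \<open>R\<close>. The Jacobian determinant \<open>\<omega>_0 \<and> ... \<and> \<omega>_n \<mapsto> det (\<delta>_j \<omega>_i)\<close> is then a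
  well-defined linear map \<open>\<phi>\<close> from the top exterior power to \<open>S/J\<close>, sending
  \<open>\<omega> = dx_0 \<and> ... \<and> dx_n\<close> to \<open>1\<close>. As \<open>\<omega>\<close> generates the exterior power, \<open>\<phi>\<close> is bijective once
  \<open>J\<close> annihilates \<open>\<omega>\<close>; and \<open>\<partial>F/\<partial>X_i \<cdot> \<omega>\<close> vanishes for \<open>F \<in> I\<close> because
  \<open>\<Sum>_l \<partial>F/\<partial>X_l \<cdot> dx_l = dF = 0\<close>. Every \<open>\<delta>_j\<close> lowers degrees by one, whence the shift.
\<close>

section \<open>Modules by generators and relations\<close>

text \<open>The exterior power is known only by generators and relations. Linear maps out of it are
  easy to define, but that an element is nonzero can only be detected through such a map. Hence the
  two halves: \<open>\<phi>\<close> shows that \<omega> has no annihilators outside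
  \<open>J\<close>, the relations show that \<open>J\<close> does annihilate it, and
  \<open>\<phi>\<close> becomes the inverse of p \<mapsto> p \<omega>. S/J is a set of cosets and
  not a type, while the determinant used is that of a matrix over a commutative ring type.
  Determinants are therefore taken of polynomial representatives, and independence of their choice
  modulo \<open>J\<close> is proved separately. An isomorphism of graded modules includes the direct
  sum decomposition of both sides. On S/J it holds because \<open>J\<close> is generated by forms;
  on the exterior power it is carried back along \<open>\<phi>\<close> instead of being derived from
  the presentation. The inclusion of \<open>I\<close> in \<open>J\<close> depends on
  \<open>I\<close> being proper: a nonzero constant among the generators would generate S, although
  all its derivatives vanish. Properness comes from the existence of a point of the scheme.\<close>

definition linear_maps ::
  "('r, 'm) ring_scheme \<Rightarrow> ('r, 'a, 'n) module_scheme \<Rightarrow> ('r, 'b, 'l) module_scheme \<Rightarrow> ('a \<Rightarrow> 'b) set" where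
  "linear_maps R M N = {h \<in> carrier M \<rightarrow> carrier N.
     (\<forall>x\<in>carrier M. \<forall>y\<in>carrier M. h (x \<oplus>\<^bsub>M\<^esub> y) = h x \<oplus>\<^bsub>N\<^esub> h y) \<and>
     (\<forall>a\<in>carrier R. \<forall>x\<in>carrier M. h (a \<odot>\<^bsub>M\<^esub> x) = a \<odot>\<^bsub>N\<^esub> h x)}"

lemma linear_mapsD:
  assumes "h \<in> linear_maps R M N"
  shows "x \<in> carrier M \<Longrightarrow> h x \<in> carrier N"
    and "x \<in> carrier M \<Longrightarrow> y \<in> carrier M \<Longrightarrow> h (x \<oplus>\<^bsub>M\<^esub> y) = h x \<oplus>\<^bsub>N\<^esub> h y"
    and "a \<in> carrier R \<Longrightarrow> x \<in> carrier M \<Longrightarrow> h (a \<odot>\<^bsub>M\<^esub> x) = a \<odot>\<^bsub>N\<^esub> h x"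
  using assms by (auto simp: linear_maps_def)

lemma linear_map_abelian_group_hom:
  assumes "module R M" "module R N" "h \<in> linear_maps R M N"
  shows "abelian_group_hom M N h"
proof -
  interpret M: module R M by fact
  interpret N: module R N by fact
  show ?thesis
    using assms(3) by (intro abelian_group_homI M.abelian_group_axioms N.abelian_group_axioms group_hom.intro
        group_hom_axioms.intro)
      (auto simp: linear_maps_def hom_def M.add.is_group N.add.is_group)
qed

lemma linear_map_zero:
  assumes "module R M" "module R N" "h \<in> linear_maps R M N"
  shows "h \<zero>\<^bsub>M\<^esub> = \<zero>\<^bsub>N\<^esub>"
  using abelian_group_hom.hom_zero[OF linear_map_abelian_group_hom[OF assms]] .

lemma linear_map_minus:
  assumes "module R M" "module R N" "h \<in> linear_maps R M N" "x \<in> carrier M" "y \<in> carrier M"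
  shows "h (x \<ominus>\<^bsub>M\<^esub> y) = h x \<ominus>\<^bsub>N\<^esub> h y"
proof -
  interpret abelian_group_hom M N h by (rule linear_map_abelian_group_hom) fact+
  show ?thesis using assms by (simp add: a_minus_def)
qed

lemma linear_map_finsum:
  assumes "module R M" "module R N" "h \<in> linear_maps R M N" "finite A" "f \<in> A \<rightarrow> carrier M"
  shows "h (finsum M f A) = finsum N (\<lambda>x. h (f x)) A"
proof -
  interpret M: module R M by fact
  interpret N: module R N by fact
  show ?thesis using assms(4,5)
  proof (induction A)
    case empty
    show ?case using linear_map_zero[OF assms(1-3)] by simp
  next
    case (insert x A)
    then have "f \<in> A \<rightarrow> carrier M" "f x \<in> carrier M" by auto
    moreover from this have "(\<lambda>x. h (f x)) \<in> A \<rightarrow> carrier N" "h (f x) \<in> carrier N"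
      using linear_mapsD(1)[OF assms(3)] by auto
    ultimately show ?case
      using insert assms(3) by (simp add: linear_mapsD(2))
  qed
qed

section \<open>Submodules and generation\<close>

lemma submodule_zero_closed: "submodule H R M \<Longrightarrow> \<zero>\<^bsub>M\<^esub> \<in> H"
  using subgroup.one_closed[OF submodule.axioms(1)] by fastforce

text \<open>Generation arguments rest on this: to see that \<open>h\<close> sends a whole module
  into \<open>H\<close>, it is enough to look at generators.\<close>

lemma submodule_vimage:
  assumes "module R M" "module R N" "h \<in> linear_maps R M N" "submodule H R N"
  shows "submodule {x \<in> carrier M. h x \<in> H} R M"
proof -
  interpret M: module R M by fact
  interpret N: module R N by fact
  interpret abelian_group_hom M N h by (rule linear_map_abelian_group_hom) fact+
  note H = N.submoduleE[OF assms(4)]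
  show ?thesis
    using H submodule_zero_closed[OF assms(4)] assms(3) by (intro M.submoduleI) (auto simp: linear_mapsD)
qed

lemma (in module) submodule_zero: "submodule {\<zero>\<^bsub>M\<^esub>} R M"
  by (intro submoduleI) auto

text \<open>Taken at \<omega>, this turns "generated by \<omega>" into "a single multiple of
  \<omega>", with no sums left over.\<close>

lemma (in module) cyclic_submodule:
  assumes x: "x \<in> carrier M"
  shows "submodule ((\<lambda>a. a \<odot>\<^bsub>M\<^esub> x) ` carrier R) R M"
proof (rule submoduleI)
  show "(\<lambda>a. a \<odot>\<^bsub>M\<^esub> x) ` carrier R \<subseteq> carrier M"
    by (rule image_subsetI) (rule smult_closed[OF _ x])
  show "\<zero>\<^bsub>M\<^esub> \<in> (\<lambda>a. a \<odot>\<^bsub>M\<^esub> x) ` carrier R"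
    by (rule image_eqI, rule smult_l_null[OF x, symmetric], rule R.zero_closed)
next
  fix y assume "y \<in> (\<lambda>a. a \<odot>\<^bsub>M\<^esub> x) ` carrier R"
  then obtain b where b: "b \<in> carrier R" "y = b \<odot>\<^bsub>M\<^esub> x" by (rule imageE)
  show "\<ominus>\<^bsub>M\<^esub> y \<in> (\<lambda>a. a \<odot>\<^bsub>M\<^esub> x) ` carrier R"
    unfolding b(2) by (rule image_eqI, rule smult_l_minus[OF b(1) x, symmetric], rule R.a_inv_closed[OF b(1)])
  show "r \<odot>\<^bsub>M\<^esub> y \<in> (\<lambda>a. a \<odot>\<^bsub>M\<^esub> x) ` carrier R" if "r \<in> carrier R" for r
    unfolding b(2)
    by (rule image_eqI, rule smult_assoc1[OF that b(1) x, symmetric], rule R.m_closed[OF that b(1)])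
  fix z assume "z \<in> (\<lambda>a. a \<odot>\<^bsub>M\<^esub> x) ` carrier R"
  then obtain c where c: "c \<in> carrier R" "z = c \<odot>\<^bsub>M\<^esub> x" by (rule imageE)
  show "y \<oplus>\<^bsub>M\<^esub> z \<in> (\<lambda>a. a \<odot>\<^bsub>M\<^esub> x) ` carrier R"
    unfolding b(2) c(2)
    by (rule image_eqI, rule smult_l_distr[OF b(1) c(1) x, symmetric], rule R.a_closed[OF b(1) c(1)])
qed

lemma submodule_finsum:
  assumes M: "module R M" and H: "submodule H R M" and "finite A" "f \<in> A \<rightarrow> H"
  shows "finsum M f A \<in> H"
proof -
  interpret M: module R M by (rule M)
  note subset = M.submoduleE(1)[OF H]
  show ?thesis using assms(3,4)
  proof (induction A)
    case empty
    show ?case using submodule_zero_closed[OF H] by simp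
  next
    case (insert x A)
    then have f: "f \<in> A \<rightarrow> H" "f x \<in> H" by auto
    then have "f \<in> A \<rightarrow> carrier M" "f x \<in> carrier M" using subset by auto
    then show ?case using insert f M.submoduleE(5)[OF H] by simp
  qed
qed

lemma (in module) submodule_Inter:
  assumes "\<And>H. H \<in> A \<Longrightarrow> submodule H R M" "A \<noteq> {}"
  shows "submodule (\<Inter>A) R M"
proof (intro submoduleI InterI)
  show "\<Inter>A \<subseteq> carrier M"
    using assms submoduleE(1) by blast
  fix H assume H: "H \<in> A"
  show "\<zero>\<^bsub>M\<^esub> \<in> H" by (rule submodule_zero_closed[OF assms(1)[OF H]])
  fix x assume "x \<in> \<Inter>A"
  then have x: "x \<in> H" using H by blast
  then show "\<ominus>\<^bsub>M\<^esub> x \<in> H" by (rule submoduleE(3)[OF assms(1)[OF H]])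
  show "a \<odot>\<^bsub>M\<^esub> x \<in> H" if "a \<in> carrier R" for a
    by (rule submoduleE(4)[OF assms(1)[OF H] that x])
  fix y assume "y \<in> \<Inter>A"
  then show "x \<oplus>\<^bsub>M\<^esub> y \<in> H"
    using H by (intro submoduleE(5)[OF assms(1)[OF H] x]) blast
qed

lemma (in module) submodule_span:
  assumes "A \<subseteq> carrier M"
  shows "submodule (submodule_span R M A) R M"
    and "A \<subseteq> submodule_span R M A"
  unfolding submodule_span_def
  using assms carrier_is_submodule by (auto intro!: submodule_Inter)

lemma submodule_span_minimal:
  assumes "submodule H R M" "A \<subseteq> H"
  shows "submodule_span R M A \<subseteq> H"
  unfolding submodule_span_def using assms by auto

section \<open>Free modules\<close>

lemma free_module_simps [simp]:
  "\<zero>\<^bsub>free_module R X\<^esub> = (\<lambda>_. \<zero>\<^bsub>R\<^esub>)"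
  "f \<oplus>\<^bsub>free_module R X\<^esub> g = (\<lambda>x. f x \<oplus>\<^bsub>R\<^esub> g x)"
  "a \<odot>\<^bsub>free_module R X\<^esub> f = (\<lambda>x. a \<otimes>\<^bsub>R\<^esub> f x)"
  by (auto simp: free_module_def)

lemma free_module_carrier:
  "f \<in> carrier (free_module R X) \<longleftrightarrow>
     (\<forall>x\<in>X. f x \<in> carrier R) \<and> (\<forall>x. x \<notin> X \<longrightarrow> f x = \<zero>\<^bsub>R\<^esub>) \<and> finite {x. f x \<noteq> \<zero>\<^bsub>R\<^esub>}"
  by (simp add: free_module_def)

lemma (in cring) free_module_apply_closed [simp]:
  "f \<in> carrier (free_module R X) \<Longrightarrow> f x \<in> carrier R"
  by (cases "x \<in> X") (auto simp: free_module_carrier)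

lemma (in cring) free_module_module: "module R (free_module R X)"
proof (rule moduleI)
  let ?F = "free_module R X"
  have add: "f \<oplus>\<^bsub>?F\<^esub> g \<in> carrier ?F" if "f \<in> carrier ?F" "g \<in> carrier ?F" for f g
  proof -
    have "{x. f x \<oplus> g x \<noteq> \<zero>} \<subseteq> {x. f x \<noteq> \<zero>} \<union> {x. g x \<noteq> \<zero>}" by auto
    then show ?thesis using that by (auto simp: free_module_carrier intro: finite_subset)
  qed
  have smult: "a \<odot>\<^bsub>?F\<^esub> f \<in> carrier ?F" if "a \<in> carrier R" "f \<in> carrier ?F" for a f
  proof -
    have "{x. a \<otimes> f x \<noteq> \<zero>} \<subseteq> {x. f x \<noteq> \<zero>}" using that by auto
    then show ?thesis using that by (auto simp: free_module_carrier intro: finite_subset)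
  qed
  show "cring R" by (rule is_cring)
  show "abelian_group ?F"
  proof (rule abelian_groupI)
    fix f assume f: "f \<in> carrier ?F"
    \<comment> \<open>The inverse is taken as a scalar multiple, so its finite support is already
      known from \<open>smult\<close>.\<close>
    then have "(\<ominus> \<one>) \<odot>\<^bsub>?F\<^esub> f \<in> carrier ?F" using smult by blast
    moreover have "(\<ominus> \<one>) \<odot>\<^bsub>?F\<^esub> f \<oplus>\<^bsub>?F\<^esub> f = \<zero>\<^bsub>?F\<^esub>"
      using free_module_apply_closed[OF f] by (auto simp: fun_eq_iff l_minus l_neg)
    ultimately show "\<exists>g\<in>carrier ?F. g \<oplus>\<^bsub>?F\<^esub> f = \<zero>\<^bsub>?F\<^esub>" by blast
  next
    fix f g h assume "f \<in> carrier ?F" "g \<in> carrier ?F" "h \<in> carrier ?F"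
    then show "f \<oplus>\<^bsub>?F\<^esub> g \<oplus>\<^bsub>?F\<^esub> h = f \<oplus>\<^bsub>?F\<^esub> (g \<oplus>\<^bsub>?F\<^esub> h)"
      using free_module_apply_closed[where X = X] by (simp add: fun_eq_iff a_assoc)
  next
    fix f g assume "f \<in> carrier ?F" "g \<in> carrier ?F"
    then show "f \<oplus>\<^bsub>?F\<^esub> g = g \<oplus>\<^bsub>?F\<^esub> f"
      using free_module_apply_closed[where X = X] by (simp add: fun_eq_iff a_comm)
  next
    fix f assume "f \<in> carrier ?F"
    then show "\<zero>\<^bsub>?F\<^esub> \<oplus>\<^bsub>?F\<^esub> f = f"
      using free_module_apply_closed[where X = X] by (simp add: fun_eq_iff)
  qed (use add in \<open>auto simp: free_module_carrier\<close>)
next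
  let ?F = "free_module R X"
  note closed = free_module_apply_closed[where X = X]
  fix f assume f: "f \<in> carrier ?F"
  show "\<one> \<odot>\<^bsub>?F\<^esub> f = f" using closed[OF f] by simp
  fix a assume a: "a \<in> carrier R"
  have "{x. a \<otimes> f x \<noteq> \<zero>} \<subseteq> {x. f x \<noteq> \<zero>}" using a by auto
  then show "a \<odot>\<^bsub>?F\<^esub> f \<in> carrier ?F"
    using a f by (auto simp: free_module_carrier intro: finite_subset)
  show "a \<odot>\<^bsub>?F\<^esub> (f \<oplus>\<^bsub>?F\<^esub> g) = a \<odot>\<^bsub>?F\<^esub> f \<oplus>\<^bsub>?F\<^esub> a \<odot>\<^bsub>?F\<^esub> g" if "g \<in> carrier ?F" for g
    using a closed[OF f] closed[OF that] by (simp add: r_distr)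
  fix b assume b: "b \<in> carrier R"
  show "(a \<oplus> b) \<odot>\<^bsub>?F\<^esub> f = a \<odot>\<^bsub>?F\<^esub> f \<oplus>\<^bsub>?F\<^esub> b \<odot>\<^bsub>?F\<^esub> f"
    using a b closed[OF f] by (simp add: l_distr)
  show "(a \<otimes> b) \<odot>\<^bsub>?F\<^esub> f = a \<odot>\<^bsub>?F\<^esub> (b \<odot>\<^bsub>?F\<^esub> f)"
    using a b closed[OF f] by (simp add: m_assoc)
qed

lemma (in cring) basis_elt_closed [simp]:
  "x \<in> X \<Longrightarrow> basis_elt R x \<in> carrier (free_module R X)"
  by (auto simp: free_module_carrier basis_elt_def)

text \<open>Induction on a finite set containing the support: deleting the value at one point
  \<open>x\<close> changes \<open>f\<close> by a multiple of the basis element at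
  \<open>x\<close>.\<close>

lemma (in cring) free_module_basis_induct:
  assumes H: "submodule H R (free_module R X)" and basis: "\<And>x. x \<in> X \<Longrightarrow> basis_elt R x \<in> H"
  shows "carrier (free_module R X) \<subseteq> H"
proof
  interpret F: module R "free_module R X" by (rule free_module_module)
  fix f assume f: "f \<in> carrier (free_module R X)"
  have "\<forall>f. f \<in> carrier (free_module R X) \<longrightarrow> {x. f x \<noteq> \<zero>} \<subseteq> U \<longrightarrow> f \<in> H" if "finite U" for U
    using that
  proof (induction U)
    case empty
    then show ?case
      using submodule_zero_closed[OF H] by (auto simp flip: fun_eq_iff)
  next
    case (insert x U)
    show ?case
    proof (intro allI impI)
      fix f assume f: "f \<in> carrier (free_module R X)" and sub: "{y. f y \<noteq> \<zero>} \<subseteq> insert x U"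
      have supp: "{y. (f(x := \<zero>)) y \<noteq> \<zero>} \<subseteq> U \<inter> {y. f y \<noteq> \<zero>}" using sub by auto
      have "f(x := \<zero>) \<in> carrier (free_module R X)"
        using f supp finite_subset[OF supp] by (auto simp: free_module_carrier)
      then have 1: "f(x := \<zero>) \<in> H" using insert.IH supp by blast
      show "f \<in> H"
      proof (cases "x \<in> X")
        case True
        have "f = f(x := \<zero>) \<oplus>\<^bsub>free_module R X\<^esub> (f x \<odot>\<^bsub>free_module R X\<^esub> basis_elt R x)"
          using free_module_apply_closed[OF f] by (auto simp: fun_eq_iff basis_elt_def)
        also have "\<dots> \<in> H"
          using 1 basis[OF True] F.submoduleE(4,5)[OF H] free_module_apply_closed[OF f] by blast
        finally show ?thesis .
      next
        \<comment> \<open>The bounding set \<open>U\<close> is an arbitrary finite set, so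
          \<open>x\<close> may lie outside \<open>X\<close>; there \<open>f\<close> is zero
          anyway.\<close>
        case False
        then have "f(x := \<zero>) = f" using f by (auto simp: fun_eq_iff free_module_carrier)
        then show ?thesis using 1 by simp
      qed
    qed
  qed
  then show "f \<in> H" using f by (auto simp: free_module_carrier)
qed

text \<open>The linear extension of a map \<open>g\<close> given on the basis. Summing over the
  support keeps the sum finite even when \<open>X\<close> is infinite, as it is for all elements of
  a ring.\<close>

definition free_lift ::
  "('r, 'm) ring_scheme \<Rightarrow> ('r, 'a, 'n) module_scheme \<Rightarrow> ('x \<Rightarrow> 'a) \<Rightarrow> ('x \<Rightarrow> 'r) \<Rightarrow> 'a" where
  "free_lift R N g f = finsum N (\<lambda>x. f x \<odot>\<^bsub>N\<^esub> g x) {x. f x \<noteq> \<zero>\<^bsub>R\<^esub>}"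

context module
begin

text \<open>Two functions and their sum have different supports. Padding with zero terms up to a
  common finite set makes the three sums comparable.\<close>

lemma free_lift_eq:
  assumes "g \<in> X \<rightarrow> carrier M" "finite U" "U \<subseteq> X" "{x. f x \<noteq> \<zero>} \<subseteq> U" "f \<in> carrier (free_module R X)"
  shows "free_lift R M g f = (\<Oplus>\<^bsub>M\<^esub>x\<in>U. f x \<odot>\<^bsub>M\<^esub> g x)"
proof -
  note f = R.free_module_apply_closed[OF assms(5)]
  have g: "g x \<in> carrier M" if "x \<in> U" for x
    by (rule funcset_mem[OF assms(1) subsetD[OF assms(3) that]])
  show ?thesis
    unfolding free_lift_def
  proof (rule M.add.finprod_mono_neutral_cong_left[OF assms(2,4)])
    show "(\<lambda>x. f x \<odot>\<^bsub>M\<^esub> g x) \<in> U \<rightarrow> carrier M"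
      by (rule funcsetI) (rule smult_closed[OF f g])
    show "f i \<odot>\<^bsub>M\<^esub> g i = \<zero>\<^bsub>M\<^esub>" if "i \<in> U - {x. f x \<noteq> \<zero>}" for i
    proof -
      have "f i = \<zero>" "i \<in> U" using that by auto
      then show ?thesis using smult_l_null[OF g] by metis
    qed
  qed (rule refl)
qed

lemma free_lift_linear:
  assumes g: "g \<in> X \<rightarrow> carrier M"
  shows "free_lift R M g \<in> linear_maps R (free_module R X) M"
proof -
  let ?F = "free_module R X"
  interpret F: module R ?F by (rule R.free_module_module)
  have gx: "g x \<in> carrier M" if "x \<in> U" "U \<subseteq> X" for x U
    by (rule funcset_mem[OF g subsetD[OF that(2,1)]])
  have gU: "(\<lambda>x. f x \<odot>\<^bsub>M\<^esub> g x) \<in> U \<rightarrow> carrier M" if "f \<in> carrier ?F" "U \<subseteq> X" for f U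
    by (intro funcsetI smult_closed R.free_module_apply_closed[OF that(1)] gx[OF _ that(2)])
  have supp: "finite {x. f x \<noteq> \<zero>}" "{x. f x \<noteq> \<zero>} \<subseteq> X" if "f \<in> carrier ?F" for f
    using that by (auto simp: free_module_carrier)
  have closed: "free_lift R M g f \<in> carrier M" if "f \<in> carrier ?F" for f
    unfolding free_lift_def using gU[OF that supp(2)[OF that]] by (rule M.finsum_closed)
  have add: "free_lift R M g (f \<oplus>\<^bsub>?F\<^esub> h) = free_lift R M g f \<oplus>\<^bsub>M\<^esub> free_lift R M g h"
    if f: "f \<in> carrier ?F" and h: "h \<in> carrier ?F" for f h
  proof -
    let ?U = "{x. f x \<noteq> \<zero>} \<union> {x. h x \<noteq> \<zero>}"
    have U: "finite ?U" "?U \<subseteq> X" using supp f h by auto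
    have "free_lift R M g (f \<oplus>\<^bsub>?F\<^esub> h) = (\<Oplus>\<^bsub>M\<^esub>x\<in>?U. (f \<oplus>\<^bsub>?F\<^esub> h) x \<odot>\<^bsub>M\<^esub> g x)"
      using U f h F.a_closed[OF f h] by (intro free_lift_eq[OF g]) auto
    also have "\<dots> = (\<Oplus>\<^bsub>M\<^esub>x\<in>?U. f x \<odot>\<^bsub>M\<^esub> g x \<oplus>\<^bsub>M\<^esub> h x \<odot>\<^bsub>M\<^esub> g x)"
      using gU[OF f U(2)] gU[OF h U(2)] gx[OF _ U(2)] R.free_module_apply_closed[OF f]
        R.free_module_apply_closed[OF h]
      by (intro M.finsum_cong' refl) (simp_all add: smult_l_distr Pi_iff)
    also have "\<dots> = (\<Oplus>\<^bsub>M\<^esub>x\<in>?U. f x \<odot>\<^bsub>M\<^esub> g x) \<oplus>\<^bsub>M\<^esub> (\<Oplus>\<^bsub>M\<^esub>x\<in>?U. h x \<odot>\<^bsub>M\<^esub> g x)"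
      using gU[OF f U(2)] gU[OF h U(2)] by (intro M.finsum_addf)
    finally show ?thesis
      using free_lift_eq[OF g U Un_upper1 f] free_lift_eq[OF g U Un_upper2 h] by simp
  qed
  have smult: "free_lift R M g (a \<odot>\<^bsub>?F\<^esub> f) = a \<odot>\<^bsub>M\<^esub> free_lift R M g f"
    if a: "a \<in> carrier R" and f: "f \<in> carrier ?F" for a f
  proof -
    let ?U = "{x. f x \<noteq> \<zero>}"
    have U: "finite ?U" "?U \<subseteq> X" using supp f by auto
    have "free_lift R M g (a \<odot>\<^bsub>?F\<^esub> f) = (\<Oplus>\<^bsub>M\<^esub>x\<in>?U. (a \<odot>\<^bsub>?F\<^esub> f) x \<odot>\<^bsub>M\<^esub> g x)"
      using U a f F.smult_closed[OF a f] by (intro free_lift_eq[OF g]) auto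
    also have "\<dots> = (\<Oplus>\<^bsub>M\<^esub>x\<in>?U. a \<odot>\<^bsub>M\<^esub> (f x \<odot>\<^bsub>M\<^esub> g x))"
      using a gU[OF f U(2)] gx[OF _ U(2)] R.free_module_apply_closed[OF f]
      by (intro M.finsum_cong' refl) (simp_all add: smult_assoc1 Pi_iff)
    also have "\<dots> = a \<odot>\<^bsub>M\<^esub> (\<Oplus>\<^bsub>M\<^esub>x\<in>?U. f x \<odot>\<^bsub>M\<^esub> g x)"
      using U a gU[OF f U(2)] by (intro finsum_smult_ldistr[symmetric]) auto
    finally show ?thesis by (simp add: free_lift_def)
  qed
  show ?thesis using closed add smult by (auto simp: linear_maps_def simp del: free_module_simps)
qed

lemma free_lift_basis_elt:
  assumes "g \<in> X \<rightarrow> carrier M" "x \<in> X"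
  shows "free_lift R M g (basis_elt R x) = g x"
proof -
  have "free_lift R M g (basis_elt R x) = (\<Oplus>\<^bsub>M\<^esub>y\<in>{x}. basis_elt R x y \<odot>\<^bsub>M\<^esub> g y)"
    using assms(2) by (intro free_lift_eq[OF assms(1)] R.basis_elt_closed) (auto simp: basis_elt_def)
  also have "\<dots> = g x"
    using funcset_mem[OF assms] by (subst M.finsum_insert) (auto simp: basis_elt_def)
  finally show ?thesis .
qed

end

section \<open>Quotient modules\<close>

lemma (in module) submodule_abelian_subgroup:
  assumes "submodule N R M"
  shows "abelian_subgroup N M"
  using submodule.axioms(1)[OF assms]
  by (intro abelian_subgroupI3 additive_subgroupI M.abelian_group_axioms)

lemma quot_module_simps [simp]:
  "carrier (quot_module M N) = a_rcosets\<^bsub>M\<^esub> N"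
  "\<zero>\<^bsub>quot_module M N\<^esub> = N"
  "A \<oplus>\<^bsub>quot_module M N\<^esub> B = A <+>\<^bsub>M\<^esub> B"
  by (simp_all add: quot_module_def)

locale quotient_module = module R M for R (structure) and M (structure) +
  fixes N
  assumes N: "submodule N R M"
begin

sublocale abelian_subgroup N M
  by (rule submodule_abelian_subgroup[OF N])

lemma coset_in_carrier [simp]: "x \<in> carrier M \<Longrightarrow> N +>\<^bsub>M\<^esub> x \<in> a_rcosets\<^bsub>M\<^esub> N"
  by (intro M.a_rcosetsI a_subset)

lemma carrier_cases:
  assumes "A \<in> a_rcosets\<^bsub>M\<^esub> N"
  obtains x where "x \<in> carrier M" "A = N +>\<^bsub>M\<^esub> x"
  using assms by (auto simp: A_RCOSETS_def' a_r_coset_def')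

lemma coset_eq_iff:
  assumes "x \<in> carrier M" "y \<in> carrier M"
  shows "N +>\<^bsub>M\<^esub> x = N +>\<^bsub>M\<^esub> y \<longleftrightarrow> x \<ominus>\<^bsub>M\<^esub> y \<in> N"
proof -
  have "x \<in> N +>\<^bsub>M\<^esub> y \<longleftrightarrow> x \<ominus>\<^bsub>M\<^esub> y \<in> N"
    unfolding a_minus_def by (rule a_rcos_module[OF assms(2,1)])
  then show ?thesis
    using a_rcos_self[OF assms(1)] a_repr_independence'[OF _ assms(2)] by auto
qed

text \<open>Scalar multiplication in \<open>quot_module\<close> is a union over all representatives.
  Since \<open>N\<close> is stable under scalars, all cosets in this union coincide.\<close>

lemma quot_smult:
  assumes "a \<in> carrier R" "x \<in> carrier M"
  shows "a \<odot>\<^bsub>quot_module M N\<^esub> (N +>\<^bsub>M\<^esub> x) = N +>\<^bsub>M\<^esub> (a \<odot>\<^bsub>M\<^esub> x)"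
proof -
  have "N +>\<^bsub>M\<^esub> (a \<odot>\<^bsub>M\<^esub> y) = N +>\<^bsub>M\<^esub> (a \<odot>\<^bsub>M\<^esub> x)" if y: "y \<in> N +>\<^bsub>M\<^esub> x" for y
  proof -
    obtain h where h: "h \<in> N" "y = h \<oplus>\<^bsub>M\<^esub> x" using y by (auto simp: a_r_coset_def')
    have "a \<odot>\<^bsub>M\<^esub> y = a \<odot>\<^bsub>M\<^esub> h \<oplus>\<^bsub>M\<^esub> a \<odot>\<^bsub>M\<^esub> x" using h assms by (simp add: smult_r_distr)
    then have "a \<odot>\<^bsub>M\<^esub> y \<in> N +>\<^bsub>M\<^esub> (a \<odot>\<^bsub>M\<^esub> x)"
      using submoduleE(4)[OF N] h assms by (auto simp: a_r_coset_def')
    then show ?thesis using assms by (simp add: a_repr_independence')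
  qed
  then have "(\<Union>y\<in>N +>\<^bsub>M\<^esub> x. N +>\<^bsub>M\<^esub> (a \<odot>\<^bsub>M\<^esub> y)) = (\<Union>y\<in>N +>\<^bsub>M\<^esub> x. N +>\<^bsub>M\<^esub> (a \<odot>\<^bsub>M\<^esub> x))"
    by (rule SUP_cong[OF refl])
  \<comment> \<open>A union of equal sets is that set only if the index set is nonempty; the coset
    contains \<open>x\<close>.\<close>
  also have "\<dots> = N +>\<^bsub>M\<^esub> (a \<odot>\<^bsub>M\<^esub> x)"
    using a_rcos_self[OF assms(2)] by (intro SUP_const) blast
  finally show ?thesis by (simp add: quot_module_def)
qed

lemma quot_module_module: "module R (quot_module M N)"
proof (rule moduleI)
  show "cring R" by (rule R.is_cring)
  show "abelian_group (quot_module M N)"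
  proof (rule abelian_groupI)
    fix A assume "A \<in> carrier (quot_module M N)"
    then obtain x where x: "x \<in> carrier M" "A = N +>\<^bsub>M\<^esub> x" by (auto elim: carrier_cases)
    then have "(N +>\<^bsub>M\<^esub> \<ominus>\<^bsub>M\<^esub> x) <+>\<^bsub>M\<^esub> A = N"
      by (simp add: a_rcos_sum M.l_neg M.a_coset_add_zero[OF a_subset])
    then show "\<exists>B\<in>carrier (quot_module M N). B \<oplus>\<^bsub>quot_module M N\<^esub> A = \<zero>\<^bsub>quot_module M N\<^esub>"
      using x by (intro bexI[of _ "N +>\<^bsub>M\<^esub> \<ominus>\<^bsub>M\<^esub> x"]) simp_all
    show "\<zero>\<^bsub>quot_module M N\<^esub> \<oplus>\<^bsub>quot_module M N\<^esub> A = A"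
      using x a_rcos_sum[of "\<zero>\<^bsub>M\<^esub>" x] M.a_coset_add_zero[OF a_subset] by simp
  next
    show "\<zero>\<^bsub>quot_module M N\<^esub> \<in> carrier (quot_module M N)"
      using coset_in_carrier[of "\<zero>\<^bsub>M\<^esub>"] M.a_coset_add_zero[OF a_subset] by simp
  qed (auto elim!: carrier_cases simp: a_rcos_sum M.a_ac)
qed (auto elim!: carrier_cases simp: quot_smult a_rcos_sum smult_l_distr smult_r_distr smult_assoc1)

lemma proj_linear: "(\<lambda>x. N +>\<^bsub>M\<^esub> x) \<in> linear_maps R M (quot_module M N)"
  by (auto simp: linear_maps_def quot_smult a_rcos_sum)

lemma proj_eq_zero_iff: "x \<in> carrier M \<Longrightarrow> N +>\<^bsub>M\<^esub> x = \<zero>\<^bsub>quot_module M N\<^esub> \<longleftrightarrow> x \<in> N"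
  using a_rcos_const a_rcos_self by auto

text \<open>The second assumption receives the pulled-back submodule as a premise, so that an
  induction principle of \<open>M\<close> itself can be plugged in.\<close>

lemma quot_module_induct:
  assumes "submodule H R (quot_module M N)"
    and "submodule {x \<in> carrier M. N +>\<^bsub>M\<^esub> x \<in> H} R M \<Longrightarrow> carrier M \<subseteq> {x \<in> carrier M. N +>\<^bsub>M\<^esub> x \<in> H}"
  shows "carrier (quot_module M N) \<subseteq> H"
  using assms(2)[OF submodule_vimage[OF module_axioms quot_module_module proj_linear assms(1)]]
  by (auto elim!: carrier_cases)

text \<open>Universal property of the quotient: evaluating \<open>h\<close> at an arbitrarily chosen
  representative is harmless because \<open>h\<close> kills \<open>N\<close>.\<close>

lemma quot_module_lift:
  assumes P: "module R P" and h: "h \<in> linear_maps R M P" and zero: "\<And>x. x \<in> N \<Longrightarrow> h x = \<zero>\<^bsub>P\<^esub>"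
  obtains k where "k \<in> linear_maps R (quot_module M N) P" "\<And>x. x \<in> carrier M \<Longrightarrow> k (N +>\<^bsub>M\<^esub> x) = h x"
proof
  interpret P: module R P by (rule P)
  define k where "k A = h (SOME x. x \<in> A)" for A
  show k: "k (N +>\<^bsub>M\<^esub> x) = h x" if x: "x \<in> carrier M" for x
  proof -
    have "(SOME y. y \<in> N +>\<^bsub>M\<^esub> x) \<in> N +>\<^bsub>M\<^esub> x"
      using a_rcos_self[OF x] by (rule someI)
    then obtain y where y: "y \<in> N" "(SOME y. y \<in> N +>\<^bsub>M\<^esub> x) = y \<oplus>\<^bsub>M\<^esub> x"
      by (auto simp: a_r_coset_def')
    then show ?thesis using x zero linear_mapsD[OF h] by (simp add: k_def)
  qed
  show "k \<in> linear_maps R (quot_module M N) P"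
    using linear_mapsD[OF h] by (auto simp: linear_maps_def quot_smult a_rcos_sum k elim!: carrier_cases)
qed

end

section \<open>Modules presented by generators and relations\<close>

text \<open>The common frame of differentials and exterior powers: both are free modules modulo the
  span of a set of relations and differ only in that set.\<close>

locale presented_module = cring R for R (structure) +
  fixes X :: "'x set" and rels :: "('x \<Rightarrow> 'a) set"
  assumes rels: "rels \<subseteq> carrier (free_module R X)"
begin

abbreviation "free \<equiv> free_module R X"
abbreviation "span_rels \<equiv> submodule_span R free rels"
abbreviation "presented \<equiv> quot_module free span_rels"
abbreviation "gen x \<equiv> span_rels +>\<^bsub>free\<^esub> basis_elt R x"

sublocale free: module R free by (rule free_module_module)

sublocale quotient_module R free span_rels
  by (intro quotient_module.intro free.module_axioms quotient_module_axioms.intro free.submodule_span[OF rels])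

lemma gen_closed: "x \<in> X \<Longrightarrow> gen x \<in> carrier presented"
  by simp

lemma rel_zero: "f \<in> rels \<Longrightarrow> span_rels +>\<^bsub>free\<^esub> f = \<zero>\<^bsub>presented\<^esub>"
  using free.submodule_span(2)[OF rels] rels by (subst proj_eq_zero_iff) auto

lemma presented_induct:
  assumes "submodule H R presented" "\<And>x. x \<in> X \<Longrightarrow> gen x \<in> H"
  shows "carrier presented \<subseteq> H"
  using assms(2) by (intro quot_module_induct[OF assms(1)] free_module_basis_induct) simp_all

lemma presented_lift:
  assumes P: "module R P" and g: "g \<in> X \<rightarrow> carrier P"
    and zero: "\<And>f. f \<in> rels \<Longrightarrow> free_lift R P g f = \<zero>\<^bsub>P\<^esub>"
  obtains k where "k \<in> linear_maps R presented P" "\<And>x. x \<in> X \<Longrightarrow> k (gen x) = g x"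
proof -
  interpret P: module R P by (rule P)
  note lin = P.free_lift_linear[OF g]
  \<comment> \<open>The kernel of the lift, written as the preimage of the zero submodule, is a
    submodule; as it contains the relations, it contains their span.\<close>
  have "span_rels \<subseteq> {f \<in> carrier free. free_lift R P g f \<in> {\<zero>\<^bsub>P\<^esub>}}"
    using rels zero
    by (intro submodule_span_minimal submodule_vimage[OF free.module_axioms P lin] P.submodule_zero) auto
  then have "free_lift R P g f = \<zero>\<^bsub>P\<^esub>" if "f \<in> span_rels" for f
    using that by auto
  then obtain k where k: "k \<in> linear_maps R presented P"
      "\<And>f. f \<in> carrier free \<Longrightarrow> k (span_rels +>\<^bsub>free\<^esub> f) = free_lift R P g f"
    by (rule quot_module_lift[OF P lin]) auto
  show thesis
  proof (rule that[OF k(1)])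
    show "k (gen x) = g x" if "x \<in> X" for x
      using that k(2)[OF basis_elt_closed[OF that]] P.free_lift_basis_elt[OF g that] by simp
  qed
qed

end

text \<open>The relations are stated as differences; this turns them into equations between
  classes.\<close>

lemma (in presented_module) proj_eq_of_rel:
  assumes "x \<ominus>\<^bsub>free\<^esub> y \<in> rels" "x \<in> carrier free" "y \<in> carrier free"
  shows "span_rels +>\<^bsub>free\<^esub> x = span_rels +>\<^bsub>free\<^esub> y"
proof -
  have "x \<ominus>\<^bsub>free\<^esub> y \<in> span_rels"
    using free.submodule_span(2)[OF rels] assms(1) by blast
  then show ?thesis by (simp only: coset_eq_iff[OF assms(2,3)])
qed

section \<open>Homogeneous components under linear maps\<close>

text \<open>Homogeneous components are defined as additive groups generated by products, so the
  image of a component can be computed from the images of these products.\<close>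

lemma linear_map_generate:
  assumes "module R M" "module R N" "h \<in> linear_maps R M N" "X \<subseteq> carrier M"
  shows "h ` generate (add_monoid M) X = generate (add_monoid N) (h ` X)"
proof -
  interpret abelian_group_hom M N h by (rule linear_map_abelian_group_hom) fact+
  show ?thesis using group_hom.generate_img[OF a_group_hom, of X] assms(4) by simp
qed

lemma (in abelian_group) generate_subset_additive_subgroup:
  assumes "X \<subseteq> H" "additive_subgroup H G"
  shows "generate (add_monoid G) X \<subseteq> H"
  using add.generate_subgroup_incl[OF assms(1) additive_subgroup.a_subgroup[OF assms(2)]] .

lemma (in abelian_group) generate_closed:
  "X \<subseteq> carrier G \<Longrightarrow> generate (add_monoid G) X \<subseteq> carrier G"
  using add.generate_incl by simp

lemma additive_subgroup_vimage:
  assumes "module R M" "module R N" "h \<in> linear_maps R M N" "additive_subgroup H N"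
  shows "additive_subgroup {x \<in> carrier M. h x \<in> H} M"
proof -
  interpret M: module R M by fact
  interpret abelian_group_hom M N h by (rule linear_map_abelian_group_hom) fact+
  interpret H: additive_subgroup H N by fact
  show ?thesis
  proof (intro additive_subgroupI)
    show "subgroup {x \<in> carrier M. h x \<in> H} (add_monoid M)"
      by unfold_locales (auto simp flip: a_inv_def)
  qed
qed

text \<open>Only the target has to be known as a graded module. As \<open>h\<close> is a bijection
  matching the candidate components, existence and uniqueness of homogeneous decompositions carry
  over to the source.\<close>

lemma graded_isomorphicI:
  assumes M: "module R M" and grN: "graded_module R gR N gN"
    and h: "h \<in> linear_maps R M N" and bij: "bij_betw h (carrier M) (carrier N)"
    and gM: "\<And>d. gM d \<subseteq> carrier M" and img: "\<And>d. h ` gM d = gN d"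
    and gR: "\<And>d. gR d \<subseteq> carrier R"
  shows "graded_isomorphic R gR M gM N gN"
proof -
  interpret M: module R M by (rule M)
  have N: "module R N" and sub: "\<And>d. additive_subgroup (gN d) N"
    and smult: "\<And>i j a x. a \<in> gR i \<Longrightarrow> x \<in> gN j \<Longrightarrow> a \<odot>\<^bsub>N\<^esub> x \<in> gN (i + j)"
    and ex1: "\<And>x. x \<in> carrier N \<Longrightarrow> \<exists>!c. (\<forall>d. c d \<in> gN d) \<and> finite {d. c d \<noteq> \<zero>\<^bsub>N\<^esub>} \<and>
        x = finsum N c {d. c d \<noteq> \<zero>\<^bsub>N\<^esub>}"
    using grN by (simp_all add: graded_module_def)
  interpret N: module R N by (rule N)
  note lin = linear_mapsD[OF h]
  have inj: "h x = h y \<longleftrightarrow> x = y" if "x \<in> carrier M" "y \<in> carrier M" for x y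
    using bij that by (auto simp: bij_betw_def inj_on_def)
  have gM_iff: "x \<in> gM d \<longleftrightarrow> x \<in> carrier M \<and> h x \<in> gN d" for x d
    using gM[of d] inj by (auto simp flip: img)
  have zero: "h x = \<zero>\<^bsub>N\<^esub> \<longleftrightarrow> x = \<zero>\<^bsub>M\<^esub>" if "x \<in> carrier M" for x
    using inj[OF that M.zero_closed] linear_map_zero[OF M N h] by simp
  define dec where "dec c x \<longleftrightarrow> (\<forall>d. c d \<in> gM d) \<and> finite {d. c d \<noteq> \<zero>\<^bsub>M\<^esub>} \<and>
        x = finsum M c {d. c d \<noteq> \<zero>\<^bsub>M\<^esub>}" for c x
  define decN where "decN c x \<longleftrightarrow> (\<forall>d. c d \<in> gN d) \<and> finite {d. c d \<noteq> \<zero>\<^bsub>N\<^esub>} \<and>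
        x = finsum N c {d. c d \<noteq> \<zero>\<^bsub>N\<^esub>}" for c x
  \<comment> \<open>Since \<open>h\<close> vanishes only at zero, a family and its image have the
    same support, so the two finite sums run over the same degrees.\<close>
  have dec_iff: "dec c x \<longleftrightarrow> decN (\<lambda>d. h (c d)) (h x)"
    if x: "x \<in> carrier M" and c: "\<And>d. c d \<in> carrier M" for c x
  proof -
    have supp: "{d. h (c d) \<noteq> \<zero>\<^bsub>N\<^esub>} = {d. c d \<noteq> \<zero>\<^bsub>M\<^esub>}"
      using zero[OF c] by simp
    have "x = finsum M c {d. c d \<noteq> \<zero>\<^bsub>M\<^esub>} \<longleftrightarrow> h x = finsum N (\<lambda>d. h (c d)) {d. c d \<noteq> \<zero>\<^bsub>M\<^esub>}"
      if "finite {d. c d \<noteq> \<zero>\<^bsub>M\<^esub>}"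
      using that x c inj[OF x, of "finsum M c {d. c d \<noteq> \<zero>\<^bsub>M\<^esub>}"] M.finsum_closed
      by (simp add: linear_map_finsum[OF M N h] Pi_iff)
    then show ?thesis
      unfolding dec_def decN_def supp using c gM_iff by auto
  qed
  have "\<exists>!c. dec c x" if x: "x \<in> carrier M" for x
  proof -
    have "h x \<in> carrier N" using lin(1) x by blast
    then obtain c where c: "decN c (h x)" and uniq: "\<And>c'. decN c' (h x) \<Longrightarrow> c' = c"
      using ex1[of "h x"] unfolding decN_def by metis
    \<comment> \<open>The decomposition is pulled back degree by degree: \<open>c d\<close> lies in
      \<open>gN d\<close>, which is the image of \<open>gM d\<close>.\<close>
    have "\<forall>d. \<exists>y. y \<in> carrier M \<and> h y = c d"
    proof
      fix d
      have "c d \<in> h ` gM d" using c unfolding decN_def img by blast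
      then obtain y where "c d = h y" "y \<in> gM d" by (rule imageE)
      then show "\<exists>y. y \<in> carrier M \<and> h y = c d" using subsetD[OF gM] by metis
    qed
    then obtain b where b: "\<And>d. b d \<in> carrier M" "\<And>d. h (b d) = c d" by metis
    show ?thesis
    proof (rule ex1I[of _ b])
      show "dec b x" using dec_iff[OF x b(1)] b(2) c by simp
      fix b' assume b': "dec b' x"
      have closed: "b' d \<in> carrier M" for d using b' gM_iff by (simp add: dec_def)
      have "decN (\<lambda>d. h (b' d)) (h x)" by (rule iffD1[OF dec_iff[OF x closed] b'])
      then have eq: "(\<lambda>d. h (b' d)) = c" by (rule uniq)
      have "h (b' d) = h (b d)" for d using fun_cong[OF eq, of d] by (simp add: b(2))
      then show "b' = b" using inj[OF closed b(1)] by (intro ext) simp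
    qed
  qed
  moreover have "additive_subgroup (gM d) M" for d
  proof -
    have "gM d = {x \<in> carrier M. h x \<in> gN d}" by (simp add: set_eq_iff gM_iff)
    then show ?thesis using additive_subgroup_vimage[OF M N h sub[of d]] by simp
  qed
  moreover have "a \<odot>\<^bsub>M\<^esub> x \<in> gM (i + j)" if a: "a \<in> gR i" and x: "x \<in> gM j" for a x i j
  proof -
    have "a \<in> carrier R" "x \<in> carrier M" "h x \<in> gN j"
      using subsetD[OF gR a] x gM_iff by simp_all
    then show ?thesis using smult[OF a] lin(3) by (simp add: gM_iff)
  qed
  ultimately have "graded_module R gR M gM"
    unfolding graded_module_def dec_def using M by simp
  then show ?thesis
    unfolding graded_isomorphic_def using grN bij img
    by (intro conjI exI[of _ h]) (simp_all add: lin(2,3))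
qed

section \<open>Differentials and exterior powers\<close>

lemma (in cring) kaehler_rels_subset:
  assumes "C \<subseteq> carrier R"
  shows "kaehler_rels R C \<subseteq> carrier (free_module R (carrier R))"
proof -
  interpret F: module R "free_module R (carrier R)" by (rule free_module_module)
  note closed = F.minus_closed F.a_closed F.smult_closed basis_elt_closed
  show ?thesis
    unfolding kaehler_rels_def Let_def using assms
    by (auto simp del: free_module_simps intro!: closed)
qed

locale kaehler_module = cring R for R (structure) +
  fixes C
  assumes C: "C \<subseteq> carrier R"
begin

sublocale K: presented_module R "carrier R" "kaehler_rels R C"
  by unfold_locales (rule kaehler_rels_subset[OF C])

abbreviation "\<Omega> \<equiv> kaehler R C"
abbreviation "d \<equiv> kaehler_d R C"

lemma \<Omega>_eq: "\<Omega> = K.presented"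
  by (simp add: kaehler_def kaehler_span_def)

lemma d_eq: "d a = K.gen a"
  by (simp add: kaehler_d_def kaehler_span_def)

lemma \<Omega>_module: "module R \<Omega>"
  unfolding \<Omega>_eq by (rule K.quot_module_module)

sublocale \<Omega>: module R \<Omega> by (rule \<Omega>_module)

lemma d_closed [simp]: "a \<in> carrier R \<Longrightarrow> d a \<in> carrier \<Omega>"
  unfolding d_eq \<Omega>_eq by (rule K.gen_closed)

lemma \<Omega>_induct:
  assumes "submodule H R \<Omega>" "\<And>a. a \<in> carrier R \<Longrightarrow> d a \<in> H"
  shows "carrier \<Omega> \<subseteq> H"
  using K.presented_induct[of H] assms by (simp add: \<Omega>_eq d_eq)

lemma d_add:
  assumes a: "a \<in> carrier R" and b: "b \<in> carrier R"
  shows "d (a \<oplus> b) = d a \<oplus>\<^bsub>\<Omega>\<^esub> d b"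
proof -
  have "K.gen (a \<oplus> b) = K.span_rels +>\<^bsub>K.free\<^esub> (basis_elt R a \<oplus>\<^bsub>K.free\<^esub> basis_elt R b)"
    using a b by (intro K.proj_eq_of_rel K.free.a_closed basis_elt_closed)
      (auto simp: kaehler_rels_def Let_def simp del: free_module_simps)
  also have "\<dots> = K.gen a \<oplus>\<^bsub>K.presented\<^esub> K.gen b"
    using a b by (intro linear_mapsD(2)[OF K.proj_linear] basis_elt_closed)
  finally show ?thesis by (simp add: d_eq \<Omega>_eq)
qed

lemma d_mult:
  assumes a: "a \<in> carrier R" and b: "b \<in> carrier R"
  shows "d (a \<otimes> b) = a \<odot>\<^bsub>\<Omega>\<^esub> d b \<oplus>\<^bsub>\<Omega>\<^esub> b \<odot>\<^bsub>\<Omega>\<^esub> d a"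
proof -
  have "K.gen (a \<otimes> b) = K.span_rels +>\<^bsub>K.free\<^esub>
      (a \<odot>\<^bsub>K.free\<^esub> basis_elt R b \<oplus>\<^bsub>K.free\<^esub> b \<odot>\<^bsub>K.free\<^esub> basis_elt R a)"
    using a b by (intro K.proj_eq_of_rel K.free.a_closed K.free.smult_closed basis_elt_closed)
      (auto simp: kaehler_rels_def Let_def simp del: free_module_simps)
  also have "\<dots> = a \<odot>\<^bsub>K.presented\<^esub> K.gen b \<oplus>\<^bsub>K.presented\<^esub> b \<odot>\<^bsub>K.presented\<^esub> K.gen a"
    using a b by (simp only: linear_mapsD[OF K.proj_linear] basis_elt_closed K.free.smult_closed)
  finally show ?thesis by (simp add: d_eq \<Omega>_eq)
qed

lemma d_const:
  assumes "c \<in> C"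
  shows "d c = \<zero>\<^bsub>\<Omega>\<^esub>"
  using K.rel_zero[of "basis_elt R c"] assms unfolding d_eq \<Omega>_eq
  by (auto simp: kaehler_rels_def Let_def)

text \<open>Universal property of the differentials: the free lift of \<open>D\<close> kills each
  family of relations by the matching law of a derivation.\<close>

lemma derivation_lift:
  assumes P: "module R P" and D: "D \<in> carrier R \<rightarrow> carrier P"
    and add: "\<And>a b. a \<in> carrier R \<Longrightarrow> b \<in> carrier R \<Longrightarrow> D (a \<oplus> b) = D a \<oplus>\<^bsub>P\<^esub> D b"
    and mult: "\<And>a b. a \<in> carrier R \<Longrightarrow> b \<in> carrier R \<Longrightarrow> D (a \<otimes> b) = a \<odot>\<^bsub>P\<^esub> D b \<oplus>\<^bsub>P\<^esub> b \<odot>\<^bsub>P\<^esub> D a"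
    and const: "\<And>c. c \<in> C \<Longrightarrow> D c = \<zero>\<^bsub>P\<^esub>"
  obtains k where "k \<in> linear_maps R \<Omega> P" "\<And>a. a \<in> carrier R \<Longrightarrow> k (d a) = D a"
proof -
  interpret P: module R P by (rule P)
  note lin = P.free_lift_linear[OF D]
  note lin_simps = linear_map_minus[OF K.free.module_axioms P lin] linear_mapsD(2,3)[OF lin]
    P.free_lift_basis_elt[OF D] K.free.a_closed K.free.smult_closed basis_elt_closed
  note Dc = funcset_mem[OF D]
  have zero: "free_lift R P D f = \<zero>\<^bsub>P\<^esub>" if "f \<in> kaehler_rels R C" for f
    using that unfolding kaehler_rels_def Let_def
    by (elim UnE CollectE exE conjE)
      (use C in \<open>simp_all add: lin_simps add mult const Dc P.minus_eq P.r_neg subsetD[OF C] del: free_module_simps\<close>)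
  show thesis
  proof (rule K.presented_lift[OF P D zero])
    fix k assume "k \<in> linear_maps R K.presented P" "\<And>a. a \<in> carrier R \<Longrightarrow> k (K.gen a) = D a"
    then show thesis by (intro that[of k]) (simp_all add: d_eq \<Omega>_eq)
  qed
qed

end

section \<open>Exterior powers\<close>

lemma tuples_update:
  "xs \<in> tuples m A \<Longrightarrow> x \<in> A \<Longrightarrow> xs[i := x] \<in> tuples m A"
  using set_update_subset_insert[of xs i x] by (auto simp: tuples_def)

lemma tuples_nth: "xs \<in> tuples m A \<Longrightarrow> l < m \<Longrightarrow> xs ! l \<in> A"
  by (auto simp: tuples_def)

lemma (in module) ext_rels_subset: "ext_rels R m M \<subseteq> carrier (free_module R (tuples m (carrier M)))"
proof -
  interpret F: module R "free_module R (tuples m (carrier M))" by (rule R.free_module_module)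
  show ?thesis
    unfolding ext_rels_def Let_def
    by (auto simp del: free_module_simps
        intro!: F.minus_closed F.a_closed F.smult_closed R.basis_elt_closed tuples_update)
qed

locale ext_module = module R M for R (structure) and M (structure) +
  fixes m :: nat
begin

sublocale E: presented_module R "tuples m (carrier M)" "ext_rels R m M"
  by (intro presented_module.intro presented_module_axioms.intro R.is_cring ext_rels_subset)

abbreviation "T \<equiv> tuples m (carrier M)"
abbreviation "ext \<equiv> ext_power R m M"
abbreviation "w \<equiv> wedge R m M"

lemma ext_eq: "ext = E.presented"
  by (simp add: ext_power_def ext_span_def)

lemma w_eq: "w xs = E.gen xs"
  by (simp add: wedge_def ext_span_def)

lemma ext_module: "module R ext"
  unfolding ext_eq by (rule E.quot_module_module)

sublocale ext: module R ext by (rule ext_module)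

lemma w_closed [simp]: "xs \<in> T \<Longrightarrow> w xs \<in> carrier ext"
  unfolding w_eq ext_eq by (rule E.gen_closed)

lemma ext_induct:
  assumes "submodule H R ext" "\<And>xs. xs \<in> T \<Longrightarrow> w xs \<in> H"
  shows "carrier ext \<subseteq> H"
  using E.presented_induct[of H] assms by (simp add: ext_eq w_eq)

lemma w_add:
  assumes xs: "xs \<in> T" and i: "i < m" and x: "x \<in> carrier M" and y: "y \<in> carrier M"
  shows "w (xs[i := x \<oplus>\<^bsub>M\<^esub> y]) = w (xs[i := x]) \<oplus>\<^bsub>ext\<^esub> w (xs[i := y])"
proof -
  note [simp] = tuples_update[OF xs]
  have "basis_elt R (xs[i := x \<oplus>\<^bsub>M\<^esub> y]) \<ominus>\<^bsub>E.free\<^esub>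
      (basis_elt R (xs[i := x]) \<oplus>\<^bsub>E.free\<^esub> basis_elt R (xs[i := y])) \<in> ext_rels R m M"
    unfolding ext_rels_def Let_def using assms by blast
  then have "E.gen (xs[i := x \<oplus>\<^bsub>M\<^esub> y]) =
      E.span_rels +>\<^bsub>E.free\<^esub> (basis_elt R (xs[i := x]) \<oplus>\<^bsub>E.free\<^esub> basis_elt R (xs[i := y]))"
    using x y by (intro E.proj_eq_of_rel E.free.a_closed R.basis_elt_closed) simp_all
  also have "\<dots> = E.gen (xs[i := x]) \<oplus>\<^bsub>E.presented\<^esub> E.gen (xs[i := y])"
    using x y by (intro linear_mapsD(2)[OF E.proj_linear] R.basis_elt_closed) simp_all
  finally show ?thesis by (simp add: w_eq ext_eq)
qed

lemma w_smult:
  assumes xs: "xs \<in> T" and i: "i < m" and a: "a \<in> carrier R" and x: "x \<in> carrier M"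
  shows "w (xs[i := a \<odot>\<^bsub>M\<^esub> x]) = a \<odot>\<^bsub>ext\<^esub> w (xs[i := x])"
proof -
  note [simp] = tuples_update[OF xs]
  have "basis_elt R (xs[i := a \<odot>\<^bsub>M\<^esub> x]) \<ominus>\<^bsub>E.free\<^esub>
      (a \<odot>\<^bsub>E.free\<^esub> basis_elt R (xs[i := x])) \<in> ext_rels R m M"
    unfolding ext_rels_def Let_def using assms by blast
  then have "E.gen (xs[i := a \<odot>\<^bsub>M\<^esub> x]) =
      E.span_rels +>\<^bsub>E.free\<^esub> (a \<odot>\<^bsub>E.free\<^esub> basis_elt R (xs[i := x]))"
    using a x by (intro E.proj_eq_of_rel E.free.smult_closed R.basis_elt_closed) simp_all
  also have "\<dots> = a \<odot>\<^bsub>E.presented\<^esub> E.gen (xs[i := x])"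
    using a x by (intro linear_mapsD(3)[OF E.proj_linear] R.basis_elt_closed) simp_all
  finally show ?thesis by (simp add: w_eq ext_eq)
qed

lemma w_alt:
  assumes "xs \<in> T" "i < m" "j < m" "i \<noteq> j" "xs ! i = xs ! j"
  shows "w xs = \<zero>\<^bsub>ext\<^esub>"
proof -
  have "\<exists>i j. i < j \<and> j < m \<and> xs ! i = xs ! j"
    using assms by (metis nat_neq_iff)
  then have "basis_elt R xs \<in> ext_rels R m M"
    unfolding ext_rels_def Let_def using assms(1) by blast
  then show ?thesis unfolding w_eq ext_eq by (rule E.rel_zero)
qed

text \<open>Expanding \<open>w(..., x + y, ..., x + y, ...) = 0\<close>.\<close>

lemma w_swap:
  assumes xs: "xs \<in> T" and i: "i < m" and j: "j < m" and ij: "i \<noteq> j"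
    and x: "x \<in> carrier M" and y: "y \<in> carrier M"
  shows "w (xs[i := x, j := y]) = \<ominus>\<^bsub>ext\<^esub> w (xs[i := y, j := x])"
proof -
  have len: "length xs = m" using xs by (simp add: tuples_def)
  note T = tuples_update[OF tuples_update[OF xs]]
  have zero: "w (xs[i := z, j := z]) = \<zero>\<^bsub>ext\<^esub>" if "z \<in> carrier M" for z
    using that i j ij len by (intro w_alt[OF T i j ij]) auto
  have expand: "w (xs[i := z, j := x \<oplus>\<^bsub>M\<^esub> y]) = w (xs[i := z, j := x]) \<oplus>\<^bsub>ext\<^esub> w (xs[i := z, j := y])"
    if "z \<in> carrier M" for z
    using that by (intro w_add tuples_update xs j x y)
  have "\<zero>\<^bsub>ext\<^esub> = w (xs[i := x \<oplus>\<^bsub>M\<^esub> y, j := x \<oplus>\<^bsub>M\<^esub> y])"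
    using zero x y by simp
  \<comment> \<open>Additivity expands the outermost update, and updates at distinct positions
    commute; the exchange brings position \<open>i\<close> to the outside.\<close>
  also have "\<dots> = w (xs[j := x \<oplus>\<^bsub>M\<^esub> y, i := x \<oplus>\<^bsub>M\<^esub> y])"
    using ij by (simp add: list_update_swap)
  also have "\<dots> = w (xs[j := x \<oplus>\<^bsub>M\<^esub> y, i := x]) \<oplus>\<^bsub>ext\<^esub> w (xs[j := x \<oplus>\<^bsub>M\<^esub> y, i := y])"
    using x y by (intro w_add tuples_update xs i) auto
  also have "\<dots> = w (xs[i := x, j := x \<oplus>\<^bsub>M\<^esub> y]) \<oplus>\<^bsub>ext\<^esub> w (xs[i := y, j := x \<oplus>\<^bsub>M\<^esub> y])"
    using ij by (simp add: list_update_swap)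
  also have "\<dots> = w (xs[i := x, j := y]) \<oplus>\<^bsub>ext\<^esub> w (xs[i := y, j := x])"
    using x y T by (simp add: expand zero)
  finally show ?thesis
    using T x y by (intro ext.M.minus_equality[symmetric]) simp_all
qed

text \<open>Universal property of the exterior power: multilinearity and alternation of
  \<open>A\<close> are exactly what makes its free lift vanish on the three families of
  relations.\<close>

lemma alternating_lift:
  assumes P: "module R P" and A: "A \<in> T \<rightarrow> carrier P"
    and add: "\<And>xs i x y. xs \<in> T \<Longrightarrow> i < m \<Longrightarrow> x \<in> carrier M \<Longrightarrow> y \<in> carrier M \<Longrightarrow>
      A (xs[i := x \<oplus>\<^bsub>M\<^esub> y]) = A (xs[i := x]) \<oplus>\<^bsub>P\<^esub> A (xs[i := y])"
    and smult: "\<And>xs i a x. xs \<in> T \<Longrightarrow> i < m \<Longrightarrow> a \<in> carrier R \<Longrightarrow> x \<in> carrier M \<Longrightarrow>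
      A (xs[i := a \<odot>\<^bsub>M\<^esub> x]) = a \<odot>\<^bsub>P\<^esub> A (xs[i := x])"
    and alt: "\<And>xs i j. xs \<in> T \<Longrightarrow> i < j \<Longrightarrow> j < m \<Longrightarrow> xs ! i = xs ! j \<Longrightarrow> A xs = \<zero>\<^bsub>P\<^esub>"
  obtains k where "k \<in> linear_maps R ext P" "\<And>xs. xs \<in> T \<Longrightarrow> k (w xs) = A xs"
proof -
  interpret P: module R P by (rule P)
  note lin = P.free_lift_linear[OF A]
  note lin_simps = linear_map_minus[OF E.free.module_axioms P lin] linear_mapsD(2,3)[OF lin]
    P.free_lift_basis_elt[OF A] E.free.a_closed E.free.smult_closed R.basis_elt_closed
  note Ac = funcset_mem[OF A]
  have zero: "free_lift R P A f = \<zero>\<^bsub>P\<^esub>" if "f \<in> ext_rels R m M" for f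
    using that unfolding ext_rels_def Let_def
    by (elim UnE CollectE exE conjE)
      (simp_all add: lin_simps add smult alt Ac tuples_update P.minus_eq P.r_neg del: free_module_simps)
  show thesis
  proof (rule E.presented_lift[OF P A zero])
    fix k assume "k \<in> linear_maps R E.presented P" "\<And>xs. xs \<in> T \<Longrightarrow> k (E.gen xs) = A xs"
    then show thesis by (intro that[of k]) (simp_all add: ext_eq w_eq)
  qed
qed

lemma w_linear:
  assumes "xs \<in> T" "i < m"
  shows "(\<lambda>x. w (xs[i := x])) \<in> linear_maps R M ext"
  using assms by (auto simp: linear_maps_def w_add w_smult tuples_update)

text \<open>Permutations are products of transpositions, and each transposition only changes the
  sign of the wedge. A submodule is closed under negation, so no signs have to be tracked.\<close>

lemma w_permute:
  assumes H: "submodule H R ext" and e: "\<And>i. i < m \<Longrightarrow> e i \<in> carrier M"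
    and base: "w (map e [0..<m]) \<in> H" and \<sigma>: "\<sigma> permutes {..<m}"
  shows "w (map (\<lambda>i. e (\<sigma> i)) [0..<m]) \<in> H"
  using finite_lessThan \<sigma>
proof (induction rule: permutes_rev_induct)
  case id
  show ?case using base by simp
next
  case (swap a b p)
  let ?xs = "map (\<lambda>i. e (p i)) [0..<m]"
  have ab: "a < m" "b < m" using swap by auto
  have p: "p i < m" if "i < m" for i
    using that permutes_in_image[OF \<open>p permutes {..<m}\<close>, of i] by simp
  have T: "?xs \<in> T" using e p by (auto simp: tuples_def)
  \<comment> \<open>Composing with a transposition on the right exchanges the entries at positions
    \<open>a\<close> and \<open>b\<close> of the list.\<close>
  have "map (\<lambda>i. e ((p \<circ> Transposition.transpose a b) i)) [0..<m] = ?xs[a := e (p b), b := e (p a)]"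
    using ab \<open>a \<noteq> b\<close> by (intro nth_equalityI) (auto simp: nth_list_update Transposition.transpose_def)
  also have "w \<dots> = \<ominus>\<^bsub>ext\<^esub> w (?xs[a := e (p a), b := e (p b)])"
    using e p ab \<open>a \<noteq> b\<close> by (intro w_swap T) auto
  also have "?xs[a := e (p a), b := e (p b)] = ?xs"
    using ab by (intro nth_equalityI) (auto simp: nth_list_update)
  also have "\<ominus>\<^bsub>ext\<^esub> w ?xs \<in> H" using swap.IH ext.submoduleE(3)[OF H] by blast
  finally show ?case .
qed

text \<open>The wedge is linear in each entry separately, so the entries can be reduced one position
  at a time to members of \<open>e\<close>. A wedge of \<open>m\<close> members of \<open>e\<close>
  either repeats one and vanishes, or permutes the given wedge.\<close>

lemma ext_generated:
  assumes e: "\<And>i. i < m \<Longrightarrow> e i \<in> carrier M"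
    and span: "\<And>H. submodule H R M \<Longrightarrow> (\<And>i. i < m \<Longrightarrow> e i \<in> H) \<Longrightarrow> carrier M \<subseteq> H"
    and H: "submodule H R ext" and base: "w (map e [0..<m]) \<in> H"
  shows "carrier ext \<subseteq> H"
proof (rule ext_induct[OF H])
  \<comment> \<open>Here \<open>k\<close> bounds the positions that may still carry arbitrary
    entries; from \<open>k\<close> on all entries are already members of \<open>e\<close>.\<close>
  have claim: "w xs \<in> H"
    if "k \<le> m" "xs \<in> T" "\<And>l. k \<le> l \<Longrightarrow> l < m \<Longrightarrow> xs ! l \<in> e ` {..<m}" for k xs
    using that
  proof (induction k arbitrary: xs)
    case 0
    have len: "length xs = m" using 0(2) by (simp add: tuples_def)
    have "\<forall>l. \<exists>i. l < m \<longrightarrow> i < m \<and> xs ! l = e i" using 0(3) by auto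
    then obtain s where s: "\<And>l. l < m \<Longrightarrow> s l < m \<and> xs ! l = e (s l)" by metis
    show ?case
    proof (cases "inj_on s {..<m}")
      case True
      \<comment> \<open>Nothing is known about \<open>s\<close> from \<open>m\<close> on, while a
        permutation of \<open>{..<m}\<close> has to fix these indices.\<close>
      define \<sigma> where "\<sigma> l = (if l < m then s l else l)" for l
      have "inj_on \<sigma> {..<m}" using True by (auto simp: \<sigma>_def inj_on_def)
      moreover have "\<sigma> ` {..<m} \<subseteq> {..<m}" using s by (auto simp: \<sigma>_def)
      ultimately have "bij_betw \<sigma> {..<m} {..<m}"
        by (simp add: bij_betw_def endo_inj_surj)
      then have "\<sigma> permutes {..<m}" by (rule bij_imp_permutes) (simp add: \<sigma>_def)
      then have "w (map (\<lambda>i. e (\<sigma> i)) [0..<m]) \<in> H" by (intro w_permute[OF H _ base] e)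
      also have "map (\<lambda>i. e (\<sigma> i)) [0..<m] = xs"
        using len s by (intro nth_equalityI) (auto simp: \<sigma>_def)
      finally show ?thesis .
    next
      case False
      then obtain i j where ij: "i < m" "j < m" "i \<noteq> j" "s i = s j" by (auto simp: inj_on_def)
      then have "xs ! i = xs ! j" using s[of i] s[of j] by simp
      then have "w xs = \<zero>\<^bsub>ext\<^esub>" by (rule w_alt[OF 0(2) ij(1-3)])
      then show ?thesis using submodule_zero_closed[OF H] by simp
    qed
  next
    case (Suc k)
    have len: "length xs = m" using Suc.prems by (simp add: tuples_def)
    let ?V = "{x \<in> carrier M. w (xs[k := x]) \<in> H}"
    have k: "k < m" using Suc.prems by simp
    have "submodule ?V R M"
      by (rule submodule_vimage[OF module_axioms ext_module w_linear[OF Suc.prems(2) k] H])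
    moreover have "e i \<in> ?V" if "i < m" for i
    proof -
      have "w (xs[k := e i]) \<in> H"
      proof (rule Suc.IH)
        show "xs[k := e i] ! l \<in> e ` {..<m}" if "k \<le> l" "l < m" for l
          using that \<open>i < m\<close> Suc.prems(3)[of l] len by (cases "l = k") auto
      qed (use Suc.prems e that in \<open>auto simp: tuples_update\<close>)
      then show ?thesis using e that by simp
    qed
    ultimately have "carrier M \<subseteq> ?V" by (rule span)
    moreover have "xs ! k \<in> carrier M" using Suc.prems(2) k len by (auto simp: tuples_def)
    \<comment> \<open>The entry actually standing at position \<open>k\<close> is one of the
      admissible values, and putting it back leaves the list unchanged.\<close>
    ultimately have "w (xs[k := xs ! k]) \<in> H" by blast
    then show ?case by simp
  qed
  show "w xs \<in> H" if "xs \<in> T" for xs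
    using that by (intro claim[of m]) auto
qed

text \<open>Replacing the entry \<open>x_i\<close> by the vanishing combination, all terms but the \<open>i\<close>-th are alternating zeros.\<close>

lemma w_linear_relation:
  assumes xs: "xs \<in> T" and i: "i < m" and c: "\<And>l. l < m \<Longrightarrow> c l \<in> carrier R"
    and rel: "(\<Oplus>\<^bsub>M\<^esub>l\<in>{..<m}. c l \<odot>\<^bsub>M\<^esub> xs ! l) = \<zero>\<^bsub>M\<^esub>"
  shows "c i \<odot>\<^bsub>ext\<^esub> w xs = \<zero>\<^bsub>ext\<^esub>"
proof -
  have len: "length xs = m" using xs by (simp add: tuples_def)
  have xsl: "xs ! l \<in> carrier M" if "l < m" for l using xs that by (auto simp: tuples_def)
  note lin = w_linear[OF xs i]
  have "\<zero>\<^bsub>ext\<^esub> = w (xs[i := (\<Oplus>\<^bsub>M\<^esub>l\<in>{..<m}. c l \<odot>\<^bsub>M\<^esub> xs ! l)])"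
    using linear_map_zero[OF module_axioms ext_module lin] rel by simp
  also have "\<dots> = (\<Oplus>\<^bsub>ext\<^esub>l\<in>{..<m}. w (xs[i := c l \<odot>\<^bsub>M\<^esub> xs ! l]))"
    using c xsl by (intro linear_map_finsum[OF module_axioms ext_module lin]) auto
  also have "\<dots> = (\<Oplus>\<^bsub>ext\<^esub>l\<in>{..<m}. if i = l then c l \<odot>\<^bsub>ext\<^esub> w xs else \<zero>\<^bsub>ext\<^esub>)"
  proof (rule ext.M.finsum_cong'[OF refl])
    show "w (xs[i := c l \<odot>\<^bsub>M\<^esub> xs ! l]) = (if i = l then c l \<odot>\<^bsub>ext\<^esub> w xs else \<zero>\<^bsub>ext\<^esub>)"
      if l: "l \<in> {..<m}" for l
    proof -
      have "w (xs[i := c l \<odot>\<^bsub>M\<^esub> xs ! l]) = c l \<odot>\<^bsub>ext\<^esub> w (xs[i := xs ! l])"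
        using l c xsl by (intro w_smult xs i) auto
      moreover have "w (xs[i := xs ! l]) = \<zero>\<^bsub>ext\<^esub>" if "i \<noteq> l"
        using that l i len xsl by (intro w_alt[of _ i l] tuples_update xs) auto
      ultimately show ?thesis using c l by auto
    qed
  qed (use c xs in auto)
  also have "\<dots> = c i \<odot>\<^bsub>ext\<^esub> w xs"
    using i c xs by (intro ext.M.finsum_singleton) auto
  finally show ?thesis ..
qed

end

section \<open>Polynomials, partial derivatives and homogeneous components\<close>

abbreviation "lookup \<equiv> Poly_Mapping.lookup"
abbreviation "keys \<equiv> Poly_Mapping.keys"
abbreviation "single \<equiv> Poly_Mapping.single"

section \<open>The coordinate ring as sums of monomials\<close>

lemma poly_mapping_eq_sum_single:
  fixes p :: "'a \<Rightarrow>\<^sub>0 'b::comm_monoid_add"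
  shows "p = (\<Sum>m\<in>keys p. single m (lookup p m))"
  by (rule poly_mapping_eqI)
    (auto simp: lookup_sum lookup_single when_def in_keys_iff sum.delta)

text \<open>The monomial case is asked only for monomials occurring in \<open>p\<close>, with their
  own coefficients, so that assumptions on \<open>p\<close> such as homogeneity can be used
  there.\<close>

lemma poly_mapping_add_induct [case_names zero single add]:
  fixes p :: "'a \<Rightarrow>\<^sub>0 'b::comm_monoid_add"
  assumes zero: "P 0"
    and single: "\<And>m. m \<in> keys p \<Longrightarrow> P (single m (lookup p m))"
    and add: "\<And>p q. P p \<Longrightarrow> P q \<Longrightarrow> P (p + q)"
  shows "P p"
proof -
  have "P (\<Sum>m\<in>A. single m (lookup p m))" if "finite A" "A \<subseteq> keys p" for A
    using that by (induction A) (auto simp: zero intro!: add single)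
  from this[OF finite_keys subset_refl] show ?thesis
    by (simp flip: poly_mapping_eq_sum_single)
qed

lemma coord_ring_simps [simp]:
  "mult (coord_ring n) = (*)" "one (coord_ring n) = 1"
  "zero (coord_ring n) = 0" "add (coord_ring n) = (+)"
  by (simp_all add: coord_ring_def)

lemma coord_ring_carrier:
  "p \<in> carrier (coord_ring n) \<longleftrightarrow> (\<forall>m\<in>keys p. keys m \<subseteq> {..n})"
  by (simp add: coord_ring_def)

lemma keys_add_nat: "keys (m + m' :: 'a \<Rightarrow>\<^sub>0 nat) = keys m \<union> keys m'"
  by (auto simp: in_keys_iff lookup_add)

lemma coord_ring_closed [simp]:
  fixes p q :: "'k::comm_ring_1 mpoly"
  shows "(0 :: 'k mpoly) \<in> carrier (coord_ring n)" "(1 :: 'k mpoly) \<in> carrier (coord_ring n)"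
  "p \<in> carrier (coord_ring n) \<Longrightarrow> - p \<in> carrier (coord_ring n)"
  "p \<in> carrier (coord_ring n) \<Longrightarrow> q \<in> carrier (coord_ring n) \<Longrightarrow> p + q \<in> carrier (coord_ring n)"
  "p \<in> carrier (coord_ring n) \<Longrightarrow> q \<in> carrier (coord_ring n) \<Longrightarrow> p - q \<in> carrier (coord_ring n)"
  "p \<in> carrier (coord_ring n) \<Longrightarrow> q \<in> carrier (coord_ring n) \<Longrightarrow> p * q \<in> carrier (coord_ring n)"
  "const_poly (c :: 'k) \<in> carrier (coord_ring n)"
  "i \<le> n \<Longrightarrow> (var_poly i :: 'k mpoly) \<in> carrier (coord_ring n)"
proof -
  have add: "p + q \<in> carrier (coord_ring n)"
    if "p \<in> carrier (coord_ring n)" "q \<in> carrier (coord_ring n)" for p q :: "'k mpoly"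
    using that keys_add[of p q] by (auto simp: coord_ring_carrier)
  have neg: "- p \<in> carrier (coord_ring n)" if "p \<in> carrier (coord_ring n)" for p :: "'k mpoly"
    using that by (simp add: coord_ring_carrier in_keys_iff)
  show "p + q \<in> carrier (coord_ring n)" if "p \<in> carrier (coord_ring n)" "q \<in> carrier (coord_ring n)"
    by (rule add[OF that])
  show "- p \<in> carrier (coord_ring n)" if "p \<in> carrier (coord_ring n)"
    by (rule neg[OF that])
  show "p - q \<in> carrier (coord_ring n)" if "p \<in> carrier (coord_ring n)" "q \<in> carrier (coord_ring n)"
    using add[OF that(1) neg[OF that(2)]] by simp
  show "p * q \<in> carrier (coord_ring n)" if "p \<in> carrier (coord_ring n)" "q \<in> carrier (coord_ring n)"
  proof -
    have "keys (a + b) \<subseteq> {..n}" if "a \<in> keys p" "b \<in> keys q" for a b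
      using that \<open>p \<in> _\<close> \<open>q \<in> _\<close> by (simp add: coord_ring_carrier keys_add_nat)
    then show ?thesis
      unfolding coord_ring_carrier using keys_mult[of p q] by blast
  qed
qed (auto simp: coord_ring_carrier const_poly_def var_poly_def)

lemma coord_ring_sum_closed [simp]:
  "(\<And>i. i \<in> A \<Longrightarrow> f i \<in> carrier (coord_ring n)) \<Longrightarrow> sum f A \<in> carrier (coord_ring n)"
  by (induction A rule: infinite_finite_induct) auto

lemma coord_ring_prod_closed [simp]:
  "(\<And>i. i \<in> A \<Longrightarrow> f i \<in> carrier (coord_ring n)) \<Longrightarrow> prod f A \<in> carrier (coord_ring n)"
  by (induction A rule: infinite_finite_induct) auto

lemma coord_ring_cring: "cring (coord_ring n)"
proof (rule cringI)
  show "abelian_group (coord_ring n)"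
  proof (rule abelian_groupI)
    fix p assume "p \<in> carrier (coord_ring n)"
    then show "\<exists>q\<in>carrier (coord_ring n). q \<oplus>\<^bsub>coord_ring n\<^esub> p = \<zero>\<^bsub>coord_ring n\<^esub>"
      by (intro bexI[of _ "- p"]) auto
  qed (auto simp: algebra_simps)
  show "comm_monoid (coord_ring n)"
    by (rule comm_monoidI) (auto simp: algebra_simps)
qed (auto simp: algebra_simps)

lemma coord_ring_a_inv [simp]:
  assumes "p \<in> carrier (coord_ring n)"
  shows "\<ominus>\<^bsub>coord_ring n\<^esub> p = - p"
proof -
  interpret cring "coord_ring n" by (rule coord_ring_cring)
  show ?thesis using minus_equality[of "- p" p] assms by simp
qed

section \<open>Degrees and forms\<close>

definition monom_degree :: "nat \<Rightarrow> (nat \<Rightarrow>\<^sub>0 nat) \<Rightarrow> nat" where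
  "monom_degree n m = (\<Sum>i\<le>n. lookup m i)"

lemma monom_degree_add [simp]: "monom_degree n (m + m') = monom_degree n m + monom_degree n m'"
  by (simp add: monom_degree_def lookup_add sum.distrib)

lemma monom_degree_zero [simp]: "monom_degree n 0 = 0"
  by (simp add: monom_degree_def)

lemma monom_degree_single [simp]: "i \<le> n \<Longrightarrow> monom_degree n (single i (Suc 0)) = Suc 0"
  by (simp add: monom_degree_def lookup_single when_def)

lemma forms_iff:
  "p \<in> forms n d \<longleftrightarrow> p \<in> carrier (coord_ring n) \<and> (\<forall>m\<in>keys p. int (monom_degree n m) = d)"
  by (simp add: forms_def monom_degree_def)

lemma sub_add_single: "lookup m i \<noteq> 0 \<Longrightarrow> (m - single i 1) + single i (1::nat) = m"
  by (rule poly_mapping_eqI) (auto simp: lookup_add lookup_minus lookup_single when_def)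

text \<open>Induction on the degree. The bound on the keys is essential: \<open>monom_degree\<close>
  sees only the variables up to X_n, and degree zero must force \<open>m = 0\<close>.\<close>

lemma monom_induct [consumes 1, case_names zero add]:
  fixes n :: nat and m :: "nat \<Rightarrow>\<^sub>0 nat"
  assumes "keys m \<subseteq> {..n}" "P 0" "\<And>m i. i \<le> n \<Longrightarrow> P m \<Longrightarrow> P (m + single i 1)"
  shows "P m"
  using assms(1)
proof (induction "monom_degree n m" arbitrary: m)
  case 0
  then have "m = 0"
    by (auto simp: monom_degree_def subset_iff in_keys_iff intro!: poly_mapping_eqI)
  then show ?case using assms(2) by simp
next
  case (Suc k)
  then have "\<exists>i\<le>n. lookup m i \<noteq> 0"
    by (metis Suc_neq_Zero atMost_iff monom_degree_def sum.neutral)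
  then obtain i where i: "i \<le> n" "lookup m i \<noteq> 0" by blast
  have eq: "(m - single i 1) + single i 1 = m" by (rule sub_add_single[OF i(2)])
  have "Suc k = monom_degree n (m - single i 1) + 1"
    using Suc.hyps(2) i(1) monom_degree_single[OF i(1)] arg_cong[OF eq, of "monom_degree n"] by simp
  moreover have "keys (m - single i 1) \<subseteq> {..n}"
    using Suc.prems by (auto simp: in_keys_iff lookup_minus subset_iff)
  ultimately have "P (m - single i 1)" using Suc.hyps(1) by simp
  then have "P ((m - single i 1) + single i 1)" by (rule assms(3)[OF i(1)])
  then show ?case by (simp only: eq)
qed

text \<open>Made for the chain rule: where both sides of an identity respect sums and obey the same
  product rule, constants and variables suffice.\<close>

lemma coord_ring_induct [consumes 1, case_names const var add mult]:
  assumes "p \<in> carrier (coord_ring n)"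
    and const: "\<And>c. P (const_poly c)"
    and var: "\<And>i. i \<le> n \<Longrightarrow> P (var_poly i)"
    and add: "\<And>p q. p \<in> carrier (coord_ring n) \<Longrightarrow> q \<in> carrier (coord_ring n) \<Longrightarrow> P p \<Longrightarrow> P q \<Longrightarrow> P (p + q)"
    and mult: "\<And>p q. p \<in> carrier (coord_ring n) \<Longrightarrow> q \<in> carrier (coord_ring n) \<Longrightarrow> P p \<Longrightarrow> P q \<Longrightarrow> P (p * q)"
  shows "P p"
proof -
  \<comment> \<open>Membership is carried along because \<open>add\<close> and \<open>mult\<close>
    ask for it. The coefficient sits in the constant from which the monomial is built up variable by
    variable.\<close>
  have "single m c \<in> carrier (coord_ring n) \<and> P (single m c)" if "keys m \<subseteq> {..n}" for m c
    using that
  proof (induction rule: monom_induct)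
    case zero
    then show ?case using const[of c] coord_ring_closed(7)[of c n] by (simp add: const_poly_def)
  next
    case (add m i)
    have "single (m + single i 1) c = single m c * var_poly i"
      by (simp add: var_poly_def mult_single)
    then show ?case using add mult[of "single m c" "var_poly i"] var[of i] by simp
  qed
  then have "p \<in> carrier (coord_ring n) \<and> P p"
  proof (intro poly_mapping_add_induct[of "\<lambda>q. q \<in> carrier (coord_ring n) \<and> P q" p])
    show "0 \<in> carrier (coord_ring n) \<and> P 0"
      using const[of 0] by (simp add: const_poly_def)
  qed (use assms(1) in \<open>auto simp: coord_ring_carrier[of p] add\<close>)
  then show ?thesis ..
qed

lemma forms_closed:
  "0 \<in> forms n d" "1 \<in> forms n 0" "const_poly c \<in> forms n 0"
  "i \<le> n \<Longrightarrow> var_poly i \<in> forms n 1"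
  "p \<in> forms n d \<Longrightarrow> - p \<in> forms n d"
  "p \<in> forms n d \<Longrightarrow> q \<in> forms n d \<Longrightarrow> p + q \<in> forms n d"
  "p \<in> forms n d \<Longrightarrow> q \<in> forms n e \<Longrightarrow> p * q \<in> forms n (d + e)"
proof -
  show "p + q \<in> forms n d" if "p \<in> forms n d" "q \<in> forms n d"
    using that keys_add[of p q] by (auto simp: forms_iff)
  show "p * q \<in> forms n (d + e)" if "p \<in> forms n d" "q \<in> forms n e"
    using that keys_mult[of p q] by (fastforce simp: forms_iff)
qed (auto simp: forms_iff, auto simp: const_poly_def var_poly_def split: if_splits)

lemma forms_subset: "p \<in> forms n d \<Longrightarrow> p \<in> carrier (coord_ring n)"
  by (simp add: forms_iff)

lemma forms_sum: "(\<And>i. i \<in> A \<Longrightarrow> f i \<in> forms n d) \<Longrightarrow> sum f A \<in> forms n d"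
  by (induction A rule: infinite_finite_induct) (auto intro: forms_closed)

lemma forms_prod: "(\<And>i. i \<in> A \<Longrightarrow> f i \<in> forms n (d i)) \<Longrightarrow> prod f A \<in> forms n (sum d A)"
  by (induction A rule: infinite_finite_induct) (auto intro!: forms_closed)

section \<open>Partial derivatives and Euler's identity\<close>

text \<open>This description by coefficients contains no truncated subtraction and is visibly
  additive in \<open>p\<close>, unlike the sum over \<open>keys p\<close> in the definition.\<close>

lemma lookup_partial:
  "lookup (partial i p) m = of_nat (Suc (lookup m i)) * lookup p (m + single i 1)"
proof -
  \<comment> \<open>If X_i does not occur in the monomial, both sides vanish through the factor
    zero; otherwise lowering and raising the exponent are inverse.\<close>
  have eq: "(of_nat (lookup m' i) * lookup p m' when m' - single i 1 = m) =
      (of_nat (lookup m' i) * lookup p m' when m' = m + single i 1)" for m'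
  proof (cases "lookup m' i = 0")
    case False
    then have "m' - single i 1 = m \<longleftrightarrow> m' = m + single i 1"
      using sub_add_single[of m' i] by auto
    then show ?thesis by simp
  qed (auto simp: when_def)
  have "lookup (partial i p) m =
      (\<Sum>m'\<in>keys p. of_nat (lookup m' i) * lookup p m' when m' - single i 1 = m)"
    by (simp add: partial_def lookup_sum lookup_single)
  also have "\<dots> = (\<Sum>m'\<in>keys p. of_nat (lookup m' i) * lookup p m' when m' = m + single i 1)"
    by (rule sum.cong[OF refl eq])
  also have "\<dots> = of_nat (Suc (lookup m i)) * lookup p (m + single i 1)"
    by (auto simp: when_def sum.delta in_keys_iff lookup_add)
  finally show ?thesis .
qed

lemma partial_zero [simp]: "partial i 0 = 0"
  by (simp add: partial_def)

lemma partial_add: "partial i (p + q) = partial i p + partial i q"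
  by (rule poly_mapping_eqI) (simp add: lookup_partial lookup_add algebra_simps)

lemma partial_diff: "partial i (p - q) = partial i p - partial i q"
  by (rule poly_mapping_eqI) (simp add: lookup_partial lookup_minus algebra_simps)

lemma partial_uminus: "partial i (- p) = - partial i p"
  by (rule poly_mapping_eqI) (simp add: lookup_partial)

lemma partial_single: "partial i (single m c) = single (m - single i 1) (of_nat (lookup m i) * c)"
  by (simp add: partial_def)

lemma partial_const [simp]: "partial i (const_poly c) = 0"
  by (simp add: const_poly_def partial_single)

lemma partial_var: "partial i (var_poly j) = (if i = j then 1 else 0)"
  by (auto simp: var_poly_def partial_single lookup_single when_def)

text \<open>Both sides are additive in each factor, which leaves two monomials; there the rule says
  that exponents add.\<close>

lemma partial_mult: "partial i (p * q) = p * partial i q + q * partial i p"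
proof (induction p rule: poly_mapping_add_induct)
  case (single m)
  show ?case
  proof (induction q rule: poly_mapping_add_induct)
    case (single m')
    \<comment> \<open>Truncated subtraction commutes with adding \<open>m\<close> only if X_i occurs
      in the differentiated monomial; if it does not, the coefficient is zero.\<close>
    have "single m c * partial i (single m' c') = single (m + m' - single i 1) (of_nat (lookup m' i) * (c * c'))"
      for m m' :: "nat \<Rightarrow>\<^sub>0 nat" and c c' :: 'a
    proof (cases "lookup m' i = 0")
      case False
      then have "m + (m' - single i 1) = m + m' - single i 1"
        by (intro poly_mapping_eqI) (auto simp: lookup_add lookup_minus lookup_single when_def)
      then show ?thesis by (simp add: partial_single mult_single algebra_simps)
    qed (simp add: partial_single)
    note this[of m "lookup p m" m' "lookup q m'"] this[of m' "lookup q m'" m "lookup p m"]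
    then show ?case
      by (simp add: mult_single partial_single lookup_add add.commute[of m']
          flip: single_add) (simp add: algebra_simps)
  qed (simp_all add: partial_add algebra_simps)
qed (simp_all add: partial_add algebra_simps)

lemma partial_closed [simp]:
  assumes "p \<in> carrier (coord_ring n)"
  shows "partial i p \<in> carrier (coord_ring n)"
proof -
  have "m + single i 1 \<in> keys p" if "m \<in> keys (partial i p)" for m
    using that by (auto simp: in_keys_iff lookup_partial)
  then show ?thesis using assms by (fastforce simp: coord_ring_carrier keys_add_nat)
qed

text \<open>The degree is an integer: for a constant form it drops to -1, where the only form is
  zero.\<close>

lemma partial_forms:
  assumes "p \<in> forms n d" "i \<le> n"
  shows "partial i p \<in> forms n (d - 1)"
proof -
  have "m + single i 1 \<in> keys p" if "m \<in> keys (partial i p)" for m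
    using that by (auto simp: in_keys_iff lookup_partial)
  then show ?thesis using assms by (fastforce simp: forms_iff)
qed

text \<open>On a monomial, X_i \<partial>/\<partial>X_i multiplies by the exponent of X_i, and these
  exponents add up to the degree.\<close>

lemma euler_identity:
  assumes "p \<in> forms n d"
  shows "(\<Sum>i\<le>n. var_poly i * partial i p) = const_poly (of_int d) * p"
proof (induction p rule: poly_mapping_add_induct)
  case (single m)
  let ?c = "lookup p m"
  have "var_poly i * partial i (single m ?c) = single m (of_nat (lookup m i) * ?c)" for i
    using sub_add_single[of m i]
    by (cases "lookup m i = 0") (simp_all add: partial_single var_poly_def mult_single add.commute)
  then have "(\<Sum>i\<le>n. var_poly i * partial i (single m ?c)) =
      (\<Sum>i\<le>n. single m (of_nat (lookup m i) * ?c))"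
    by simp
  also have "\<dots> = single m (of_nat (monom_degree n m) * ?c)"
    by (rule poly_mapping_eqI)
      (simp add: lookup_sum lookup_single when_def monom_degree_def sum_distrib_right)
  also have "of_nat (monom_degree n m) = (of_int d :: 'a)"
    using assms single by (auto simp: forms_iff)
  finally show ?case by (simp add: const_poly_def mult_single del: single_of_int)
qed (simp_all add: partial_add algebra_simps sum.distrib)

section \<open>Homogeneous components of polynomials\<close>

definition component :: "nat \<Rightarrow> int \<Rightarrow> 'k::comm_ring_1 mpoly \<Rightarrow> 'k mpoly" where
  "component n d p = (\<Sum>m\<in>keys p. if int (monom_degree n m) = d then single m (lookup p m) else 0)"

lemma lookup_component:
  "lookup (component n d p) m = (if int (monom_degree n m) = d then lookup p m else 0)"
proof -
  have "lookup (component n d p) m =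
      (\<Sum>m'\<in>keys p. if m' = m then if int (monom_degree n m) = d then lookup p m else 0 else 0)"
    unfolding component_def lookup_sum
    by (rule sum.cong) (auto simp: lookup_single)
  then show ?thesis by (auto simp: sum.delta in_keys_iff)
qed

lemma component_zero [simp]: "component n d 0 = 0"
  by (simp add: component_def)

lemma component_add: "component n d (p + q) = component n d p + component n d q"
  by (rule poly_mapping_eqI) (simp add: lookup_component lookup_add)

lemma component_uminus: "component n d (- p) = - component n d p"
  by (rule poly_mapping_eqI) (simp add: lookup_component)

lemma component_sum: "component n d (sum f A) = (\<Sum>i\<in>A. component n d (f i))"
  by (induction A rule: infinite_finite_induct) (auto simp: component_add)

lemma component_forms:
  assumes "p \<in> carrier (coord_ring n)"
  shows "component n d p \<in> forms n d"
  using assms by (auto simp: forms_iff coord_ring_carrier in_keys_iff lookup_component split: if_splits)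

lemma component_of_form:
  assumes "p \<in> forms n e"
  shows "component n d p = (if d = e then p else 0)"
  using assms by (intro poly_mapping_eqI) (auto simp: lookup_component forms_iff in_keys_iff)

lemma sum_components:
  assumes "finite D" "(\<lambda>m. int (monom_degree n m)) ` keys p \<subseteq> D"
  shows "(\<Sum>d\<in>D. component n d p) = p"
proof (rule poly_mapping_eqI)
  fix m
  show "lookup (\<Sum>d\<in>D. component n d p) m = lookup p m"
    using assms by (cases "m \<in> keys p") (auto simp: lookup_sum lookup_component sum.delta' in_keys_iff)
qed

text \<open>Multiplying by a monomial shifts degrees. The difference is formed in the integers; if
  it is negative, both sides are zero.\<close>

lemma component_single_mult:
  "component n d (single m c * p) = single m c * component n (d - int (monom_degree n m)) p"
proof (induction p rule: poly_mapping_add_induct)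
  case (single m')
  have "component n d (single m c) = (if int (monom_degree n m) = d then single m c else 0)"
    for m d and c :: 'a
    by (rule poly_mapping_eqI) (auto simp: lookup_component lookup_single when_def)
  then show ?case by (auto simp: mult_single)
qed (simp_all add: component_add algebra_simps)

text \<open>The polynomials with all components in the ideal form an ideal themselves, and it
  contains every generator, since a form is its own only nonzero component.\<close>

lemma homogeneous_generators_component:
  fixes G :: "'k::comm_ring_1 mpoly set"
  assumes G: "\<And>g. g \<in> G \<Longrightarrow> homogeneous n g" and p: "p \<in> genideal (coord_ring n) G"
  shows "component n d p \<in> genideal (coord_ring n) G"
proof -
  interpret S: cring "coord_ring n" by (rule coord_ring_cring)
  have GC: "G \<subseteq> carrier (coord_ring n)"
    using G by (auto simp: homogeneous_def forms_iff)
  let ?J = "genideal (coord_ring n) G"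
  \<comment> \<open>All degrees are required at once, because multiplication by a monomial moves a
    component to another degree.\<close>
  let ?H = "{p \<in> carrier (coord_ring n). \<forall>d. component n d p \<in> ?J}"
  interpret J: ideal ?J "coord_ring n" by (rule S.genideal_ideal[OF GC])
  have mult: "a * p \<in> ?H" if a: "a \<in> carrier (coord_ring n)" and p: "p \<in> ?H" for a p
  proof -
    have "a * p \<in> carrier (coord_ring n)" using a p by simp
    moreover have "\<forall>d. component n d (a * p) \<in> ?J"
    proof (induction a rule: poly_mapping_add_induct)
      case zero
      then show ?case using J.zero_closed by simp
    next
      case (single m)
      then have "single m (lookup a m) \<in> carrier (coord_ring n)"
        using a by (auto simp: coord_ring_carrier)
      then show ?case using p J.I_l_closed by (simp add: component_single_mult)
    next
      case (add a b)
      then show ?case using J.a_closed by (simp add: distrib_right component_add)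
    qed
    ultimately show ?thesis by simp
  qed
  have "ideal ?H (coord_ring n)"
  proof (rule idealI)
    show "subgroup ?H (add_monoid (coord_ring n))"
    proof
      fix p assume p: "p \<in> ?H"
      then have "inv\<^bsub>add_monoid (coord_ring n)\<^esub> p = - p"
        using coord_ring_a_inv[of p n] by (simp add: a_inv_def)
      then show "inv\<^bsub>add_monoid (coord_ring n)\<^esub> p \<in> ?H"
        using p J.a_inv_closed J.a_Hcarr by (fastforce simp: component_uminus)
    qed (use J.zero_closed J.a_closed in \<open>auto simp: component_add\<close>)
  next
    fix a p :: "'k mpoly" assume "p \<in> ?H" "a \<in> carrier (coord_ring n)"
    then have "a * p \<in> ?H" by (rule mult[rotated])
    then show "a \<otimes>\<^bsub>coord_ring n\<^esub> p \<in> ?H" "p \<otimes>\<^bsub>coord_ring n\<^esub> a \<in> ?H"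
      by (simp_all only: coord_ring_simps mult.commute[of p a])
  qed (rule S.ring_axioms)
  moreover have "G \<subseteq> ?H"
  proof
    fix g assume g: "g \<in> G"
    then obtain e where "g \<in> forms n e" using G homogeneous_def by blast
    then show "g \<in> ?H"
      using g GC S.genideal_self[OF GC] J.zero_closed by (auto simp: component_of_form)
  qed
  ultimately have "?J \<subseteq> ?H" by (rule S.genideal_minimal)
  then show ?thesis using p by auto
qed

section \<open>Determinants and quotients of the polynomial ring\<close>

text \<open>With entries given by a function of row and column, replacing a row is the function
  update \<open>A(k := v)\<close>, the form in which multilinearity is needed.\<close>

definition fun_det :: "nat \<Rightarrow> (nat \<Rightarrow> nat \<Rightarrow> 'a::comm_ring_1) \<Rightarrow> 'a" where
  "fun_det N A = det (mat N N (\<lambda>(i, j). A i j))"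

lemma fun_det_leibniz:
  "fun_det N A = (\<Sum>p | p permutes {0..<N}. signof p * (\<Prod>i = 0..<N. A i (p i)))"
  unfolding fun_det_def
  by (subst det_def'[of _ N], simp) (intro sum.cong prod.cong arg_cong2[where f = "(*)"] refl, auto simp: permutes_in_image)

text \<open>Every term of the Leibniz formula has exactly one factor from row \<open>k\<close>;
  splitting it off makes linearity in that row visible.\<close>

lemma fun_det_row_expand:
  assumes "k < N"
  shows "fun_det N (A(k := v)) = (\<Sum>p | p permutes {0..<N}. v (p k) * (signof p * (\<Prod>i\<in>{0..<N} - {k}. A i (p i))))"
proof -
  have "(\<Prod>i = 0..<N. (A(k := v)) i (p i)) = v (p k) * (\<Prod>i\<in>{0..<N} - {k}. A i (p i))" for p
    using assms by (subst prod.remove[of _ k]) (auto intro!: prod.cong)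
  then show ?thesis by (simp add: fun_det_leibniz mult.left_commute)
qed

lemma fun_det_row_add:
  "k < N \<Longrightarrow> fun_det N (A(k := (\<lambda>j. u j + v j))) = fun_det N (A(k := u)) + fun_det N (A(k := v))"
  by (simp add: fun_det_row_expand distrib_right sum.distrib)

lemma fun_det_row_smult:
  "k < N \<Longrightarrow> fun_det N (A(k := (\<lambda>j. c * v j))) = c * fun_det N (A(k := v))"
  by (simp add: fun_det_row_expand sum_distrib_left mult.assoc)

lemma fun_det_identical_rows:
  "i \<noteq> j \<Longrightarrow> i < N \<Longrightarrow> j < N \<Longrightarrow> A i = A j \<Longrightarrow> fun_det N A = 0"
  unfolding fun_det_def by (rule det_identical_rows[of _ N i j]) auto

lemma fun_det_one: "fun_det N (\<lambda>i j. if i = j then 1 else 0) = 1"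
proof -
  have "mat N N (\<lambda>(i, j). if i = j then 1 else (0::'a)) = 1\<^sub>m N"
    by (rule eq_matI) auto
  then show ?thesis unfolding fun_det_def by simp
qed

lemma const_poly_of_int: "const_poly (of_int c) = of_int c"
  by (simp add: const_poly_def)

lemma fun_det_closed:
  assumes "\<And>i j. i < N \<Longrightarrow> j < N \<Longrightarrow> A i j \<in> carrier (coord_ring n)"
  shows "fun_det N A \<in> carrier (coord_ring n)"
  \<comment> \<open>The signs are rewritten as constant polynomials, which are known to lie in the
    coordinate ring.\<close>
  unfolding fun_det_leibniz const_poly_of_int[symmetric] using assms
  by (intro coord_ring_sum_closed coord_ring_closed(6,7) coord_ring_prod_closed)
    (auto dest: permutes_in_image)

text \<open>Each Leibniz term takes one entry from every row, so degrees depending only on the row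
  add up to the same total for all permutations.\<close>

lemma fun_det_forms:
  assumes "\<And>i j. i < N \<Longrightarrow> j < N \<Longrightarrow> A i j \<in> forms n (e i)"
  shows "fun_det N A \<in> forms n (\<Sum>i = 0..<N. e i)"
proof -
  have "signof p * (\<Prod>i = 0..<N. A i (p i)) \<in> forms n (0 + (\<Sum>i = 0..<N. e i))"
    if "p permutes {0..<N}" for p
    unfolding const_poly_of_int[symmetric] using assms permutes_in_image[OF that]
    by (intro forms_closed(7,3) forms_prod) auto
  then show ?thesis unfolding fun_det_leibniz by (intro forms_sum) auto
qed

section \<open>Ideals and cosets of the polynomial ring\<close>

context
  fixes n :: nat and J :: "'k::comm_ring_1 mpoly set"
  assumes J: "ideal J (coord_ring n)"
begin

interpretation J: ideal J "coord_ring n" by (rule J)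

lemma coord_ideal_closed:
  "0 \<in> J"
  "p \<in> J \<Longrightarrow> q \<in> J \<Longrightarrow> p + q \<in> J"
  "p \<in> J \<Longrightarrow> - p \<in> J"
  "p \<in> J \<Longrightarrow> q \<in> J \<Longrightarrow> p - q \<in> J"
  "a \<in> carrier (coord_ring n) \<Longrightarrow> p \<in> J \<Longrightarrow> a * p \<in> J"
  "a \<in> carrier (coord_ring n) \<Longrightarrow> p \<in> J \<Longrightarrow> p * a \<in> J"
  "p \<in> J \<Longrightarrow> p \<in> carrier (coord_ring n)"
proof -
  show neg: "- p \<in> J" if "p \<in> J" for p
    using additive_subgroup.a_inv_closed[OF J.is_additive_subgroup that] J.a_Hcarr[OF that] by simp
  show add: "p + q \<in> J" if "p \<in> J" "q \<in> J" for p q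
    using additive_subgroup.a_closed[OF J.is_additive_subgroup that] by simp
  show "p - q \<in> J" if "p \<in> J" "q \<in> J"
    using add[OF that(1) neg[OF that(2)]] by simp
qed (use additive_subgroup.zero_closed[OF J.is_additive_subgroup] J.I_l_closed J.I_r_closed J.a_Hcarr in auto)

lemma coord_ideal_sum: "(\<And>i. i \<in> A \<Longrightarrow> f i \<in> J) \<Longrightarrow> sum f A \<in> J"
  by (induction A rule: infinite_finite_induct) (auto intro: coord_ideal_closed)

lemma coord_ideal_prod_diff:
  assumes "finite A" "\<And>i. i \<in> A \<Longrightarrow> f i \<in> carrier (coord_ring n)"
    "\<And>i. i \<in> A \<Longrightarrow> g i \<in> carrier (coord_ring n)" "\<And>i. i \<in> A \<Longrightarrow> f i - g i \<in> J"
  shows "prod f A - prod g A \<in> J"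
  using assms
proof (induction A)
  case empty
  then show ?case using coord_ideal_closed(1) by simp
next
  case (insert x A)
  \<comment> \<open>This telescopes: the mixed product of \<open>f x\<close> and
    \<open>prod g A\<close> cancels, and what remains is the difference of the two full
    products.\<close>
  have "f x * (prod f A - prod g A) + (f x - g x) * prod g A \<in> J"
    using insert by (intro coord_ideal_closed(2,5,6) coord_ring_prod_closed) auto
  then show ?case using insert by (simp add: algebra_simps)
qed

text \<open>The determinant of a matrix over S/J is well defined although it is computed with
  representatives in S.\<close>

lemma fun_det_diff:
  assumes A: "\<And>i j. i < N \<Longrightarrow> j < N \<Longrightarrow> A i j \<in> carrier (coord_ring n)"
    and B: "\<And>i j. i < N \<Longrightarrow> j < N \<Longrightarrow> B i j \<in> carrier (coord_ring n)"
    and diff: "\<And>i j. i < N \<Longrightarrow> j < N \<Longrightarrow> A i j - B i j \<in> J"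
  shows "fun_det N A - fun_det N B \<in> J"
proof -
  have "const_poly (of_int (sign p)) * ((\<Prod>i = 0..<N. A i (p i)) - (\<Prod>i = 0..<N. B i (p i))) \<in> J"
    if "p permutes {0..<N}" for p
    using assms permutes_in_image[OF that]
    by (intro coord_ideal_closed(5) coord_ring_closed(7) coord_ideal_prod_diff) auto
  then have "(\<Sum>p | p permutes {0..<N}. const_poly (of_int (sign p)) *
      ((\<Prod>i = 0..<N. A i (p i)) - (\<Prod>i = 0..<N. B i (p i)))) \<in> J"
    by (intro coord_ideal_sum) auto
  then show ?thesis
    by (simp add: fun_det_leibniz const_poly_of_int right_diff_distrib sum_subtractf)
qed

lemma coord_coset_eq_iff:
  assumes "p \<in> carrier (coord_ring n)" "q \<in> carrier (coord_ring n)"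
  shows "J +>\<^bsub>coord_ring n\<^esub> p = J +>\<^bsub>coord_ring n\<^esub> q \<longleftrightarrow> p - q \<in> J"
proof -
  have "p \<in> J +>\<^bsub>coord_ring n\<^esub> q \<longleftrightarrow> p - q \<in> J"
    using J.a_rcos_module[OF assms(2,1)] assms by simp
  then show ?thesis
    using J.a_rcos_self[OF assms(1)] J.a_repr_independence'[OF _ assms(2)] by auto
qed

lemma coord_coset_self: "p \<in> carrier (coord_ring n) \<Longrightarrow> p \<in> J +>\<^bsub>coord_ring n\<^esub> p"
  by (rule J.a_rcos_self)

lemma coord_coset_zero: "J +>\<^bsub>coord_ring n\<^esub> 0 = J"
  using J.a_coset_add_zero[OF J.a_subset] by simp

lemma coord_coset_closed:
  "p \<in> carrier (coord_ring n) \<Longrightarrow> J +>\<^bsub>coord_ring n\<^esub> p \<in> a_rcosets\<^bsub>coord_ring n\<^esub> J"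
  by (intro J.a_rcosetsI J.a_subset)

lemma coord_coset_cases:
  assumes "A \<in> a_rcosets\<^bsub>coord_ring n\<^esub> J"
  obtains p where "p \<in> carrier (coord_ring n)" "A = J +>\<^bsub>coord_ring n\<^esub> p"
  using assms by (auto simp: A_RCOSETS_def' a_r_coset_def')

lemma coord_coset_add:
  "p \<in> carrier (coord_ring n) \<Longrightarrow> q \<in> carrier (coord_ring n) \<Longrightarrow>
    (J +>\<^bsub>coord_ring n\<^esub> p) <+>\<^bsub>coord_ring n\<^esub> (J +>\<^bsub>coord_ring n\<^esub> q) = J +>\<^bsub>coord_ring n\<^esub> (p + q)"
  using J.a_rcos_sum[of p q] by simp

lemma coord_coset_memberD:
  assumes "p \<in> J +>\<^bsub>coord_ring n\<^esub> q" "q \<in> carrier (coord_ring n)"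
  shows "p \<in> carrier (coord_ring n)" "p - q \<in> J"
proof -
  show "p \<in> carrier (coord_ring n)" using assms J.a_elemrcos_carrier by blast
  then show "p - q \<in> J"
    using J.a_rcos_module[of q p] assms by simp
qed

end

lemma quot_as_module_simps [simp]:
  "carrier (quot_as_module n J) = a_rcosets\<^bsub>coord_ring n\<^esub> J"
  "zero (quot_as_module n J) = J"
  "add (quot_as_module n J) = set_add (coord_ring n)"
  by (simp_all add: quot_as_module_def FactRing_def)

lemma RX_simps [simp]:
  "carrier (RX n I) = a_rcosets\<^bsub>coord_ring n\<^esub> I"
  "zero (RX n I) = I"
  "one (RX n I) = I +>\<^bsub>coord_ring n\<^esub> 1"
  "add (RX n I) = set_add (coord_ring n)"
  by (simp_all add: RX_def FactRing_def)

section \<open>S/J as a graded module over S/I\<close>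

locale ideal_pair =
  fixes n :: nat and I J :: "'k::comm_ring_1 mpoly set"
  assumes I: "ideal I (coord_ring n)" and J: "ideal J (coord_ring n)" and IJ: "I \<subseteq> J"
begin

abbreviation "S \<equiv> coord_ring n"
abbreviation "R \<equiv> RX n I"
abbreviation "N \<equiv> quot_as_module n J"
abbreviation "clI p \<equiv> I +>\<^bsub>S\<^esub> p"
abbreviation "clJ p \<equiv> J +>\<^bsub>S\<^esub> p"

lemma R_cring: "cring R"
  unfolding RX_def by (rule ideal.quotient_is_cring[OF I coord_ring_cring])

lemma R_mult: "p \<in> carrier S \<Longrightarrow> q \<in> carrier S \<Longrightarrow> clI p \<otimes>\<^bsub>R\<^esub> clI q = clI (p * q)"
  using ideal.rcoset_mult_add[OF I, of p q] by (simp add: RX_def FactRing_def)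

lemma N_smult:
  assumes "p \<in> carrier S" "q \<in> carrier S"
  shows "clI p \<odot>\<^bsub>N\<^esub> clJ q = clJ (p * q)"
proof -
  have eq: "clJ (a * b) = clJ (p * q)" if a: "a \<in> clI p" and b: "b \<in> clJ q" for a b
  proof -
    note a = coord_coset_memberD[OF I a assms(1)] and b = coord_coset_memberD[OF J b assms(2)]
    \<comment> \<open>This is \<open>a * b - p * q\<close>. The second summand lies in
      \<open>J\<close> because \<open>a - p\<close> is in \<open>I\<close> and \<open>I\<close> is
      contained in \<open>J\<close>.\<close>
    have "a * (b - q) + (a - p) * q \<in> J"
      using a b assms IJ by (intro coord_ideal_closed(2,5,6)[OF J]) auto
    then have "a * b - p * q \<in> J" by (simp add: algebra_simps)
    then show ?thesis using a b assms by (simp add: coord_coset_eq_iff[OF J])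
  qed
  have "p \<in> clI p" "q \<in> clJ q"
    using assms coord_coset_self[OF I] coord_coset_self[OF J] by auto
  then have "(\<Union>a\<in>clI p. \<Union>b\<in>clJ q. clJ (a * b)) = clJ (p * q)"
    using eq by blast
  then show ?thesis by (simp add: quot_as_module_def rcoset_mult_def)
qed

lemma N_module: "module R N"
proof (rule moduleI)
  show "cring R" by (rule R_cring)
  interpret Q: ring "S Quot J" by (rule ideal.quotient_is_ring[OF J])
  have neg: "\<exists>y\<in>carrier (S Quot J). y \<oplus>\<^bsub>S Quot J\<^esub> x = \<zero>\<^bsub>S Quot J\<^esub>" if "x \<in> carrier (S Quot J)" for x
    using that Q.l_neg by blast
  note Q = Q.a_closed Q.a_assoc Q.a_comm Q.zero_closed Q.l_zero neg
  show "abelian_group N"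
    by (rule abelian_groupI) (use Q in \<open>auto simp: FactRing_def\<close>)
qed (auto elim!: coord_coset_cases[OF I] coord_coset_cases[OF J]
  simp: N_smult R_mult coord_coset_add[OF I] coord_coset_add[OF J] coord_coset_closed[OF J] algebra_simps)

sublocale R: cring R by (rule R_cring)
sublocale N: module R N by (rule N_module)

lemma clJ_closed [simp]: "p \<in> carrier S \<Longrightarrow> clJ p \<in> a_rcosets\<^bsub>S\<^esub> J"
  by (rule coord_coset_closed[OF J])

lemma clI_closed [simp]: "p \<in> carrier S \<Longrightarrow> clI p \<in> a_rcosets\<^bsub>S\<^esub> I"
  by (rule coord_coset_closed[OF I])

lemma N_minus: "p \<in> carrier S \<Longrightarrow> \<ominus>\<^bsub>N\<^esub> clJ p = clJ (- p)"
  by (rule N.M.minus_equality) (simp_all add: coord_coset_add[OF J] coord_coset_zero[OF J])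

lemma N_finsum:
  "finite D \<Longrightarrow> (\<And>d. d \<in> D \<Longrightarrow> q d \<in> carrier S) \<Longrightarrow> finsum N (\<lambda>d. clJ (q d)) D = clJ (sum q D)"
proof (induction D rule: finite_induct)
  case (insert d D)
  then have "(\<lambda>d. clJ (q d)) \<in> D \<rightarrow> carrier N" "clJ (q d) \<in> carrier N" by auto
  then show ?case
    using insert by (simp add: coord_coset_add[OF J])
qed (simp add: coord_coset_zero[OF J])

lemma quot_grading_additive_subgroup: "additive_subgroup (quot_grading n J e) N"
proof (intro additive_subgroupI)
  show "subgroup (quot_grading n J e) (add_monoid N)"
  proof
    show "quot_grading n J e \<subseteq> carrier (add_monoid N)"
      by (auto simp: quot_grading_def forms_subset)
    show "x \<otimes>\<^bsub>add_monoid N\<^esub> y \<in> quot_grading n J e" if "x \<in> quot_grading n J e" "y \<in> quot_grading n J e" for x y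
      using that unfolding quot_grading_def
      by (auto simp: coord_coset_add[OF J] forms_subset intro!: forms_closed)
    show "\<one>\<^bsub>add_monoid N\<^esub> \<in> quot_grading n J e"
      using coord_coset_zero[OF J] forms_closed(1)[of n e] by (auto simp: quot_grading_def)
    show "inv\<^bsub>add_monoid N\<^esub> x \<in> quot_grading n J e" if x: "x \<in> quot_grading n J e" for x
    proof -
      obtain p where p: "p \<in> forms n e" "x = clJ p" using x by (auto simp: quot_grading_def)
      then have "inv\<^bsub>add_monoid N\<^esub> x = clJ (- p)"
        using N_minus[OF forms_subset[OF p(1)]] by (simp add: a_inv_def)
      then show ?thesis using forms_closed(5)[OF p(1)] by (auto simp: quot_grading_def)
    qed
  qed
qed

text \<open>Existence of a decomposition comes from the components of any representative. Uniqueness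
  is where \<open>hom\<close> enters: a polynomial in \<open>J\<close> has all its components in
  \<open>J\<close>.\<close>

lemma quot_graded_module:
  assumes hom: "\<And>p d. p \<in> J \<Longrightarrow> component n d p \<in> J"
  shows "graded_module R (quot_grading n I) N (shift a (quot_grading n J))"
  unfolding graded_module_def
proof (intro conjI allI ballI)
  show "module R N" by (rule N_module)
  show "additive_subgroup (shift a (quot_grading n J) d) N" for d
    unfolding shift_def by (rule quot_grading_additive_subgroup)
  show "r \<odot>\<^bsub>N\<^esub> x \<in> shift a (quot_grading n J) (i + j)"
    if rx: "r \<in> quot_grading n I i" "x \<in> shift a (quot_grading n J) j" for r x i j
  proof -
    obtain p q where p: "p \<in> forms n i" "r = clI p" and q: "q \<in> forms n (a + j)" "x = clJ q"
      using rx by (auto simp: quot_grading_def shift_def)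
    have "r \<odot>\<^bsub>N\<^esub> x = clJ (p * q)" using p q by (simp add: N_smult forms_subset)
    moreover have "p * q \<in> forms n (a + (i + j))"
      using forms_closed(7)[OF p(1) q(1)] by (simp add: algebra_simps)
    ultimately show ?thesis by (auto simp: quot_grading_def shift_def)
  qed
  fix x assume "x \<in> carrier N"
  then obtain p where p: "p \<in> carrier S" "x = clJ p"
    by (auto elim: coord_coset_cases[OF J])
  define b where "b d = clJ (component n (a + d) p)" for d
  have comp: "component n d p \<in> carrier S" for d
    using component_forms[OF p(1)] by (rule forms_subset)
  show "\<exists>!c. (\<forall>d. c d \<in> shift a (quot_grading n J) d) \<and> finite {d. c d \<noteq> \<zero>\<^bsub>N\<^esub>} \<and>
      x = finsum N c {d. c d \<noteq> \<zero>\<^bsub>N\<^esub>}"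
  proof (rule ex1I[of _ b])
    \<comment> \<open>Component \<open>d\<close> of the shifted module has degree
      \<open>a + d\<close> in S/J, so these are the \<open>d\<close> for which \<open>a + d\<close>
      is the degree of a monomial of \<open>p\<close>.\<close>
    let ?D = "(\<lambda>m. int (monom_degree n m) - a) ` keys p"
    \<comment> \<open>Equality may fail, since a nonzero component of \<open>p\<close> can lie in
      \<open>J\<close>; the sum is padded with zeros.\<close>
    have supp: "{d. b d \<noteq> \<zero>\<^bsub>N\<^esub>} \<subseteq> ?D"
    proof (rule ccontr)
      assume "\<not> ?thesis"
      then obtain d where d: "b d \<noteq> \<zero>\<^bsub>N\<^esub>" "d \<notin> ?D" by blast
      then have "\<forall>m\<in>keys p. int (monom_degree n m) \<noteq> a + d" by force
      then have "component n (a + d) p = 0" by (simp add: component_def)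
      then show False using d(1) by (simp add: b_def coord_coset_zero[OF J])
    qed
    have "finsum N b {d. b d \<noteq> \<zero>\<^bsub>N\<^esub>} = finsum N b ?D"
      by (rule N.M.add.finprod_mono_neutral_cong_left[OF _ supp]) (use comp in \<open>auto simp: b_def\<close>)
    also have "\<dots> = clJ (\<Sum>d\<in>?D. component n (a + d) p)"
      unfolding b_def using comp by (intro N_finsum) auto
    also have "(\<Sum>d\<in>?D. component n (a + d) p) = (\<Sum>d\<in>(\<lambda>d. a + d) ` ?D. component n d p)"
      by (subst sum.reindex) (auto simp: inj_on_def)
    also have "\<dots> = p" by (rule sum_components) (auto simp: image_image)
    finally have sum: "x = finsum N b {d. b d \<noteq> \<zero>\<^bsub>N\<^esub>}" using p(2) by simp
    have "b d \<in> shift a (quot_grading n J) d" for d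
      using component_forms[OF p(1)] by (auto simp: b_def shift_def quot_grading_def)
    then show "(\<forall>d. b d \<in> shift a (quot_grading n J) d) \<and> finite {d. b d \<noteq> \<zero>\<^bsub>N\<^esub>} \<and>
        x = finsum N b {d. b d \<noteq> \<zero>\<^bsub>N\<^esub>}"
      using sum finite_subset[OF supp] by simp
  next
    fix c assume c: "(\<forall>d. c d \<in> shift a (quot_grading n J) d) \<and> finite {d. c d \<noteq> \<zero>\<^bsub>N\<^esub>} \<and>
        x = finsum N c {d. c d \<noteq> \<zero>\<^bsub>N\<^esub>}"
    let ?D = "{d. c d \<noteq> \<zero>\<^bsub>N\<^esub>}"
    have "\<forall>d. \<exists>q. q \<in> forms n (a + d) \<and> c d = clJ q"
      using c by (auto simp: shift_def quot_grading_def)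
    then obtain q where q: "\<And>d. q d \<in> forms n (a + d)" "\<And>d. c d = clJ (q d)" by metis
    note qS = forms_subset[OF q(1)]
    have fin: "finite ?D" using c by simp
    have "c = (\<lambda>d. clJ (q d))" using q(2) by (rule ext)
    then have "finsum N c ?D = finsum N (\<lambda>d. clJ (q d)) ?D" by (rule arg_cong)
    then have "clJ p = finsum N (\<lambda>d. clJ (q d)) ?D" using c p(2) by simp
    also have "\<dots> = clJ (\<Sum>d\<in>?D. q d)" using qS by (intro N_finsum[OF fin])
    finally have diff: "p - (\<Sum>d\<in>?D. q d) \<in> J"
      using p(1) qS by (simp add: coord_coset_eq_iff[OF J])
    show "c = b"
    proof
      fix d
      \<comment> \<open>The forms \<open>q e\<close> have distinct degrees \<open>a + e\<close>, so
        at most one of them contributes in degree \<open>a + d\<close>.\<close>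
      have "component n (a + d) (\<Sum>d\<in>?D. q d) = (\<Sum>e\<in>?D. if d = e then q e else 0)"
        unfolding component_sum by (intro sum.cong) (simp_all add: component_of_form[OF q(1)])
      also have "\<dots> = (if d \<in> ?D then q d else 0)" using fin by (simp add: sum.delta)
      \<comment> \<open>Outside \<open>?D\<close> the form \<open>q d\<close> lies in
        \<open>J\<close> but need not be zero; \<open>0\<close> represents the same class.\<close>
      finally have "component n (a + d) p - (if d \<in> ?D then q d else 0) \<in> J"
        using hom[OF diff, of "a + d"] component_add[of n "a + d" p "- (\<Sum>d\<in>?D. q d)"]
        by (simp add: component_uminus)
      then have "b d = clJ (if d \<in> ?D then q d else 0)"
        using comp qS by (simp add: b_def coord_coset_eq_iff[OF J])
      then show "c d = b d" using q(2)[of d] by (auto simp: coord_coset_zero[OF J] split: if_splits)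
    qed
  qed
qed

end

section \<open>Generators in the ideal of their derivatives\<close>

lemma form_zero_eq_const:
  assumes "p \<in> forms n 0"
  shows "p = const_poly (lookup p 0)"
proof (rule poly_mapping_eqI)
  fix m
  show "lookup p m = lookup (const_poly (lookup p 0)) m"
  proof (cases "m \<in> keys p")
    case True
    then have "keys m \<subseteq> {..n}" "monom_degree n m = 0"
      using assms by (auto simp: forms_iff coord_ring_carrier)
    then have "keys m \<subseteq> {..n}" "\<forall>i\<le>n. lookup m i = 0"
      by (auto simp: monom_degree_def)
    then have "lookup m i = 0" for i by (cases "i \<le> n") (auto simp: in_keys_iff subset_iff)
    then have "m = 0" by (intro poly_mapping_eqI) simp
    then show ?thesis by (simp add: const_poly_def)
  qed (auto simp: const_poly_def lookup_single when_def in_keys_iff)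
qed

text \<open>
  In degree \<open>d \<noteq> 0\<close> this is Euler's identity divided by \<open>d\<close>; a form of degree \<open>0\<close> in a proper
  ideal vanishes.
\<close>

lemma form_mem_jacobian:
  fixes G :: "'k::field_char_0 mpoly set"
  assumes G: "\<And>g. g \<in> G \<Longrightarrow> homogeneous n g"
    and proper: "genideal (coord_ring n) G \<noteq> carrier (coord_ring n)" and g: "g \<in> G"
  shows "g \<in> genideal (coord_ring n) {partial i g | i g. i \<le> n \<and> g \<in> G}"
proof -
  interpret S: cring "coord_ring n" by (rule coord_ring_cring)
  have GC: "G \<subseteq> carrier (coord_ring n)"
    using G forms_subset by (auto simp: homogeneous_def)
  have dG: "{partial i g | i g. i \<le> n \<and> g \<in> G} \<subseteq> carrier (coord_ring n)" using GC by auto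
  let ?I = "genideal (coord_ring n) G"
  let ?J = "genideal (coord_ring n) {partial i g | i g. i \<le> n \<and> g \<in> G}"
  note I = S.genideal_ideal[OF GC] and J = S.genideal_ideal[OF dG]
  obtain d where d: "g \<in> forms n d" using G[OF g] by (auto simp: homogeneous_def)
  have const: "const_poly a * const_poly b = const_poly (a * b)" for a b :: 'k
    by (simp add: const_poly_def mult_single)
  have one: "const_poly 1 = (1 :: 'k mpoly)" by (simp add: const_poly_def)
  show ?thesis
  proof (cases "d = 0")
    case True
    define c where "c = lookup g 0"
    have gc: "g = const_poly c" using form_zero_eq_const d True by (auto simp: c_def)
    have "c = 0"
    proof (rule ccontr)
      assume "c \<noteq> 0"
      then have "const_poly (inverse c) * g = 1" by (simp add: gc const one)
      moreover have "const_poly (inverse c) * g \<in> ?I"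
        using S.genideal_self[OF GC] g by (intro coord_ideal_closed(5)[OF I]) auto
      ultimately show False using proper ideal.one_imp_carrier[OF I] by simp
    qed
    then show ?thesis using coord_ideal_closed(1)[OF J] by (simp add: gc const_poly_def)
  next
    case False
    have "g = const_poly (inverse (of_int d)) * (\<Sum>i\<le>n. var_poly i * partial i g)"
      using False by (simp add: euler_identity[OF d] const one flip: mult.assoc)
    also have "\<dots> \<in> ?J"
      using S.genideal_self[OF dG] g
      by (intro coord_ideal_closed(5)[OF J] coord_ideal_sum[OF J]) auto
    finally show ?thesis .
  qed
qed

section \<open>Top differentials\<close>

text \<open>Generators form a set of forms, without indexing. Together with \<open>proper\<close>,
  this is what \<open>form_mem_jacobian\<close> needs to place them in the ideal of their
  derivatives.\<close>

locale jacobian =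
  fixes n :: nat and G :: "'k::field_char_0 mpoly set"
  assumes G: "\<And>g. g \<in> G \<Longrightarrow> homogeneous n g"
    and proper: "genideal (coord_ring n) G \<noteq> carrier (coord_ring n)"
begin

abbreviation "dG \<equiv> {partial i g | i g. i \<le> n \<and> g \<in> G}"

definition "I = genideal (coord_ring n) G"
definition "J = genideal (coord_ring n) dG"

interpretation S: cring "coord_ring n" by (rule coord_ring_cring)

lemma G_closed: "G \<subseteq> carrier (coord_ring n)"
  using G forms_subset by (auto simp: homogeneous_def)

lemma dG_closed: "dG \<subseteq> carrier (coord_ring n)"
  using G_closed by auto

lemma G_subset_I: "G \<subseteq> I"
  unfolding I_def by (rule S.genideal_self[OF G_closed])

lemma dG_subset_J: "dG \<subseteq> J"
  unfolding J_def by (rule S.genideal_self[OF dG_closed])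

lemma I_ideal: "ideal I (coord_ring n)"
  unfolding I_def by (rule S.genideal_ideal[OF G_closed])

lemma J_ideal: "ideal J (coord_ring n)"
  unfolding J_def by (rule S.genideal_ideal[OF dG_closed])

lemma G_subset_J: "G \<subseteq> J"
  unfolding J_def using form_mem_jacobian[OF G proper] by blast

lemma I_subset_J: "I \<subseteq> J"
  unfolding I_def by (rule S.genideal_minimal[OF J_ideal G_subset_J])

sublocale ideal_pair n I J
  by (rule ideal_pair.intro[OF I_ideal J_ideal I_subset_J])

lemma partial_I:
  assumes i: "i \<le> n" and p: "p \<in> I"
  shows "partial i p \<in> J"
proof -
  note Jc = coord_ideal_closed[OF J]
  \<comment> \<open>Membership in \<open>J\<close> is built in because the product rule for
    \<open>a * p\<close> leaves the term \<open>p * partial i a\<close>.\<close>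
  let ?H = "{p \<in> J. partial i p \<in> J}"
  have "ideal ?H S"
  proof (rule idealI)
    show "subgroup ?H (add_monoid S)"
    proof
      fix p assume p: "p \<in> ?H"
      then have "inv\<^bsub>add_monoid S\<^esub> p = - p"
        using coord_ring_a_inv[of p n] Jc(7) by (simp add: a_inv_def)
      then show "inv\<^bsub>add_monoid S\<^esub> p \<in> ?H"
        using p Jc(3) by (simp add: partial_uminus)
    qed (use Jc in \<open>auto simp: partial_add\<close>)
    fix a p :: "'k mpoly" assume p: "p \<in> ?H" and a: "a \<in> carrier S"
    have "a * p \<in> ?H"
      using p a Jc(5)[OF a] Jc(6)[of "partial i a" p] Jc(2) by (simp add: partial_mult mult.commute[of p])
    then show "a \<otimes>\<^bsub>S\<^esub> p \<in> ?H" "p \<otimes>\<^bsub>S\<^esub> a \<in> ?H"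
      by (simp_all only: coord_ring_simps mult.commute[of p a])
  qed (rule S.ring_axioms)
  moreover have "G \<subseteq> ?H" using G_subset_J dG_subset_J i by blast
  ultimately have "I \<subseteq> ?H" unfolding I_def by (rule S.genideal_minimal)
  then show ?thesis using p by blast
qed

lemma component_J: "p \<in> J \<Longrightarrow> component n d p \<in> J"
proof -
  have "homogeneous n g" if "g \<in> dG" for g
    using that G partial_forms by (fastforce simp: homogeneous_def)
  then show "p \<in> J \<Longrightarrow> component n d p \<in> J"
    unfolding J_def by (intro homogeneous_generators_component)
qed

lemma consts_closed: "RX_consts n I \<subseteq> carrier R"
  by (auto simp: RX_consts_def)

sublocale K: kaehler_module R "RX_consts n I"
  by (intro kaehler_module.intro kaehler_module_axioms.intro R_cring consts_closed)

sublocale E: ext_module R "kaehler R (RX_consts n I)" "Suc n"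
  by (intro ext_module.intro K.\<Omega>_module)

abbreviation "dx i \<equiv> K.d (clI (var_poly i))"

definition "\<omega> = E.w (map dx [0..<Suc n])"

lemma R_add: "p \<in> carrier S \<Longrightarrow> q \<in> carrier S \<Longrightarrow> clI p \<oplus>\<^bsub>R\<^esub> clI q = clI (p + q)"
  by (simp add: coord_coset_add[OF I])

lemma clI_R [simp]: "p \<in> carrier S \<Longrightarrow> clI p \<in> carrier R"
  by simp

lemma dx_closed [simp]: "i \<le> n \<Longrightarrow> dx i \<in> carrier K.\<Omega>"
  by (intro K.d_closed) simp

text \<open>The chain rule: both sides vanish on constants, agree on the variables, are additive and
  obey the Leibniz rule.\<close>

lemma d_clI:
  assumes "p \<in> carrier S"
  shows "K.d (clI p) = (\<Oplus>\<^bsub>K.\<Omega>\<^esub>i\<in>{..n}. clI (partial i p) \<odot>\<^bsub>K.\<Omega>\<^esub> dx i)"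
  using assms
proof (induction p rule: coord_ring_induct)
  case (const c)
  have "clI (partial i (const_poly c)) = \<zero>\<^bsub>R\<^esub>" for i
    by (simp add: coord_coset_zero[OF I])
  then have "(\<Oplus>\<^bsub>K.\<Omega>\<^esub>i\<in>{..n}. clI (partial i (const_poly c)) \<odot>\<^bsub>K.\<Omega>\<^esub> dx i) = \<zero>\<^bsub>K.\<Omega>\<^esub>"
    by (intro K.\<Omega>.M.add.finprod_one_eqI) (auto simp del: RX_simps)
  then show ?case
    using K.d_const[of "clI (const_poly c)"] by (auto simp: RX_consts_def)
next
  case (var j)
  have "(\<Oplus>\<^bsub>K.\<Omega>\<^esub>i\<in>{..n}. clI (partial i (var_poly j)) \<odot>\<^bsub>K.\<Omega>\<^esub> dx i) =
      (\<Oplus>\<^bsub>K.\<Omega>\<^esub>i\<in>{..n}. if j = i then dx i else \<zero>\<^bsub>K.\<Omega>\<^esub>)"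
  proof (rule K.\<Omega>.M.finsum_cong'[OF refl])
    fix i assume "i \<in> {..n}"
    then have "dx i \<in> carrier K.\<Omega>" by simp
    then show "clI (partial i (var_poly j)) \<odot>\<^bsub>K.\<Omega>\<^esub> dx i = (if j = i then dx i else \<zero>\<^bsub>K.\<Omega>\<^esub>)"
      using K.\<Omega>.smult_one[of "dx i"] K.\<Omega>.smult_l_null[of "dx i"]
      by (simp add: partial_var coord_coset_zero[OF I])
  qed auto
  also have "\<dots> = dx j"
    using var by (intro K.\<Omega>.M.finsum_singleton) auto
  finally show ?case by simp
next
  case (add p q)
  have closed: "clI (partial i p) \<odot>\<^bsub>K.\<Omega>\<^esub> dx i \<in> carrier K.\<Omega>"
    if "p \<in> carrier S" "i \<le> n" for p i
    using that by (intro K.\<Omega>.smult_closed dx_closed clI_R partial_closed)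
  have "(\<Oplus>\<^bsub>K.\<Omega>\<^esub>i\<in>{..n}. clI (partial i (p + q)) \<odot>\<^bsub>K.\<Omega>\<^esub> dx i) =
     (\<Oplus>\<^bsub>K.\<Omega>\<^esub>i\<in>{..n}. clI (partial i p) \<odot>\<^bsub>K.\<Omega>\<^esub> dx i \<oplus>\<^bsub>K.\<Omega>\<^esub> clI (partial i q) \<odot>\<^bsub>K.\<Omega>\<^esub> dx i)"
  proof (rule K.\<Omega>.M.finsum_cong'[OF refl])
    fix i assume "i \<in> {..n}"
    then show "clI (partial i (p + q)) \<odot>\<^bsub>K.\<Omega>\<^esub> dx i =
        clI (partial i p) \<odot>\<^bsub>K.\<Omega>\<^esub> dx i \<oplus>\<^bsub>K.\<Omega>\<^esub> clI (partial i q) \<odot>\<^bsub>K.\<Omega>\<^esub> dx i"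
      using add(1,2) K.\<Omega>.smult_l_distr[of "clI (partial i p)" "clI (partial i q)" "dx i"]
      by (simp add: partial_add coord_coset_add[OF I])
  qed (use closed add(1,2) in auto)
  also have "\<dots> = (\<Oplus>\<^bsub>K.\<Omega>\<^esub>i\<in>{..n}. clI (partial i p) \<odot>\<^bsub>K.\<Omega>\<^esub> dx i) \<oplus>\<^bsub>K.\<Omega>\<^esub>
      (\<Oplus>\<^bsub>K.\<Omega>\<^esub>i\<in>{..n}. clI (partial i q) \<odot>\<^bsub>K.\<Omega>\<^esub> dx i)"
    using closed add(1,2) by (intro K.\<Omega>.M.finsum_addf) auto
  also have "\<dots> = K.d (clI p \<oplus>\<^bsub>R\<^esub> clI q)"
    using add K.d_add[of "clI p" "clI q"] by simp
  finally show ?case using add(1,2) by (simp add: R_add del: RX_simps)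
next
  case (mult p q)
  have closed: "clI (partial i p) \<odot>\<^bsub>K.\<Omega>\<^esub> dx i \<in> carrier K.\<Omega>"
    if "p \<in> carrier S" "i \<le> n" for p i
    using that by (intro K.\<Omega>.smult_closed dx_closed clI_R partial_closed)
  have "(\<Oplus>\<^bsub>K.\<Omega>\<^esub>i\<in>{..n}. clI (partial i (p * q)) \<odot>\<^bsub>K.\<Omega>\<^esub> dx i) =
     (\<Oplus>\<^bsub>K.\<Omega>\<^esub>i\<in>{..n}. clI p \<odot>\<^bsub>K.\<Omega>\<^esub> (clI (partial i q) \<odot>\<^bsub>K.\<Omega>\<^esub> dx i) \<oplus>\<^bsub>K.\<Omega>\<^esub>
       clI q \<odot>\<^bsub>K.\<Omega>\<^esub> (clI (partial i p) \<odot>\<^bsub>K.\<Omega>\<^esub> dx i))"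
  proof (rule K.\<Omega>.M.finsum_cong'[OF refl])
    fix i assume i: "i \<in> {..n}"
    have "clI (partial i (p * q)) = clI p \<otimes>\<^bsub>R\<^esub> clI (partial i q) \<oplus>\<^bsub>R\<^esub> clI q \<otimes>\<^bsub>R\<^esub> clI (partial i p)"
      using mult(1,2) by (simp add: partial_mult R_mult R_add del: RX_simps)
    then show "clI (partial i (p * q)) \<odot>\<^bsub>K.\<Omega>\<^esub> dx i =
        clI p \<odot>\<^bsub>K.\<Omega>\<^esub> (clI (partial i q) \<odot>\<^bsub>K.\<Omega>\<^esub> dx i) \<oplus>\<^bsub>K.\<Omega>\<^esub>
        clI q \<odot>\<^bsub>K.\<Omega>\<^esub> (clI (partial i p) \<odot>\<^bsub>K.\<Omega>\<^esub> dx i)"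
      using i mult(1,2)
      by (simp add: K.\<Omega>.smult_l_distr K.\<Omega>.smult_assoc1 R.m_closed del: RX_simps)
  qed (use closed mult(1,2) in \<open>auto simp del: RX_simps\<close>)
  also have "\<dots> = (\<Oplus>\<^bsub>K.\<Omega>\<^esub>i\<in>{..n}. clI p \<odot>\<^bsub>K.\<Omega>\<^esub> (clI (partial i q) \<odot>\<^bsub>K.\<Omega>\<^esub> dx i)) \<oplus>\<^bsub>K.\<Omega>\<^esub>
      (\<Oplus>\<^bsub>K.\<Omega>\<^esub>i\<in>{..n}. clI q \<odot>\<^bsub>K.\<Omega>\<^esub> (clI (partial i p) \<odot>\<^bsub>K.\<Omega>\<^esub> dx i))"
    using closed mult(1,2) by (intro K.\<Omega>.M.finsum_addf) (auto simp del: RX_simps)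
  also have "\<dots> = clI p \<odot>\<^bsub>K.\<Omega>\<^esub> K.d (clI q) \<oplus>\<^bsub>K.\<Omega>\<^esub> clI q \<odot>\<^bsub>K.\<Omega>\<^esub> K.d (clI p)"
    unfolding mult.IH using closed mult(1,2)
    by (intro arg_cong2[where f = "add K.\<Omega>"] K.\<Omega>.finsum_smult_ldistr[symmetric]) auto
  also have "\<dots> = K.d (clI p \<otimes>\<^bsub>R\<^esub> clI q)"
    using mult(1,2) by (intro K.d_mult[symmetric]) simp_all
  finally show ?case using mult(1,2) by (simp add: R_mult)
qed

lemma dx_span:
  assumes H: "submodule H R K.\<Omega>" and dx: "\<And>i. i < Suc n \<Longrightarrow> dx i \<in> H"
  shows "carrier K.\<Omega> \<subseteq> H"
proof (rule K.\<Omega>_induct[OF H])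
  fix a assume "a \<in> carrier R"
  then obtain p where p: "p \<in> carrier S" "a = clI p" by (auto elim: coord_coset_cases[OF I])
  have "(\<Oplus>\<^bsub>K.\<Omega>\<^esub>i\<in>{..n}. clI (partial i p) \<odot>\<^bsub>K.\<Omega>\<^esub> dx i) \<in> H"
    using p dx by (intro submodule_finsum[OF K.\<Omega>_module H] funcsetI K.\<Omega>.submoduleE(4)[OF H]) auto
  then show "K.d a \<in> H" using p by (simp add: d_clI)
qed

lemma dx_list: "map dx [0..<Suc n] \<in> E.T"
  by (auto simp: tuples_def simp del: upt_Suc)

lemma \<omega>_closed [simp]: "\<omega> \<in> carrier E.ext"
  unfolding \<omega>_def by (rule E.w_closed[OF dx_list])

text \<open>The exterior degree \<open>Suc n\<close> equals the number of generators dx_0, ..., dx_n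
  of the differentials, so up to sign only one nonrepeating wedge of generators exists.\<close>

lemma ext_cases:
  assumes "x \<in> carrier E.ext"
  obtains p where "p \<in> carrier S" "x = clI p \<odot>\<^bsub>E.ext\<^esub> \<omega>"
proof -
  let ?H = "(\<lambda>a. a \<odot>\<^bsub>E.ext\<^esub> \<omega>) ` carrier R"
  have "submodule ?H R E.ext" by (rule E.ext.cyclic_submodule[OF \<omega>_closed])
  moreover have "E.w (map dx [0..<Suc n]) \<in> ?H"
    unfolding \<omega>_def[symmetric]
    by (rule image_eqI, rule E.ext.smult_one[OF \<omega>_closed, symmetric], rule R.one_closed)
  ultimately have sub: "carrier E.ext \<subseteq> ?H"
    by (intro E.ext_generated[of dx] dx_span dx_closed) auto
  from subsetD[OF sub assms] obtain a where a: "x = a \<odot>\<^bsub>E.ext\<^esub> \<omega>" "a \<in> carrier R"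
    by (rule imageE)
  from a(2) obtain p where "p \<in> carrier S" "a = clI p" by (auto elim: coord_coset_cases[OF I])
  then show thesis using a(1) by (intro that[of p]) simp_all
qed

text \<open>Annihilators of \<omega> form an ideal, so only the derivatives of the generators
  matter; for these, dg = 0 is a linear relation among the factors of \<omega>.\<close>

lemma \<omega>_annihilated:
  assumes "p \<in> J"
  shows "clI p \<odot>\<^bsub>E.ext\<^esub> \<omega> = \<zero>\<^bsub>E.ext\<^esub>"
proof -
  interpret S: cring S by (rule coord_ring_cring)
  let ?H = "{p \<in> carrier S. clI p \<odot>\<^bsub>E.ext\<^esub> \<omega> = \<zero>\<^bsub>E.ext\<^esub>}"
  have mult: "a * p \<in> ?H" if "a \<in> carrier S" "p \<in> ?H" for a p
  proof -
    have "clI (a * p) \<odot>\<^bsub>E.ext\<^esub> \<omega> = clI a \<odot>\<^bsub>E.ext\<^esub> (clI p \<odot>\<^bsub>E.ext\<^esub> \<omega>)"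
      using that E.ext.smult_assoc1[of "clI a" "clI p" \<omega>] by (simp add: R_mult)
    then show ?thesis using that by simp
  qed
  have "ideal ?H S"
  proof (rule idealI)
    show "subgroup ?H (add_monoid S)"
    proof
      fix p assume p: "p \<in> ?H"
      then have "inv\<^bsub>add_monoid S\<^esub> p = - p"
        using coord_ring_a_inv[of p n] by (simp add: a_inv_def)
      moreover have "(- 1) * p \<in> ?H" using p by (intro mult) auto
      ultimately show "inv\<^bsub>add_monoid S\<^esub> p \<in> ?H" by simp
    next
      fix p q assume "p \<in> ?H" "q \<in> ?H"
      then show "p \<otimes>\<^bsub>add_monoid S\<^esub> q \<in> ?H"
        using E.ext.smult_l_distr[of "clI p" "clI q" \<omega>] by (simp add: coord_coset_add[OF I])
    next
      show "\<one>\<^bsub>add_monoid S\<^esub> \<in> ?H"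
        using E.ext.smult_l_null[OF \<omega>_closed] by (simp add: coord_coset_zero[OF I])
    qed auto
    fix a p :: "'k mpoly" assume "p \<in> ?H" "a \<in> carrier S"
    then have "a * p \<in> ?H" by (rule mult[rotated])
    then show "a \<otimes>\<^bsub>S\<^esub> p \<in> ?H" "p \<otimes>\<^bsub>S\<^esub> a \<in> ?H"
      by (simp_all only: coord_ring_simps mult.commute[of p a])
  qed (rule S.ring_axioms)
  moreover have "dG \<subseteq> ?H"
  proof
    fix p assume "p \<in> dG"
    then obtain i g where ig: "i \<le> n" "g \<in> G" "p = partial i g" by blast
    have g: "g \<in> carrier S" using ig G_closed by blast
    have nth: "map dx [0..<Suc n] ! l = dx l" if "l < Suc n" for l
      using that by (simp del: upt_Suc)
    \<comment> \<open>The class of \<open>g\<close> is zero, hence the image of the constant 0, and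
      \<open>K.d\<close> kills constants.\<close>
    have "clI g = clI (const_poly 0)"
      using G_subset_I ig(2) g by (subst coord_coset_eq_iff[OF I]) (auto simp: const_poly_def)
    then have "clI g \<in> RX_consts n I" by (auto simp: RX_consts_def)
    then have "\<zero>\<^bsub>K.\<Omega>\<^esub> = (\<Oplus>\<^bsub>K.\<Omega>\<^esub>l\<in>{..n}. clI (partial l g) \<odot>\<^bsub>K.\<Omega>\<^esub> dx l)"
      using K.d_const d_clI[OF g] by simp
    also have "\<dots> = (\<Oplus>\<^bsub>K.\<Omega>\<^esub>l\<in>{..<Suc n}. clI (partial l g) \<odot>\<^bsub>K.\<Omega>\<^esub> (map dx [0..<Suc n] ! l))"
      using g nth by (intro K.\<Omega>.M.finsum_cong') (auto simp: lessThan_Suc_atMost simp del: upt_Suc RX_simps)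
    finally have "clI (partial i g) \<odot>\<^bsub>E.ext\<^esub> \<omega> = \<zero>\<^bsub>E.ext\<^esub>"
      unfolding \<omega>_def using g ig
      by (intro E.w_linear_relation[OF dx_list, where c = "\<lambda>l. clI (partial l g)"]) auto
    then show "p \<in> ?H" using g ig by simp
  qed
  ultimately have "J \<subseteq> ?H" unfolding J_def by (rule S.genideal_minimal)
  then show ?thesis using assms by blast
qed

section \<open>The induced derivations and the Jacobian determinant\<close>

lemma delta_exists:
  assumes i: "i \<le> n"
  shows "\<exists>k\<in>linear_maps R K.\<Omega> N. \<forall>p\<in>carrier S. k (K.d (clI p)) = clJ (partial i p)"
proof -
  define D where "D A = clJ (partial i (SOME p. p \<in> A))" for A
  have D: "D (clI p) = clJ (partial i p)" if p: "p \<in> carrier S" for p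
  proof -
    have "(SOME q. q \<in> clI p) \<in> clI p"
      using coord_coset_self[OF I p] by (rule someI)
    note q = coord_coset_memberD[OF I this p]
    \<comment> \<open>Independence of the representative: two of them differ by an element of
      \<open>I\<close>, whose derivative lies in \<open>J\<close>, though not in general in
      \<open>I\<close>.\<close>
    have "partial i (SOME q. q \<in> clI p) - partial i p \<in> J"
      using partial_I[OF i q(2)] by (simp add: partial_diff)
    then show ?thesis using q(1) p by (simp add: D_def coord_coset_eq_iff[OF J])
  qed
  show ?thesis
  proof (rule K.derivation_lift[OF N_module, of D])
    show "D \<in> carrier R \<rightarrow> carrier N"
      by (auto elim!: coord_coset_cases[OF I] simp: D)
    show "D (a \<oplus>\<^bsub>R\<^esub> b) = D a \<oplus>\<^bsub>N\<^esub> D b" if "a \<in> carrier R" "b \<in> carrier R" for a b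
      using that by (auto elim!: coord_coset_cases[OF I]
          simp: D coord_coset_add[OF I] coord_coset_add[OF J] partial_add)
    show "D (a \<otimes>\<^bsub>R\<^esub> b) = a \<odot>\<^bsub>N\<^esub> D b \<oplus>\<^bsub>N\<^esub> b \<odot>\<^bsub>N\<^esub> D a" if "a \<in> carrier R" "b \<in> carrier R" for a b
      using that by (auto elim!: coord_coset_cases[OF I]
          simp: D R_mult N_smult coord_coset_add[OF J] partial_mult)
    show "D c = \<zero>\<^bsub>N\<^esub>" if "c \<in> RX_consts n I" for c
      using that by (auto simp: RX_consts_def D coord_coset_zero[OF J])
    show ?thesis if "k \<in> linear_maps R K.\<Omega> N" "\<And>a. a \<in> carrier R \<Longrightarrow> k (K.d a) = D a" for k
      using that D by (intro bexI[of _ k]) auto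
  qed
qed

text \<open>The choice is only a name: the values on the differentials of classes determine a linear
  map on all of \<open>K.\<Omega>\<close>.\<close>

definition "\<delta> i = (SOME k. k \<in> linear_maps R K.\<Omega> N \<and> (\<forall>p\<in>carrier S. k (K.d (clI p)) = clJ (partial i p)))"

lemma
  assumes "i \<le> n"
  shows \<delta>_linear: "\<delta> i \<in> linear_maps R K.\<Omega> N"
    and \<delta>_d: "p \<in> carrier S \<Longrightarrow> \<delta> i (K.d (clI p)) = clJ (partial i p)"
proof -
  have "\<delta> i \<in> linear_maps R K.\<Omega> N \<and> (\<forall>p\<in>carrier S. \<delta> i (K.d (clI p)) = clJ (partial i p))"
    unfolding \<delta>_def by (rule someI_ex[OF delta_exists[OF assms, unfolded Bex_def]])
  then show "\<delta> i \<in> linear_maps R K.\<Omega> N"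
    and "p \<in> carrier S \<Longrightarrow> \<delta> i (K.d (clI p)) = clJ (partial i p)"
    by auto
qed

definition "rep A = (SOME p. p \<in> A)" for A :: "'k mpoly set"

lemma
  assumes "A \<in> carrier N"
  shows rep_closed: "rep A \<in> carrier S" and clJ_rep: "clJ (rep A) = A"
proof -
  from assms obtain p where p: "p \<in> carrier S" "A = clJ p" by (auto elim: coord_coset_cases[OF J])
  have "rep A \<in> clJ p"
    unfolding rep_def p(2) using coord_coset_self[OF J p(1)] by (rule someI)
  note q = coord_coset_memberD[OF J this p(1)]
  show "rep A \<in> carrier S" by (rule q(1))
  show "clJ (rep A) = A" using q p by (simp add: coord_coset_eq_iff[OF J])
qed

text \<open>Rows belong to the factors of the wedge and columns to the derivations, so operations on
  the tuple become row operations.\<close>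

definition "jac xs = clJ (fun_det (Suc n) (\<lambda>l j. rep (\<delta> j (xs ! l))))"

lemma \<delta>_closed:
  assumes "xs \<in> E.T" "l < Suc n" "j < Suc n"
  shows "\<delta> j (xs ! l) \<in> carrier N"
proof -
  have "xs ! l \<in> carrier K.\<Omega>" using assms by (auto simp: tuples_def)
  then show ?thesis using assms(3) by (intro linear_mapsD(1)[OF \<delta>_linear]) simp_all
qed

text \<open>The representatives built into \<open>jac\<close> may be exchanged for convenient ones:
  sums, multiples or forms.\<close>

lemma jac_eq:
  assumes xs: "xs \<in> E.T"
    and p: "\<And>l j. l < Suc n \<Longrightarrow> j < Suc n \<Longrightarrow> p l j \<in> carrier S"
    and eq: "\<And>l j. l < Suc n \<Longrightarrow> j < Suc n \<Longrightarrow> \<delta> j (xs ! l) = clJ (p l j)"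
  shows "jac xs = clJ (fun_det (Suc n) p)"
proof -
  have "rep (\<delta> j (xs ! l)) \<in> carrier S" "rep (\<delta> j (xs ! l)) - p l j \<in> J"
    if "l < Suc n" "j < Suc n" for l j
  proof -
    note closed = \<delta>_closed[OF xs that]
    show r: "rep (\<delta> j (xs ! l)) \<in> carrier S" by (rule rep_closed[OF closed])
    show "rep (\<delta> j (xs ! l)) - p l j \<in> J"
      using clJ_rep[OF closed] eq[OF that] coord_coset_eq_iff[OF J r p[OF that]] by simp
  qed
  then show ?thesis
    unfolding jac_def using p
    by (subst coord_coset_eq_iff[OF J]) (auto intro!: fun_det_closed fun_det_diff[OF J])
qed

lemma rep_\<delta>:
  assumes "x \<in> carrier K.\<Omega>" "j < Suc n"
  shows "rep (\<delta> j x) \<in> carrier S" "clJ (rep (\<delta> j x)) = \<delta> j x"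
proof -
  have closed: "\<delta> j x \<in> carrier N"
    using assms by (intro linear_mapsD(1)[OF \<delta>_linear]) simp_all
  show "rep (\<delta> j x) \<in> carrier S" by (rule rep_closed[OF closed])
  show "clJ (rep (\<delta> j x)) = \<delta> j x" by (rule clJ_rep[OF closed])
qed

text \<open>The other rows keep the representatives fixed by \<open>rep\<close>, so the matrices
  compared for multilinearity differ in row \<open>i\<close> alone.\<close>

lemma jac_update:
  assumes xs: "xs \<in> E.T" and i: "i < Suc n" and x: "x \<in> carrier K.\<Omega>"
    and v: "\<And>j. j < Suc n \<Longrightarrow> v j \<in> carrier S" "\<And>j. j < Suc n \<Longrightarrow> \<delta> j x = clJ (v j)"
  shows "jac (xs[i := x]) = clJ (fun_det (Suc n) ((\<lambda>l j. rep (\<delta> j (xs ! l)))(i := v)))"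
proof -
  have len: "length xs = Suc n" and xsl: "\<And>l. l < Suc n \<Longrightarrow> xs ! l \<in> carrier K.\<Omega>"
    using xs by (auto simp: tuples_def)
  show ?thesis
    using len i v rep_\<delta>[OF xsl]
    by (intro jac_eq tuples_update xs x) (auto simp: nth_list_update)
qed

lemma jac_update_closed:
  assumes xs: "xs \<in> E.T" and v: "\<And>j. j < Suc n \<Longrightarrow> v j \<in> carrier S"
  shows "fun_det (Suc n) ((\<lambda>l j. rep (\<delta> j (xs ! l)))(i := v)) \<in> carrier S"
  using v rep_\<delta>(1)[OF tuples_nth[OF xs]] by (intro fun_det_closed) auto

lemma jacobian_map_exists:
  "\<exists>k\<in>linear_maps R E.ext N. \<forall>xs\<in>E.T. k (E.w xs) = jac xs"
proof (rule E.alternating_lift[OF N_module, of jac])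
  show "jac \<in> E.T \<rightarrow> carrier N"
    unfolding jac_def using rep_\<delta>(1)[OF tuples_nth]
    by (auto intro!: clJ_closed fun_det_closed)
  show "jac (xs[i := x \<oplus>\<^bsub>K.\<Omega>\<^esub> y]) = jac (xs[i := x]) \<oplus>\<^bsub>N\<^esub> jac (xs[i := y])"
    if "xs \<in> E.T" "i < Suc n" "x \<in> carrier K.\<Omega>" "y \<in> carrier K.\<Omega>" for xs i x y
  proof -
    note x = rep_\<delta>[OF that(3)] and y = rep_\<delta>[OF that(4)]
    \<comment> \<open>The sum of the chosen representatives need not be the chosen representative of
      the sum, but it represents the same class.\<close>
    have "\<delta> j (x \<oplus>\<^bsub>K.\<Omega>\<^esub> y) = clJ (rep (\<delta> j x) + rep (\<delta> j y))" if j: "j < Suc n" for j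
      using linear_mapsD(2)[OF \<delta>_linear \<open>x \<in> _\<close> \<open>y \<in> _\<close>, of j] x[OF j] y[OF j] j
        coord_coset_add[OF J x(1)[OF j] y(1)[OF j]] by simp
    then have "jac (xs[i := x \<oplus>\<^bsub>K.\<Omega>\<^esub> y]) =
      clJ (fun_det (Suc n) ((\<lambda>l j. rep (\<delta> j (xs ! l)))(i := (\<lambda>j. rep (\<delta> j x) + rep (\<delta> j y)))))"
      using x y that by (intro jac_update K.\<Omega>.M.a_closed coord_ring_closed)
    also have "\<dots> = jac (xs[i := x]) \<oplus>\<^bsub>N\<^esub> jac (xs[i := y])"
      using x y that jac_update_closed[OF that(1)]
      by (simp add: fun_det_row_add coord_coset_add[OF J] jac_update[where v = "\<lambda>j. rep (\<delta> j x)"]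
          jac_update[where v = "\<lambda>j. rep (\<delta> j y)"])
    finally show ?thesis .
  qed
  show "jac (xs[i := a \<odot>\<^bsub>K.\<Omega>\<^esub> x]) = a \<odot>\<^bsub>N\<^esub> jac (xs[i := x])"
    if "xs \<in> E.T" "i < Suc n" "a \<in> carrier R" "x \<in> carrier K.\<Omega>" for xs i a x
  proof -
    obtain p where p: "p \<in> carrier S" "a = clI p"
      using \<open>a \<in> _\<close> by (auto elim: coord_coset_cases[OF I])
    note x = rep_\<delta>[OF that(4)]
    have "\<delta> j (a \<odot>\<^bsub>K.\<Omega>\<^esub> x) = clJ (p * rep (\<delta> j x))" if j: "j < Suc n" for j
      using linear_mapsD(3)[OF \<delta>_linear \<open>a \<in> _\<close> \<open>x \<in> _\<close>, of j] x[OF j] j N_smult[OF p(1) x(1)[OF j]] p(2)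
      by simp
    then have "jac (xs[i := a \<odot>\<^bsub>K.\<Omega>\<^esub> x]) =
      clJ (fun_det (Suc n) ((\<lambda>l j. rep (\<delta> j (xs ! l)))(i := (\<lambda>j. p * rep (\<delta> j x)))))"
      using x p(1) that by (intro jac_update K.\<Omega>.smult_closed coord_ring_closed)
    also have "\<dots> = a \<odot>\<^bsub>N\<^esub> jac (xs[i := x])"
      using x p that jac_update_closed[OF that(1)]
      by (simp add: fun_det_row_smult N_smult jac_update[where v = "\<lambda>j. rep (\<delta> j x)"])
    finally show ?thesis .
  qed
  show "jac xs = \<zero>\<^bsub>N\<^esub>" if "xs \<in> E.T" "i < j" "j < Suc n" "xs ! i = xs ! j" for xs i j
  proof -
    \<comment> \<open>Equal entries of \<open>xs\<close> give rows that are equal as polynomials and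
      not merely modulo \<open>J\<close>, since \<open>rep\<close> is a function of the
      coset.\<close>
    have "fun_det (Suc n) (\<lambda>l j. rep (\<delta> j (xs ! l))) = 0"
      using that by (intro fun_det_identical_rows[of i j]) auto
    then show ?thesis by (simp add: jac_def coord_coset_zero[OF J])
  qed
  show ?thesis if "k \<in> linear_maps R E.ext N" "\<And>xs. xs \<in> E.T \<Longrightarrow> k (E.w xs) = jac xs" for k
    using that by blast
qed

section \<open>The isomorphism with S/J\<close>

definition "\<phi> = (SOME k. k \<in> linear_maps R E.ext N \<and> (\<forall>xs\<in>E.T. k (E.w xs) = jac xs))"

lemma
  shows \<phi>_linear: "\<phi> \<in> linear_maps R E.ext N"
    and \<phi>_w: "xs \<in> E.T \<Longrightarrow> \<phi> (E.w xs) = jac xs"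
proof -
  have "\<phi> \<in> linear_maps R E.ext N \<and> (\<forall>xs\<in>E.T. \<phi> (E.w xs) = jac xs)"
    unfolding \<phi>_def by (rule someI_ex[OF jacobian_map_exists[unfolded Bex_def]])
  then show "\<phi> \<in> linear_maps R E.ext N" and "xs \<in> E.T \<Longrightarrow> \<phi> (E.w xs) = jac xs"
    by auto
qed

text \<open>The Jacobian matrix of the variables X_0, ..., X_n is the identity.\<close>

lemma \<phi>_\<omega>: "\<phi> \<omega> = clJ 1"
proof -
  have "jac (map dx [0..<Suc n]) = clJ (fun_det (Suc n) (\<lambda>l j. if l = j then 1 else 0))"
    by (rule jac_eq[OF dx_list]) (auto simp: \<delta>_d partial_var simp del: upt_Suc)
  then show ?thesis by (simp add: \<omega>_def \<phi>_w[OF dx_list] fun_det_one del: upt_Suc)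
qed

lemma \<phi>_smult_\<omega>: "p \<in> carrier S \<Longrightarrow> \<phi> (clI p \<odot>\<^bsub>E.ext\<^esub> \<omega>) = clJ p"
  using linear_mapsD(3)[OF \<phi>_linear _ \<omega>_closed, of "clI p"] by (simp add: \<phi>_\<omega> N_smult)

lemma \<phi>_bij: "bij_betw \<phi> (carrier E.ext) (carrier N)"
  unfolding bij_betw_def
proof
  show "inj_on \<phi> (carrier E.ext)"
  proof (rule inj_onI)
    fix x y assume x: "x \<in> carrier E.ext" and y: "y \<in> carrier E.ext" and eq: "\<phi> x = \<phi> y"
    obtain p q where p: "p \<in> carrier S" "x = clI p \<odot>\<^bsub>E.ext\<^esub> \<omega>"
      and q: "q \<in> carrier S" "y = clI q \<odot>\<^bsub>E.ext\<^esub> \<omega>"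
      by (metis ext_cases x y)
    have "p - q \<in> J" using eq p q by (simp add: \<phi>_smult_\<omega> coord_coset_eq_iff[OF J])
    then have zero: "clI (p - q) \<odot>\<^bsub>E.ext\<^esub> \<omega> = \<zero>\<^bsub>E.ext\<^esub>" by (rule \<omega>_annihilated)
    have pq: "p - q \<in> carrier S" using p(1) q(1) by simp
    \<comment> \<open>Splitting \<open>p\<close> as \<open>(p - q) + q\<close> isolates the part
      that annihilates \<omega>.\<close>
    have "x = (clI (p - q) \<oplus>\<^bsub>R\<^esub> clI q) \<odot>\<^bsub>E.ext\<^esub> \<omega>"
      using p q pq by (simp add: coord_coset_add[OF I])
    also have "\<dots> = clI (p - q) \<odot>\<^bsub>E.ext\<^esub> \<omega> \<oplus>\<^bsub>E.ext\<^esub> clI q \<odot>\<^bsub>E.ext\<^esub> \<omega>"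
      using pq q(1) by (intro E.ext.smult_l_distr \<omega>_closed clI_R)
    also have "\<dots> = y" using y by (simp add: zero flip: q(2))
    finally show "x = y" .
  qed
  show "\<phi> ` carrier E.ext = carrier N"
  proof
    show "\<phi> ` carrier E.ext \<subseteq> carrier N"
      by (rule image_subsetI) (rule linear_mapsD(1)[OF \<phi>_linear])
    show "carrier N \<subseteq> \<phi> ` carrier E.ext"
    proof
      fix A assume "A \<in> carrier N"
      then obtain p where p: "p \<in> carrier S" "A = clJ p" by (auto elim: coord_coset_cases[OF J])
      have "clI p \<odot>\<^bsub>E.ext\<^esub> \<omega> \<in> carrier E.ext"
        using p(1) by (intro E.ext.smult_closed \<omega>_closed clI_R)
      then show "A \<in> \<phi> ` carrier E.ext"
        unfolding p(2) \<phi>_smult_\<omega>[OF p(1), symmetric] by (rule imageI)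
    qed
  qed
qed

section \<open>Degrees of differentials and wedges\<close>

abbreviation "gr\<Omega> \<equiv> kaehler_grading R (RX_consts n I) (quot_grading n I)"
abbreviation "gr_ext \<equiv> ext_grading R (quot_grading n I) (Suc n) K.\<Omega> gr\<Omega>"

lemma quot_grading_I_subset: "quot_grading n I e \<subseteq> carrier R"
  by (auto simp: quot_grading_def forms_subset)

lemma gr\<Omega>_generators_closed:
  "{a \<odot>\<^bsub>K.\<Omega>\<^esub> K.d b | a b i j. a \<in> quot_grading n I i \<and> b \<in> quot_grading n I j \<and> i + j = e}
    \<subseteq> carrier K.\<Omega>"
proof
  fix x assume "x \<in> {a \<odot>\<^bsub>K.\<Omega>\<^esub> K.d b | a b i j.
    a \<in> quot_grading n I i \<and> b \<in> quot_grading n I j \<and> i + j = e}"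
  then obtain a b i j where x: "x = a \<odot>\<^bsub>K.\<Omega>\<^esub> K.d b" "a \<in> quot_grading n I i" "b \<in> quot_grading n I j"
    by blast
  then have "a \<in> carrier R" "b \<in> carrier R"
    using subsetD[OF quot_grading_I_subset] by blast+
  then show "x \<in> carrier K.\<Omega>"
    unfolding x(1) by (intro K.\<Omega>.smult_closed K.d_closed)
qed

lemma gr\<Omega>_closed: "gr\<Omega> e \<subseteq> carrier K.\<Omega>"
  unfolding kaehler_grading_def
  by (rule K.\<Omega>.M.generate_closed[OF gr\<Omega>_generators_closed])

lemma dx_gr\<Omega>: "i \<le> n \<Longrightarrow> dx i \<in> gr\<Omega> 1"
proof -
  assume i: "i \<le> n"
  have "dx i = clI 1 \<odot>\<^bsub>K.\<Omega>\<^esub> K.d (clI (var_poly i))"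
    using K.\<Omega>.smult_one[OF dx_closed[OF i]] by simp
  moreover have "clI 1 \<in> quot_grading n I 0" "clI (var_poly i) \<in> quot_grading n I 1"
    using forms_closed(2,4) i by (auto simp: quot_grading_def)
  ultimately have "dx i \<in> {a \<odot>\<^bsub>K.\<Omega>\<^esub> K.d b | a b i j.
      a \<in> quot_grading n I i \<and> b \<in> quot_grading n I j \<and> i + j = 1}"
    by force
  then show ?thesis unfolding kaehler_grading_def by (rule generate.incl)
qed

text \<open>On a generator p dq the value is the class of p \<partial>q/\<partial>X_i, one degree
  lower. The bound extends to the generated group because preimages of additive subgroups are
  additive subgroups.\<close>

lemma \<delta>_gr\<Omega>:
  assumes i: "i \<le> n" and x: "x \<in> gr\<Omega> e"
  shows "\<delta> i x \<in> quot_grading n J (e - 1)"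
proof -
  let ?H = "{x \<in> carrier K.\<Omega>. \<delta> i x \<in> quot_grading n J (e - 1)}"
  have "additive_subgroup ?H K.\<Omega>"
    by (rule additive_subgroup_vimage[OF K.\<Omega>_module N_module \<delta>_linear[OF i] quot_grading_additive_subgroup])
  moreover have "{a \<odot>\<^bsub>K.\<Omega>\<^esub> K.d b | a b i j.
      a \<in> quot_grading n I i \<and> b \<in> quot_grading n I j \<and> i + j = e} \<subseteq> ?H"
  proof
    fix x assume x: "x \<in> {a \<odot>\<^bsub>K.\<Omega>\<^esub> K.d b | a b i j.
      a \<in> quot_grading n I i \<and> b \<in> quot_grading n I j \<and> i + j = e}"
    then obtain p q j k where pq: "x = clI p \<odot>\<^bsub>K.\<Omega>\<^esub> K.d (clI q)" "p \<in> forms n j" "q \<in> forms n k" "j + k = e"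
      by (auto simp: quot_grading_def)
    note closed = forms_subset[OF pq(2)] forms_subset[OF pq(3)]
    have "\<delta> i x = clI p \<odot>\<^bsub>N\<^esub> \<delta> i (K.d (clI q))"
      unfolding pq(1) using closed
      by (intro linear_mapsD(3)[OF \<delta>_linear[OF i]] K.d_closed clI_R)
    also have "\<dots> = clJ (p * partial i q)"
      using closed i by (simp add: \<delta>_d N_smult)
    finally have "\<delta> i x = clJ (p * partial i q)" .
    moreover have "p * partial i q \<in> forms n (e - 1)"
      using forms_closed(7)[OF pq(2) partial_forms[OF pq(3) i]] pq(4) by (simp add: algebra_simps)
    moreover have "x \<in> carrier K.\<Omega>" using gr\<Omega>_generators_closed x by blast
    ultimately show "x \<in> ?H" by (auto simp: quot_grading_def)
  qed
  ultimately have "gr\<Omega> e \<subseteq> ?H"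
    unfolding kaehler_grading_def by (intro K.\<Omega>.M.generate_subset_additive_subgroup)
  then show ?thesis using x by blast
qed

lemma graded_tuple:
  assumes "length xs = Suc n" "\<And>l. l < Suc n \<Longrightarrow> xs ! l \<in> gr\<Omega> (ds ! l)"
  shows "xs \<in> E.T"
  using assms gr\<Omega>_closed by (fastforce simp: tuples_def in_set_conv_nth)

text \<open>Each of the \<open>Suc n\<close> rows loses one degree, and this total loss is the shift
  of the theorem.\<close>

lemma jac_graded:
  assumes len: "length xs = Suc n" "length ds = Suc n"
    and gr: "\<And>l. l < Suc n \<Longrightarrow> xs ! l \<in> gr\<Omega> (ds ! l)"
  shows "\<exists>q\<in>forms n (sum_list ds - int (Suc n)). jac xs = clJ q"
proof -
  have "\<exists>p. p \<in> forms n (ds ! l - 1) \<and> \<delta> j (xs ! l) = clJ p" if "l < Suc n" "j < Suc n" for l j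
    using \<delta>_gr\<Omega>[OF _ gr[OF that(1)], of j] that(2) by (auto simp: quot_grading_def)
  then have "\<forall>l j. \<exists>p. l < Suc n \<longrightarrow> j < Suc n \<longrightarrow> p \<in> forms n (ds ! l - 1) \<and> \<delta> j (xs ! l) = clJ p"
    by blast
  then obtain p where p: "\<And>l j. l < Suc n \<Longrightarrow> j < Suc n \<Longrightarrow> p l j \<in> forms n (ds ! l - 1)"
      "\<And>l j. l < Suc n \<Longrightarrow> j < Suc n \<Longrightarrow> \<delta> j (xs ! l) = clJ (p l j)"
    by metis
  \<comment> \<open>Representatives chosen by \<open>rep\<close> need not be homogeneous;
    \<open>jac_eq\<close> replaces them by forms.\<close>
  have "jac xs = clJ (fun_det (Suc n) p)"
    using p by (intro jac_eq graded_tuple[OF len(1) gr] forms_subset[OF p(1)])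
  moreover have "fun_det (Suc n) p \<in> forms n (\<Sum>l = 0..<Suc n. ds ! l - 1)"
    using p(1) by (rule fun_det_forms)
  moreover have "(\<Sum>l = 0..<Suc n. ds ! l - 1) = sum_list ds - int (Suc n)"
    by (simp add: sum_list_sum_nth len(2) sum_subtractf del: sum.op_ivl_Suc)
  ultimately show ?thesis by metis
qed

lemma gr_ext_generators_closed:
  "{a \<odot>\<^bsub>E.ext\<^esub> E.w xs | a xs i ds. a \<in> quot_grading n I i \<and> length xs = Suc n \<and>
      length ds = Suc n \<and> (\<forall>l<Suc n. xs ! l \<in> gr\<Omega> (ds ! l)) \<and> i + sum_list ds = e} \<subseteq> carrier E.ext"
proof
  fix x assume "x \<in> {a \<odot>\<^bsub>E.ext\<^esub> E.w xs | a xs i ds. a \<in> quot_grading n I i \<and> length xs = Suc n \<and>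
      length ds = Suc n \<and> (\<forall>l<Suc n. xs ! l \<in> gr\<Omega> (ds ! l)) \<and> i + sum_list ds = e}"
  then obtain a xs i ds where x: "x = a \<odot>\<^bsub>E.ext\<^esub> E.w xs" "a \<in> quot_grading n I i" "length xs = Suc n"
      "\<And>l. l < Suc n \<Longrightarrow> xs ! l \<in> gr\<Omega> (ds ! l)"
    by blast
  have "a \<in> carrier R" using subsetD[OF quot_grading_I_subset x(2)] .
  then show "x \<in> carrier E.ext"
    unfolding x(1) by (intro E.ext.smult_closed E.w_closed graded_tuple[OF x(3,4)])
qed

lemma gr_ext_closed: "gr_ext e \<subseteq> carrier E.ext"
  unfolding ext_grading_def
  by (rule E.ext.M.generate_closed[OF gr_ext_generators_closed])

text \<open>Degrees are counted on generators of the component only. Conversely, p \<omega> is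
  itself such a generator, as every dx_i has degree 1.\<close>

lemma \<phi>_gr_ext: "\<phi> ` gr_ext e = shift (- int n - 1) (quot_grading n J) e"
proof -
  let ?X = "{a \<odot>\<^bsub>E.ext\<^esub> E.w xs | a xs i ds. a \<in> quot_grading n I i \<and> length xs = Suc n \<and>
      length ds = Suc n \<and> (\<forall>l<Suc n. xs ! l \<in> gr\<Omega> (ds ! l)) \<and> i + sum_list ds = e}"
  let ?Y = "quot_grading n J (e - int (Suc n))"
  have img: "\<phi> ` gr_ext e = generate (add_monoid N) (\<phi> ` ?X)"
    unfolding ext_grading_def
    by (rule linear_map_generate[OF E.ext_module N_module \<phi>_linear gr_ext_generators_closed])
  have "\<phi> ` ?X \<subseteq> ?Y"
  proof
    fix y assume "y \<in> \<phi> ` ?X"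
    then obtain a xs i ds where y: "y = \<phi> (a \<odot>\<^bsub>E.ext\<^esub> E.w xs)" "a \<in> quot_grading n I i"
      "length xs = Suc n" "length ds = Suc n" "\<And>l. l < Suc n \<Longrightarrow> xs ! l \<in> gr\<Omega> (ds ! l)" "i + sum_list ds = e"
      by blast
    obtain p where p: "p \<in> forms n i" "a = clI p" using y(2) by (auto simp: quot_grading_def)
    obtain q where q: "q \<in> forms n (sum_list ds - int (Suc n))" "jac xs = clJ q"
      using jac_graded[OF y(3,4,5)] by blast
    note closed = forms_subset[OF p(1)] forms_subset[OF q(1)]
    have xs: "xs \<in> E.T" by (rule graded_tuple[OF y(3,5)])
    have "y = a \<odot>\<^bsub>N\<^esub> \<phi> (E.w xs)"
      unfolding y(1) p(2) using closed by (intro linear_mapsD(3)[OF \<phi>_linear] E.w_closed xs clI_R)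
    also have "\<dots> = clJ (p * q)"
      using closed by (simp add: \<phi>_w[OF xs] p(2) q(2) N_smult)
    finally have "y = clJ (p * q)" .
    moreover have "p * q \<in> forms n (e - int (Suc n))"
      using forms_closed(7)[OF p(1) q(1)] y(6) by (simp add: algebra_simps)
    ultimately show "y \<in> ?Y" by (auto simp: quot_grading_def)
  qed
  then have "\<phi> ` gr_ext e \<subseteq> ?Y"
    unfolding img by (rule N.M.generate_subset_additive_subgroup[OF _ quot_grading_additive_subgroup])
  moreover have "?Y \<subseteq> \<phi> ` gr_ext e"
  proof
    fix y assume "y \<in> ?Y"
    then obtain p where p: "p \<in> forms n (e - int (Suc n))" "y = clJ p" by (auto simp: quot_grading_def)
    \<comment> \<open>The witnesses are \<open>p\<close> of degree \<open>e - int (Suc n)\<close>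
      and the factors dx_0, ..., dx_n with the constant degree list 1.\<close>
    have "clI p \<odot>\<^bsub>E.ext\<^esub> \<omega> \<in> ?X"
    proof (intro CollectI exI conjI allI impI)
      show "clI p \<odot>\<^bsub>E.ext\<^esub> \<omega> = clI p \<odot>\<^bsub>E.ext\<^esub> E.w (map dx [0..<Suc n])"
        by (simp only: \<omega>_def)
      show "clI p \<in> quot_grading n I (e - int (Suc n))" using p(1) by (auto simp: quot_grading_def)
      show "length (replicate (Suc n) (1::int)) = Suc n" by simp
      show "map dx [0..<Suc n] ! l \<in> gr\<Omega> (replicate (Suc n) 1 ! l)" if "l < Suc n" for l
        using dx_gr\<Omega>[of l] that by (simp del: upt_Suc replicate_Suc)
      show "e - int (Suc n) + sum_list (replicate (Suc n) 1) = e"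
        by (simp add: sum_list_replicate del: replicate_Suc)
    qed simp
    then have "clI p \<odot>\<^bsub>E.ext\<^esub> \<omega> \<in> gr_ext e"
      unfolding ext_grading_def by (rule generate.incl)
    then show "y \<in> \<phi> ` gr_ext e"
      unfolding p(2) \<phi>_smult_\<omega>[OF forms_subset[OF p(1)], symmetric] by (rule imageI)
  qed
  \<comment> \<open>\<open>shift a\<close> takes degree \<open>a + e\<close> of the original module,
    so \<open>- int n - 1\<close> removes the degree of \<omega>.\<close>
  moreover have "e - int (Suc n) = - int n - 1 + e" by simp
  ultimately show ?thesis unfolding shift_def by (metis subset_antisym)
qed

lemma top_differentials_graded_isomorphic:
  "graded_isomorphic R (quot_grading n I) E.ext gr_ext N (shift (- int n - 1) (quot_grading n J))"
  by (rule graded_isomorphicI[OF E.ext_module quot_graded_module[OF component_J] \<phi>_linear \<phi>_bij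
        gr_ext_closed \<phi>_gr_ext quot_grading_I_subset])

end

section \<open>Application to zero-dimensional subschemes\<close>

theorem corollary2p3:
  fixes n r :: nat
    and I :: "'k::field_char_0 mpoly set"
    and F :: "nat \<Rightarrow> 'k mpoly"
  assumes "n \<ge> 1"
    and "zero_dim_subscheme n I"
    and "\<forall>j\<in>{1..r}. homogeneous n (F j)"
    and "I = genideal (coord_ring n) (F ` {1..r})"
  shows "graded_isomorphic (RX n I) (quot_grading n I)
           (Omega (n + 1) n I) (Omega_grading (n + 1) n I)
           (quot_as_module n (jacobian_ideal n r F))
           (shift (- int n - 1) (quot_grading n (jacobian_ideal n r F)))"
proof -
  \<comment> \<open>A chain of length zero is a single point, so having dimension zero supplies
    one.\<close>
  obtain P where "P \<in> proj_points n I"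
    using assms(2) by (auto simp: zero_dim_subscheme_def proj_dim_is_def has_point_chain_def)
  then have P: "primeideal P (coord_ring n)" "I \<subseteq> P"
    by (simp_all add: proj_points_def)
  \<comment> \<open>A point is a prime, hence proper, ideal containing \<open>I\<close>.\<close>
  have "I \<noteq> carrier (coord_ring n)"
  proof
    assume "I = carrier (coord_ring n)"
    then have "1 \<in> P" using P(2) by auto
    then have "P = carrier (coord_ring n)"
      using ideal.one_imp_carrier[OF primeideal.axioms(1)[OF P(1)]] by simp
    then show False using primeideal.I_notcarr[OF P(1)] by simp
  qed
  then have "genideal (coord_ring n) (F ` {1..r}) \<noteq> carrier (coord_ring n)"
    unfolding assms(4) .
  then interpret j: jacobian n "F ` {1..r}"
    using assms(3) by unfold_locales auto
  have I: "j.I = I"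
    unfolding j.I_def by (rule assms(4)[symmetric])
  \<comment> \<open>The derivatives are indexed by \<open>j\<close> on one side and by the generator
    itself on the other; repetitions in \<open>F\<close> do not change the set.\<close>
  have gens: "{partial i (F j) | i j. i \<le> n \<and> j \<in> {1..r}} = {partial i g | i g. i \<le> n \<and> g \<in> F ` {1..r}}"
    by blast
  have J: "j.J = jacobian_ideal n r F"
    unfolding j.J_def jacobian_ideal_def gens ..
  show ?thesis
    using j.top_differentials_graded_isomorphic[unfolded I J]
    unfolding Omega_def Omega_grading_def Omega1_def Omega1_grading_def Suc_eq_plus1 .
qed

end
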